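(* For every composition $\eta\in\mathbb{N}^n$ we have $x^{\underline\eta}=\sum_{G\in\mathcal{G}(\eta)}w(G)$.
   Context: Fix $n\ge1$; $r$ is an indeterminate, $\alpha=1/r$, $\mathbb{F}=\mathbb{Q}(r)$, polynomials lie in $\mathbb{F}[x_1,\dots,x_n]$. Compositions are $\eta\in\mathbb{N}^n$, $|\eta|=\sum\eta_i$, $x^\eta=\prod x_i^{\eta_i}$; partitions are weakly decreasing compositions; $\delta=(n-1,\dots,0)$; permutations act on vectors by $(wv)_{w(i)}=v_i$; for a composition $\gamma$, $w_\gamma$ is the minimal-length permutation with $w_\gamma^{-1}(\gamma)$ a partition, and $\overline\gamma=\gamma+w_\gamma(r\delta)$. Let $E_\eta^{r\delta}$ be the unique polynomial of degree $|\eta|$ vanishing at all $\overline\gamma$ with $\gamma\neq\eta$, $|\gamma|\le|\eta|$, with coefficient $1$ on $x^\eta$, and $E_\eta^{(\alpha)}$ its top homogeneous component. With $a_\eta(i,j)=\eta_i-j$, $l_\eta(i,j)=\#\{k>i:j\le\eta_k\le\eta_i\}+\#\{k<i:j\le\eta_k+1\le\eta_i\}$ and $d_\eta(\alpha)=\prod_{\text{boxes }(i,j),\,1\le j\le\eta_i}(\alpha(a_\eta(i,j)+1)+l_\eta(i,j)+1)$, put $F_\eta^{(\alpha)}=d_\eta E_\eta^{(\alpha)}$, $F_\eta^{r\delta}(x)=(-1)^{|\eta|}d_\eta E_\eta^{r\delta}(-x)$; $\Xi$ is the unique $\mathbb{F}$-linear operator with $\Xi(F_\eta^{(\alpha)})=F_\eta^{r\delta}$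 for all $\eta$, and $x^{\underline\eta}=\Xi(x^\eta)$. Combinatorics. For $\eta\ne0$ let $m=\max_i\eta_i$ and $k=\min\{i:\eta_i=m\}$ (critical row); the critical leg is $l[\eta]=\#\{i>k:\eta_i=m\}+\#\{i<k:\eta_i=m-1\}$. Let $\eta^*$ be $\eta$ with $\eta_k$ replaced by $m-1$. A glissade $\eta\gtrdot\gamma$ means: either $\gamma=\eta^*$, or there exist $j\ne k$ and an integer $l>0$ with $\gamma_j=\eta_j+l$, $\gamma_k=m-1-l$, $\gamma_i=\eta_i$ for $i\ne j,k$, and $\varepsilon=m-1-\eta_j-l$ satisfies $\varepsilon>0$ if $j<k$ and $\varepsilon\ge0$ if $j>k$ (i.e., after deleting the box $(k,m)$, $l$ boxes are moved from the end of row $k$ to the end of row $j$, landing above and strictly left or below and weakly left of their old positions). The weight of $\eta$ is $w_\eta=x_k+(m-1)+r(n-1-l[\eta])$, and the weight of $\eta\gtrdot\gamma$ is $w_\eta$ if $\gamma=\eta^*$ and $r$ otherwise. A bar game on $\eta$ is a chain $\eta=\eta^{(0)}\gtrdot\eta^{(1)}\gtrdot\cdots\gtrdot\eta^{(d)}=0$ with $d=|\eta|$; its weight $w(G)$ is the product of the weights of its $d$ steps. $\mathcal{G}(\eta)$ is the set of bar games on $\eta$ (for $\eta=0$ it consists of the empty game of weight $1$). *)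

theory Defs
  imports
    "HOL-Library.Poly_Mapping"
    "HOL-Library.FuncSet"
    "HOL-Computational_Algebra.Polynomial"
    "HOL-Computational_Algebra.Fraction_Field"
    "HOL-Combinatorics.Permutations"
begin

(* The field Q(r). *)
type_synonym ratfun = "rat poly fract"

definition rvar :: ratfun where
  "rvar = Fract [:0, 1:] 1"

definition alpha :: ratfun where
  "alpha = 1 / rvar"

(* Compositions are the exponent vectors supported on {1..n}; polynomials in x_1, ..., x_n are
   the elements of the monoid algebra of nat \<Rightarrow>\<^sub>0 nat (with its convolution product) all of whose
   exponents are compositions. *)
type_synonym expo = "nat \<Rightarrow>\<^sub>0 nat"
type_synonym 'a mvpoly = "expo \<Rightarrow>\<^sub>0 'a"

definition compositions :: "nat \<Rightarrow> expo set" where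
  "compositions n = {\<eta>. Poly_Mapping.keys \<eta> \<subseteq> {1..n}}"

definition csize :: "expo \<Rightarrow> nat" where
  "csize \<eta> = (\<Sum>i\<in>Poly_Mapping.keys \<eta>. Poly_Mapping.lookup \<eta> i)"

definition polys :: "nat \<Rightarrow> ratfun mvpoly set" where
  "polys n = {p. Poly_Mapping.keys p \<subseteq> compositions n}"

definition Const :: "'a::zero \<Rightarrow> 'a mvpoly" where
  "Const c = Poly_Mapping.single 0 c"

definition monomial :: "expo \<Rightarrow> 'a::zero_neq_one mvpoly" where
  "monomial \<eta> = Poly_Mapping.single \<eta> 1"

definition X :: "nat \<Rightarrow> 'a::zero_neq_one mvpoly" where
  "X i = monomial (Poly_Mapping.single i 1)"

definition pdegree :: "'a::zero mvpoly \<Rightarrow> nat" where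
  "pdegree p = Max (insert 0 (csize ` Poly_Mapping.keys p))"

definition top_component :: "'a::comm_monoid_add mvpoly \<Rightarrow> 'a mvpoly" where
  "top_component p = (\<Sum>m | m \<in> Poly_Mapping.keys p \<and> csize m = pdegree p.
     Poly_Mapping.single m (Poly_Mapping.lookup p m))"

definition eval_poly :: "'a::comm_semiring_1 mvpoly \<Rightarrow> (nat \<Rightarrow> 'a) \<Rightarrow> 'a" where
  "eval_poly p v = (\<Sum>m\<in>Poly_Mapping.keys p.
     Poly_Mapping.lookup p m * (\<Prod>i\<in>Poly_Mapping.keys m. v i ^ Poly_Mapping.lookup m i))"

definition subst_poly :: "'a::comm_semiring_1 mvpoly \<Rightarrow> (nat \<Rightarrow> 'a mvpoly) \<Rightarrow> 'a mvpoly" where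
  "subst_poly p f = (\<Sum>m\<in>Poly_Mapping.keys p.
     Const (Poly_Mapping.lookup p m) * (\<Prod>i\<in>Poly_Mapping.keys m. f i ^ Poly_Mapping.lookup m i))"

definition perm_act :: "(nat \<Rightarrow> nat) \<Rightarrow> (nat \<Rightarrow> 'a) \<Rightarrow> nat \<Rightarrow> 'a" where
  "perm_act w v = (\<lambda>j. v (inv w j))"

definition perm_length :: "nat \<Rightarrow> (nat \<Rightarrow> nat) \<Rightarrow> nat" where
  "perm_length n w = card {(i, j). 1 \<le> i \<and> i < j \<and> j \<le> n \<and> w i > w j}"

definition is_partition :: "nat \<Rightarrow> (nat \<Rightarrow> nat) \<Rightarrow> bool" where
  "is_partition n v \<longleftrightarrow> (\<forall>i j. 1 \<le> i \<and> i \<le> j \<and> j \<le> n \<longrightarrow> v j \<le> v i)"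

definition sorting_perms :: "nat \<Rightarrow> expo \<Rightarrow> (nat \<Rightarrow> nat) set" where
  "sorting_perms n \<gamma> =
     {w. w permutes {1..n} \<and> is_partition n (perm_act (inv w) (Poly_Mapping.lookup \<gamma>))}"

definition sort_perm :: "nat \<Rightarrow> expo \<Rightarrow> nat \<Rightarrow> nat" where
  "sort_perm n \<gamma> = (THE w. w \<in> sorting_perms n \<gamma> \<and>
     (\<forall>u \<in> sorting_perms n \<gamma>. perm_length n w \<le> perm_length n u))"

definition delta :: "nat \<Rightarrow> nat \<Rightarrow> nat" where
  "delta n i = n - i"

definition spectral :: "nat \<Rightarrow> expo \<Rightarrow> nat \<Rightarrow> ratfun" where
  "spectral n \<gamma> i = of_nat (Poly_Mapping.lookup \<gamma> i)
     + perm_act (sort_perm n \<gamma>) (\<lambda>j. rvar * of_nat (delta n j)) i"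

definition interp_E :: "nat \<Rightarrow> expo \<Rightarrow> ratfun mvpoly" where
  "interp_E n \<eta> = (THE p. p \<in> polys n \<and> pdegree p = csize \<eta> \<and>
     (\<forall>\<gamma> \<in> compositions n. \<gamma> \<noteq> \<eta> \<and> csize \<gamma> \<le> csize \<eta> \<longrightarrow> eval_poly p (spectral n \<gamma>) = 0) \<and>
     Poly_Mapping.lookup p \<eta> = 1)"

definition jack_E :: "nat \<Rightarrow> expo \<Rightarrow> ratfun mvpoly" where
  "jack_E n \<eta> = top_component (interp_E n \<eta>)"

definition arm :: "expo \<Rightarrow> nat \<Rightarrow> nat \<Rightarrow> nat" where
  "arm \<eta> i j = Poly_Mapping.lookup \<eta> i - j"

definition leg :: "nat \<Rightarrow> expo \<Rightarrow> nat \<Rightarrow> nat \<Rightarrow> nat" where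
  "leg n \<eta> i j =
     card {k \<in> {1..n}. k > i \<and> j \<le> Poly_Mapping.lookup \<eta> k \<and>
       Poly_Mapping.lookup \<eta> k \<le> Poly_Mapping.lookup \<eta> i}
   + card {k \<in> {1..n}. k < i \<and> j \<le> Poly_Mapping.lookup \<eta> k + 1 \<and>
       Poly_Mapping.lookup \<eta> k + 1 \<le> Poly_Mapping.lookup \<eta> i}"

definition d_coeff :: "nat \<Rightarrow> expo \<Rightarrow> ratfun" where
  "d_coeff n \<eta> = (\<Prod>i\<in>{1..n}. \<Prod>j\<in>{1..Poly_Mapping.lookup \<eta> i}.
     alpha * (of_nat (arm \<eta> i j) + 1) + of_nat (leg n \<eta> i j) + 1)"

definition jack_F :: "nat \<Rightarrow> expo \<Rightarrow> ratfun mvpoly" where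
  "jack_F n \<eta> = Const (d_coeff n \<eta>) * jack_E n \<eta>"

definition interp_F :: "nat \<Rightarrow> expo \<Rightarrow> ratfun mvpoly" where
  "interp_F n \<eta> =
     Const ((- 1) ^ csize \<eta> * d_coeff n \<eta>) * subst_poly (interp_E n \<eta>) (\<lambda>i. - X i)"

(* An operator on polys n is an extensional function (undefined outside polys n), so that it is
   determined by its values on polys n. *)
definition linear_operators :: "nat \<Rightarrow> (ratfun mvpoly \<Rightarrow> ratfun mvpoly) set" where
  "linear_operators n = {T \<in> polys n \<rightarrow>\<^sub>E polys n.
     (\<forall>p \<in> polys n. \<forall>q \<in> polys n. T (p + q) = T p + T q) \<and>
     (\<forall>c. \<forall>p \<in> polys n. T (Const c * p) = Const c * T p)}"

definition Xi :: "nat \<Rightarrow> ratfun mvpoly \<Rightarrow> ratfun mvpoly" where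
  "Xi n = (THE T. T \<in> linear_operators n \<and>
     (\<forall>\<eta> \<in> compositions n. T (jack_F n \<eta>) = interp_F n \<eta>))"

definition bar_monomial :: "nat \<Rightarrow> expo \<Rightarrow> ratfun mvpoly" where
  "bar_monomial n \<eta> = Xi n (monomial \<eta>)"

(* The next notions are only meaningful for n \<ge> 1 and nonzero compositions. *)
definition max_part :: "nat \<Rightarrow> expo \<Rightarrow> nat" where
  "max_part n \<eta> = Max (Poly_Mapping.lookup \<eta> ` {1..n})"

definition crit_row :: "nat \<Rightarrow> expo \<Rightarrow> nat" where
  "crit_row n \<eta> = Min {i \<in> {1..n}. Poly_Mapping.lookup \<eta> i = max_part n \<eta>}"

definition crit_leg :: "nat \<Rightarrow> expo \<Rightarrow> nat" where
  "crit_leg n \<eta> =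
     card {i \<in> {1..n}. i > crit_row n \<eta> \<and> Poly_Mapping.lookup \<eta> i = max_part n \<eta>}
   + card {i \<in> {1..n}. i < crit_row n \<eta> \<and> Poly_Mapping.lookup \<eta> i = max_part n \<eta> - 1}"

definition eta_star :: "nat \<Rightarrow> expo \<Rightarrow> expo" where
  "eta_star n \<eta> = Poly_Mapping.update (crit_row n \<eta>) (max_part n \<eta> - 1) \<eta>"

definition glissade :: "nat \<Rightarrow> expo \<Rightarrow> expo \<Rightarrow> bool" where
  "glissade n \<eta> \<gamma> \<longleftrightarrow>
     \<eta> \<in> compositions n \<and> \<eta> \<noteq> 0 \<and> \<gamma> \<in> compositions n \<and>
     (\<gamma> = eta_star n \<eta> \<or>
      (let m = max_part n \<eta>; k = crit_row n \<eta> in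
       \<exists>j \<in> {1..n} - {k}. \<exists>l::nat. l > 0 \<and>
         Poly_Mapping.lookup \<gamma> j = Poly_Mapping.lookup \<eta> j + l \<and>
         int (Poly_Mapping.lookup \<gamma> k) = int m - 1 - int l \<and>
         (\<forall>i \<in> {1..n} - {j, k}. Poly_Mapping.lookup \<gamma> i = Poly_Mapping.lookup \<eta> i) \<and>
         (let eps = int m - 1 - int (Poly_Mapping.lookup \<eta> j) - int l in
           (j < k \<longrightarrow> eps > 0) \<and> (j > k \<longrightarrow> eps \<ge> 0))))"

definition comp_weight :: "nat \<Rightarrow> expo \<Rightarrow> ratfun mvpoly" where
  "comp_weight n \<eta> = X (crit_row n \<eta>)
     + Const (of_nat (max_part n \<eta>) - 1 + rvar * (of_nat n - 1 - of_nat (crit_leg n \<eta>)))"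

definition step_weight :: "nat \<Rightarrow> expo \<Rightarrow> expo \<Rightarrow> ratfun mvpoly" where
  "step_weight n \<eta> \<gamma> = (if \<gamma> = eta_star n \<eta> then comp_weight n \<eta> else Const rvar)"

(* A game is the list of its d + 1 positions, where d is the size of the initial one. *)
definition bar_games :: "nat \<Rightarrow> expo \<Rightarrow> expo list set" where
  "bar_games n \<eta> = {G. length G = csize \<eta> + 1 \<and> G ! 0 = \<eta> \<and> G ! csize \<eta> = 0 \<and>
     (\<forall>t < csize \<eta>. glissade n (G ! t) (G ! Suc t))}"

definition game_weight :: "nat \<Rightarrow> expo list \<Rightarrow> ratfun mvpoly" where
  "game_weight n G = (\<Prod>t < length G - 1. step_weight n (G ! t) (G ! Suc t))"

end

theory Submission
  imports Defs
begin

text \<open>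
  Let \<open>P\<^sub>\<eta>\<close> be the polynomial with leading monomial \<open>x\<^sup>\<eta>\<close> and no other monomial of degree \<open>|\<eta>|\<close> that
  vanishes at the spectral vectors of all \<open>\<gamma>\<close> with \<open>|\<gamma>| < |\<eta>|\<close>.  If \<open>E\<^sub>\<eta>\<close> is the interpolation
  polynomial, then the coefficients expressing its top component in monomials also express \<open>E\<^sub>\<eta>\<close> in the \<open>P\<^sub>\<nu>\<close>;
  hence \<open>\<Xi>\<close> sends \<open>x\<^sup>\<eta>\<close> to \<open>(-1)\<^sup>d P\<^sub>\<eta>(-x)\<close>, where \<open>d = |\<eta>|\<close>.

  For \<open>\<kappa> = \<eta> + e\<^sub>k\<close> the polynomial \<open>x\<^sub>k P\<^sub>\<eta> - P\<^sub>\<kappa>\<close> has degree at most \<open>d\<close> and vanishes below level \<open>d\<close>, so it is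
  the combination of the \<open>P\<^sub>\<nu>\<close>, \<open>|\<nu>| = d\<close>, given by its top component.  This component only involves
  the subleading terms of \<open>P\<^sub>\<eta>\<close> and \<open>P\<^sub>\<kappa>\<close>, for which there is a closed formula as a sum over pairs of rows;
  when \<open>k\<close> is the critical row of \<open>\<kappa>\<close> the result is precisely the sum over glissades.

  Existence of \<open>P\<^sub>\<eta>\<close> and the formula for the subleading terms follow from the Hecke operators
  \<open>s\<^sub>i + r (1 - s\<^sub>i) / (x\<^sub>i - x\<^sub>i\<^sub>+\<^sub>1)\<close> and \<open>f \<mapsto> x\<^sub>n f(x\<^sub>n - 1, x\<^sub>1, \<dots>, x\<^sub>n\<^sub>-\<^sub>1)\<close>, which permute the \<open>P\<^sub>\<eta>\<close>.
  Uniqueness of interpolation comes from specialising at \<open>r = 0\<close>: there the values \<open>P\<^sub>\<nu>(\<gamma>)\<close> are products of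
  falling factorials, so within one level they form an invertible diagonal matrix.
\<close>

section \<open>Linear extension and evaluation of polynomials\<close>

abbreviation "lk \<equiv> Poly_Mapping.lookup"

lemma Const_mult_single:
  fixes c d :: "'a::comm_ring_1"
  shows "Const c * Poly_Mapping.single m d = Poly_Mapping.single m (c * d)"
  by (simp add: Const_def mult_single)

lemma Const_mult_monomial:
  fixes c :: "'a::comm_ring_1"
  shows "Const c * monomial m = Poly_Mapping.single m c"
  by (simp add: monomial_def Const_mult_single)

lemma lookup_Const_mult [simp]:
  fixes c :: "'a::comm_ring_1"
  shows "lk (Const c * p) m = c * lk p m"
  by (simp add: Const_def mult_map_scale_conv_mult [symmetric] map.rep_eq when_def)

lemma Const_distrib:
  fixes a b :: "'a::comm_ring_1"
  shows "Const (a * b) = Const a * Const b" "Const (a + b) = Const a + Const b"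
    "Const (a - b) = Const a - Const b" "Const (- a) = - Const a" "Const 1 = (1 :: 'a mvpoly)"
    "Const 0 = (0 :: 'a mvpoly)"
  by (simp_all add: Const_def mult_single single_add single_diff single_uminus)

lemma lookup_monomial: "lk (monomial m :: 'a::zero_neq_one mvpoly) \<mu> = (if \<mu> = m then 1 else 0)"
  by (simp add: monomial_def lookup_single when_def)

lemma X_mult_monomial:
  "X k * monomial m = (monomial (m + Poly_Mapping.single k (Suc 0)) :: 'a::comm_ring_1 mvpoly)"
  by (simp add: X_def monomial_def mult_single add.commute)

text \<open>The linear extension of \<open>F\<close> from the monomial basis. Multiplication by a
  variable, the Hecke operators, the reflection of the variables and finally \<open>Xi\<close> take
  this form, so identities between them need checking on single exponents only.\<close>

definition lin :: "('b \<Rightarrow> 'a::comm_ring_1 mvpoly) \<Rightarrow> ('b \<Rightarrow>\<^sub>0 'a) \<Rightarrow> 'a mvpoly" where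
  "lin F p = (\<Sum>m\<in>Poly_Mapping.keys p. Const (lk p m) * F m)"

lemma lin_superset:
  assumes "finite A" "Poly_Mapping.keys p \<subseteq> A"
  shows "lin F p = (\<Sum>m\<in>A. Const (lk p m) * F m)"
  unfolding lin_def
  by (rule sum.mono_neutral_left) (use assms in \<open>auto simp: in_keys_iff Const_distrib\<close>)

lemma lin_add: "lin F (p + q) = lin F p + lin F q"
proof -
  let ?A = "Poly_Mapping.keys p \<union> Poly_Mapping.keys q"
  have "Poly_Mapping.keys (p + q) \<subseteq> ?A" by (rule keys_add)
  then show ?thesis
    by (simp add: lin_superset [where A = ?A] lookup_add Const_distrib distrib_right sum.distrib)
qed

lemma lin_0 [simp]: "lin F 0 = 0"
  by (simp add: lin_def)

lemma lin_uminus: "lin F (- p) = - lin F p"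
  using lin_add [of F p "- p"] by (simp add: eq_neg_iff_add_eq_0 add.commute)

lemma lin_diff: "lin F (p - q) = lin F p - lin F q"
  using lin_add [of F p "- q"] by (simp add: lin_uminus)

lemma lin_sum: "lin F (sum f A) = (\<Sum>a\<in>A. lin F (f a))"
  by (induction A rule: infinite_finite_induct) (simp_all add: lin_add)

lemma lin_Const_mult: "lin F (Const c * p) = Const c * lin F p"
proof -
  have "Poly_Mapping.keys (Const c * p) \<subseteq> Poly_Mapping.keys p"
    by (auto simp: in_keys_iff)
  then show ?thesis
    by (simp add: lin_superset [where A = "Poly_Mapping.keys p"] Const_distrib mult.assoc
        sum_distrib_left)
qed

lemma lin_monomial [simp]: "lin F (monomial m) = F m"
  by (simp add: lin_superset [where A = "{m}"] monomial_def Const_distrib)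

lemma lin_plus: "lin (\<lambda>m. F m + G m) p = lin F p + lin G p"
  by (simp add: lin_def distrib_left sum.distrib)

lemma lin_minus: "lin (\<lambda>m. F m - G m) p = lin F p - lin G p"
  by (simp add: lin_def right_diff_distrib sum_subtractf)

lemma lin_Const_fun: "lin (\<lambda>m. Const c * F m) p = Const c * lin F p"
  by (simp add: lin_def sum_distrib_left algebra_simps)

lemma lin_id: "lin monomial p = p"
proof (rule poly_mapping_eqI)
  fix \<mu>
  have "lk (lin monomial p) \<mu> = (\<Sum>m\<in>Poly_Mapping.keys p. if \<mu> = m then lk p m else 0)"
    unfolding lin_def lookup_sum by (rule sum.cong) (simp_all add: lookup_monomial)
  then show "lk (lin monomial p) \<mu> = lk p \<mu>"
    by (simp add: in_keys_iff)
qed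

lemma X_mult_lin: "X k * p = lin (\<lambda>m. monomial (m + Poly_Mapping.single k (Suc 0))) p"
proof -
  have "X k * p = X k * lin monomial p" by (simp add: lin_id)
  also have "\<dots> = (\<Sum>m\<in>Poly_Mapping.keys p. X k * (Const (lk p m) * monomial m))"
    by (simp only: lin_def sum_distrib_left)
  also have "\<dots> = (\<Sum>m\<in>Poly_Mapping.keys p. Const (lk p m) * (X k * monomial m))"
    by (simp add: mult.left_commute)
  finally show ?thesis by (simp add: lin_def X_mult_monomial)
qed

section \<open>Degree bounds as support conditions\<close>

definition supp_in :: "expo set \<Rightarrow> 'a::zero mvpoly \<Rightarrow> bool" where
  "supp_in A p \<longleftrightarrow> Poly_Mapping.keys p \<subseteq> A"

lemma supp_in_iff: "supp_in A p \<longleftrightarrow> (\<forall>m. lk p m \<noteq> 0 \<longrightarrow> m \<in> A)"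
  by (auto simp: supp_in_def in_keys_iff)

lemma supp_in_0 [simp]: "supp_in A 0"
  by (simp add: supp_in_def)

lemma supp_in_add: "supp_in A p \<Longrightarrow> supp_in A q \<Longrightarrow> supp_in A (p + q)"
  unfolding supp_in_def using keys_add [of p q] by blast

lemma supp_in_uminus [simp]: "supp_in A (- p) = supp_in A (p :: 'a::comm_ring_1 mvpoly)"
  by (simp add: supp_in_iff)

lemma supp_in_diff: "supp_in A p \<Longrightarrow> supp_in A q \<Longrightarrow> supp_in A (p - q)"
  for p :: "'a::comm_ring_1 mvpoly"
  using supp_in_add [of A p "- q"] by simp

lemma supp_in_Const_mult: "supp_in A p \<Longrightarrow> supp_in A (Const c * p)"
  for p :: "'a::comm_ring_1 mvpoly"
  unfolding supp_in_iff by (metis lookup_Const_mult mult_zero_right)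

lemma supp_in_sum: "(\<And>i. i \<in> I \<Longrightarrow> supp_in A (f i)) \<Longrightarrow> supp_in A (sum f I)"
  by (induction I rule: infinite_finite_induct) (auto simp: supp_in_add)

lemma supp_in_monomial [simp]: "supp_in A (monomial m :: 'a::zero_neq_one mvpoly) \<longleftrightarrow> m \<in> A"
  by (simp add: supp_in_def monomial_def)

lemma supp_in_mono: "supp_in A p \<Longrightarrow> A \<subseteq> B \<Longrightarrow> supp_in B p"
  by (auto simp: supp_in_def)

lemma supp_in_lin: "supp_in A p \<Longrightarrow> (\<And>m. m \<in> A \<Longrightarrow> supp_in B (F m)) \<Longrightarrow> supp_in B (lin F p)"
  unfolding lin_def by (intro supp_in_sum supp_in_Const_mult) (auto simp: supp_in_def)

lemma polys_iff: "p \<in> polys n \<longleftrightarrow> supp_in (compositions n) p"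
  by (simp add: polys_def supp_in_def)

section \<open>Evaluation of monomials and polynomials\<close>

definition mono_eval :: "expo \<Rightarrow> (nat \<Rightarrow> 'a::comm_ring_1) \<Rightarrow> 'a" where
  "mono_eval m v = (\<Prod>i\<in>Poly_Mapping.keys m. v i ^ lk m i)"

lemma mono_eval_superset:
  assumes "finite A" "Poly_Mapping.keys m \<subseteq> A"
  shows "mono_eval m v = (\<Prod>i\<in>A. v i ^ lk m i)"
  unfolding mono_eval_def
  by (rule prod.mono_neutral_left) (use assms in \<open>auto simp: in_keys_iff\<close>)

lemma mono_eval_add: "mono_eval (a + b) v = mono_eval a v * mono_eval b v"
proof -
  let ?A = "Poly_Mapping.keys a \<union> Poly_Mapping.keys b"
  have "Poly_Mapping.keys (a + b) \<subseteq> ?A" by (rule keys_add)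
  then show ?thesis
    by (simp add: mono_eval_superset [where A = ?A] lookup_add power_add prod.distrib)
qed

lemma mono_eval_single [simp]: "mono_eval (Poly_Mapping.single i k) v = v i ^ k"
  by (simp add: mono_eval_superset [where A = "{i}"])

lemma mono_eval_cong:
  "m \<in> compositions n \<Longrightarrow> (\<And>i. i \<in> {1..n} \<Longrightarrow> u i = v i) \<Longrightarrow> mono_eval m u = mono_eval m v"
  unfolding mono_eval_def compositions_def by (rule prod.cong) auto

lemma eval_superset:
  fixes p :: "'a::comm_ring_1 mvpoly"
  assumes "finite A" "Poly_Mapping.keys p \<subseteq> A"
  shows "eval_poly p v = (\<Sum>m\<in>A. lk p m * mono_eval m v)"
  unfolding eval_poly_def mono_eval_def
  by (rule sum.mono_neutral_left) (use assms in \<open>auto simp: in_keys_iff\<close>)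

lemma eval_0 [simp]: "eval_poly 0 v = 0"
  by (simp add: eval_poly_def)

lemma eval_add: "eval_poly (p + q) v = eval_poly p v + eval_poly q v"
  for p :: "'a::comm_ring_1 mvpoly"
proof -
  let ?A = "Poly_Mapping.keys p \<union> Poly_Mapping.keys q"
  have "Poly_Mapping.keys (p + q) \<subseteq> ?A" by (rule keys_add)
  then show ?thesis
    by (simp add: eval_superset [where A = ?A] lookup_add distrib_right sum.distrib)
qed

lemma eval_Const_mult: "eval_poly (Const c * p) v = c * eval_poly p v"
  for p :: "'a::comm_ring_1 mvpoly"
proof -
  have "Poly_Mapping.keys (Const c * p) \<subseteq> Poly_Mapping.keys p"
    by (auto simp: in_keys_iff)
  then show ?thesis
    by (simp add: eval_superset [where A = "Poly_Mapping.keys p"] mult.assoc sum_distrib_left)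
qed

lemma eval_uminus: "eval_poly (- p) v = - eval_poly p v"
  for p :: "'a::comm_ring_1 mvpoly"
  using eval_Const_mult [of "- 1" p v] by (simp add: Const_distrib)

lemma eval_diff: "eval_poly (p - q) v = eval_poly p v - eval_poly q v"
  for p :: "'a::comm_ring_1 mvpoly"
  using eval_add [of p "- q" v] by (simp add: eval_uminus)

lemma eval_sum: "eval_poly (sum f A) v = (\<Sum>a\<in>A. eval_poly (f a) v)"
  for f :: "'b \<Rightarrow> 'a::comm_ring_1 mvpoly"
  by (induction A rule: infinite_finite_induct) (simp_all add: eval_add)

lemma eval_monomial [simp]: "eval_poly (monomial m) v = mono_eval m v"
  by (simp add: eval_superset [where A = "{m}"] monomial_def)

lemma eval_lin: "eval_poly (lin F p) v = (\<Sum>m\<in>Poly_Mapping.keys p. lk p m * eval_poly (F m) v)"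
  by (simp add: lin_def eval_sum eval_Const_mult)

lemma eval_alt: "eval_poly p v = (\<Sum>m\<in>Poly_Mapping.keys p. lk p m * mono_eval m v)"
  for p :: "'a::comm_ring_1 mvpoly"
  by (simp add: eval_superset)

lemma eval_X_mult: "eval_poly (X k * p) v = v k * eval_poly p v"
  for p :: "'a::comm_ring_1 mvpoly"
  unfolding X_mult_lin eval_lin eval_alt [of p]
  by (simp add: mono_eval_add sum_distrib_left ac_simps)

lemma eval_cong:
  "p \<in> polys n \<Longrightarrow> (\<And>i. i \<in> {1..n} \<Longrightarrow> u i = v i) \<Longrightarrow> eval_poly p u = eval_poly p v"
  for p :: "ratfun mvpoly"
  unfolding eval_alt by (intro sum.cong refl arg_cong2 [where f = "(*)"] mono_eval_cong)
    (auto simp: polys_def)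

section \<open>Sizes of exponents\<close>

lemma csize_superset:
  assumes "finite A" "Poly_Mapping.keys m \<subseteq> A"
  shows "csize m = (\<Sum>i\<in>A. lk m i)"
  unfolding csize_def
  by (rule sum.mono_neutral_left) (use assms in \<open>auto simp: in_keys_iff\<close>)

lemma csize_add: "csize (a + b) = csize a + csize b"
proof -
  let ?A = "Poly_Mapping.keys a \<union> Poly_Mapping.keys b"
  have "Poly_Mapping.keys (a + b) \<subseteq> ?A" by (rule keys_add)
  then show ?thesis
    by (simp add: csize_superset [where A = ?A] lookup_add sum.distrib)
qed

lemma csize_single [simp]: "csize (Poly_Mapping.single i k) = k"
  by (simp add: csize_superset [where A = "{i}"])

lemma csize_0 [simp]: "csize 0 = 0"
  by (simp add: csize_def)

lemma csize_eq_0_iff [simp]: "csize m = 0 \<longleftrightarrow> m = 0"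
  by (auto simp: csize_def in_keys_iff poly_mapping_eq_iff fun_eq_iff)

lemma csize_comp: "m \<in> compositions n \<Longrightarrow> csize m = (\<Sum>i\<in>{1..n}. lk m i)"
  by (rule csize_superset) (auto simp: compositions_def)

lemma compositions_iff: "m \<in> compositions n \<longleftrightarrow> (\<forall>i. i \<notin> {1..n} \<longrightarrow> lk m i = 0)"
  by (auto simp: compositions_def in_keys_iff)

lemma finite_compositions_csize: "finite {m \<in> compositions n. csize m \<le> d}"
proof (rule finite_imageD)
  show "inj_on (\<lambda>m. restrict (lk m) {1..n}) {m \<in> compositions n. csize m \<le> d}"
  proof (rule inj_onI, rule poly_mapping_eqI)
    fix a b i
    assume *: "a \<in> {m \<in> compositions n. csize m \<le> d}" "b \<in> {m \<in> compositions n. csize m \<le> d}"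
      "restrict (lk a) {1..n} = restrict (lk b) {1..n}"
    show "lk a i = lk b i"
    proof (cases "i \<in> {1..n}")
      case True
      then show ?thesis using fun_cong [OF *(3), of i] by auto
    qed (use * in \<open>auto simp: compositions_iff\<close>)
  qed
  have "lk m i \<le> csize m" if "m \<in> compositions n" "i \<in> {1..n}" for m i
    unfolding csize_comp [OF that(1)] by (rule member_le_sum) (use that in auto)
  then have "(\<lambda>m. restrict (lk m) {1..n}) ` {m \<in> compositions n. csize m \<le> d} \<subseteq> {1..n} \<rightarrow>\<^sub>E {..d}"
    by (intro image_subsetI restrict_PiE_iff [THEN iffD2] ballI)
      (metis (no_types, lifting) atMost_iff le_trans mem_Collect_eq)
  then show "finite ((\<lambda>m. restrict (lk m) {1..n}) ` {m \<in> compositions n. csize m \<le> d})"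
    by (rule finite_subset) (auto intro: finite_PiE)
qed

definition level :: "nat \<Rightarrow> nat \<Rightarrow> expo set" where
  "level n d = {m \<in> compositions n. csize m = d}"

lemma finite_level [simp]: "finite (level n d)"
  by (rule finite_subset [OF _ finite_compositions_csize [of n d]]) (auto simp: level_def)

section \<open>Rational functions regular at r = 0, and spectral vectors\<close>

text \<open>\<open>f\<close> is regular at \<open>r = 0\<close> and takes the value \<open>a\<close> there.\<close>

definition reg :: "ratfun \<Rightarrow> rat \<Rightarrow> bool" where
  "reg f a \<longleftrightarrow> (\<exists>p q. poly q 0 \<noteq> 0 \<and> f = Fract p q \<and> a = poly p 0 / poly q 0)"

lemma regI: "poly q 0 \<noteq> 0 \<Longrightarrow> f = Fract p q \<Longrightarrow> a = poly p 0 / poly q 0 \<Longrightarrow> reg f a"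
  unfolding reg_def by blast

lemma reg_add:
  assumes "reg f a" "reg g b" shows "reg (f + g) (a + b)"
proof -
  obtain p q where 1: "poly q 0 \<noteq> 0" "f = Fract p q" "a = poly p 0 / poly q 0"
    using assms(1) unfolding reg_def by blast
  obtain p' q' where 2: "poly q' 0 \<noteq> 0" "g = Fract p' q'" "b = poly p' 0 / poly q' 0"
    using assms(2) unfolding reg_def by blast
  have "q \<noteq> 0" "q' \<noteq> 0" using 1 2 by auto
  then have "f + g = Fract (p * q' + p' * q) (q * q')"
    using 1 2 by simp
  then show ?thesis
    by (rule regI [rotated]) (use 1 2 in \<open>auto simp: add_divide_distrib\<close>)
qed

lemma reg_mult:
  assumes "reg f a" "reg g b" shows "reg (f * g) (a * b)"
proof -
  obtain p q where 1: "poly q 0 \<noteq> 0" "f = Fract p q" "a = poly p 0 / poly q 0"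
    using assms(1) unfolding reg_def by blast
  obtain p' q' where 2: "poly q' 0 \<noteq> 0" "g = Fract p' q'" "b = poly p' 0 / poly q' 0"
    using assms(2) unfolding reg_def by blast
  have "f * g = Fract (p * p') (q * q')"
    using 1 2 by simp
  then show ?thesis
    by (rule regI [rotated]) (use 1 2 in auto)
qed

lemma reg_inverse:
  assumes "reg f a" "a \<noteq> 0" shows "reg (inverse f) (inverse a)"
proof -
  obtain p q where 1: "poly q 0 \<noteq> 0" "f = Fract p q" "a = poly p 0 / poly q 0"
    using assms(1) unfolding reg_def by blast
  have "inverse f = Fract q p"
    using 1 by simp
  then show ?thesis
    by (rule regI [rotated]) (use 1 assms(2) in auto)
qed

lemma reg_0 [simp]: "reg 0 0" and reg_1 [simp]: "reg 1 1"
  by (auto intro: regI [of 1 _ 0] regI [of 1 _ 1] simp: Zero_fract_def One_fract_def)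

lemma reg_rvar [simp]: "reg rvar 0"
  by (rule regI [of 1 _ "[:0, 1:]"]) (simp_all add: rvar_def)

lemma reg_uminus: "reg f a \<Longrightarrow> reg (- f) (- a)"
  unfolding reg_def by (metis minus_divide_left minus_fract poly_minus)

lemma reg_diff: "reg f a \<Longrightarrow> reg g b \<Longrightarrow> reg (f - g) (a - b)"
  using reg_add [of f a "- g" "- b"] by (simp add: reg_uminus)

lemma reg_divide: "reg f a \<Longrightarrow> reg g b \<Longrightarrow> b \<noteq> 0 \<Longrightarrow> reg (f / g) (a / b)"
  using reg_mult [of f a "inverse g" "inverse b"] by (simp add: reg_inverse divide_inverse)

lemma reg_of_nat [simp]: "reg (of_nat k) (of_nat k)"
  by (induction k) (auto intro: reg_add)

lemma reg_sum: "(\<And>i. i \<in> I \<Longrightarrow> reg (f i) (a i)) \<Longrightarrow> reg (sum f I) (sum a I)"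
  by (induction I rule: infinite_finite_induct) (auto intro: reg_add)

lemma reg_nonzero: "reg f a \<Longrightarrow> a \<noteq> 0 \<Longrightarrow> f \<noteq> 0"
proof -
  assume "reg f a" "a \<noteq> 0"
  then obtain p q where *: "poly q 0 \<noteq> 0" "f = Fract p q" "poly p 0 \<noteq> 0"
    by (auto simp: reg_def)
  then have "q \<noteq> 0" "p \<noteq> 0" by auto
  then show ?thesis using * by (simp add: Zero_fract_def eq_fract)
qed

text \<open>
  The matrix is diagonal and invertible at \<open>r = 0\<close>, a property which the Schur complement of a
  diagonal entry inherits.
\<close>

lemma reg_solve:
  assumes "finite I"
    and "\<And>i j. i \<in> I \<Longrightarrow> j \<in> I \<Longrightarrow> reg (M i j) (if i = j then a i else 0)"
    and "\<And>i. i \<in> I \<Longrightarrow> a i \<noteq> 0" and "\<And>i. i \<in> I \<Longrightarrow> reg (b i) (\<beta> i)"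
  obtains c where "\<And>i. i \<in> I \<Longrightarrow> reg (c i) (\<beta> i / a i)"
    and "\<And>i. i \<in> I \<Longrightarrow> (\<Sum>j\<in>I. M i j * c j) = b i"
proof -
  have "\<exists>c. \<forall>i\<in>I. reg (c i) (\<beta> i / a i) \<and> (\<Sum>j\<in>I. M i j * c j) = b i"
    using assms
  proof (induction I arbitrary: M b rule: finite_induct)
    case (insert k I)
    have kk: "reg (M k k) (a k)" "a k \<noteq> 0"
      using insert.prems(1) [of k k] insert.prems(2) by auto
    then have Mk: "M k k \<noteq> 0" by (rule reg_nonzero)
    have ik: "reg (M i k) 0" "reg (M k i) 0" if "i \<in> I" for i
      using insert.prems(1) [of i k] insert.prems(1) [of k i] insert.hyps that by (auto split: if_splits)
    \<comment> \<open>\<open>M'\<close> is the Schur complement of the pivot \<open>M k k\<close>,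
      and \<open>b'\<close> the matching right-hand side. Both corrections contain the factor
      \<open>M i k\<close>, which vanishes at \<open>r = 0\<close>, so the values there stay as they
      were.\<close>
    define M' where "M' i j = M i j - M i k * M k j / M k k" for i j
    define b' where "b' i = b i - M i k * b k / M k k" for i
    have "\<exists>c. \<forall>i\<in>I. reg (c i) (\<beta> i / a i) \<and> (\<Sum>j\<in>I. M' i j * c j) = b' i"
    proof (rule insert.IH)
      show "reg (M' i j) (if i = j then a i else 0)" if "i \<in> I" "j \<in> I" for i j
        using reg_diff [OF insert.prems(1) [of i j] reg_divide [OF reg_mult [OF ik(1) ik(2)] kk]] that
        unfolding M'_def by simp
      show "reg (b' i) (\<beta> i)" if "i \<in> I" for i
        using reg_diff [OF insert.prems(3) [of i]
            reg_divide [OF reg_mult [OF ik(1) insert.prems(3) [of k]] kk]] that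
        unfolding b'_def by simp
    qed (use insert.prems in auto)
    then obtain c where c: "\<And>i. i \<in> I \<Longrightarrow> reg (c i) (\<beta> i / a i)"
      "\<And>i. i \<in> I \<Longrightarrow> (\<Sum>j\<in>I. M' i j * c j) = b' i" by blast
    define x where "x = (b k - (\<Sum>j\<in>I. M k j * c j)) / M k k"
    have "reg (\<Sum>j\<in>I. M k j * c j) (\<Sum>j\<in>I. 0 * (\<beta> j / a j))"
      by (intro reg_sum reg_mult ik c)
    then have x: "reg x (\<beta> k / a k)"
      unfolding x_def using reg_divide [OF reg_diff [OF insert.prems(3) [of k]] kk] by fastforce
    have "(\<Sum>j\<in>insert k I. M i j * (c(k := x)) j) = b i" if "i \<in> insert k I" for i
    proof -
      have "(\<Sum>j\<in>insert k I. M i j * (c(k := x)) j) = M i k * x + (\<Sum>j\<in>I. M i j * (c(k := x)) j)"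
        using insert.hyps by simp
      also have "(\<Sum>j\<in>I. M i j * (c(k := x)) j) = (\<Sum>j\<in>I. M i j * c j)"
        using insert.hyps by (intro sum.cong) auto
      also have "M i k * x + (\<Sum>j\<in>I. M i j * c j) = b i"
      proof (cases "i = k")
        case True
        then show ?thesis using Mk by (simp add: x_def)
      next
        case False
        then have i: "i \<in> I" using that by simp
        have "(\<Sum>j\<in>I. M' i j * c j) = (\<Sum>j\<in>I. M i j * c j) - M i k / M k k * (\<Sum>j\<in>I. M k j * c j)"
          unfolding M'_def by (simp add: algebra_simps sum_subtractf sum_distrib_left)
        then show ?thesis
          using c(2) [OF i] Mk by (simp add: b'_def x_def field_simps)
      qed
      finally show ?thesis .
    qed
    moreover have "reg ((c(k := x)) i) (\<beta> i / a i)" if "i \<in> insert k I" for i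
      using that x c(1) by auto
    ultimately show ?case by blast
  qed simp
  then show ?thesis using that by blast
qed

text \<open>The transposed matrix satisfies the same hypotheses, so some combination
  \<open>y\<close> of the rows of \<open>M\<close> is the unit vector at \<open>l\<close>. Applied
  to the equations it extracts \<open>c l\<close>.\<close>

lemma reg_solution_unique:
  assumes I: "finite I"
    and M: "\<And>i j. i \<in> I \<Longrightarrow> j \<in> I \<Longrightarrow> reg (M i j) (if i = j then a i else 0)"
    and a: "\<And>i. i \<in> I \<Longrightarrow> a i \<noteq> 0"
    and c: "\<And>i. i \<in> I \<Longrightarrow> (\<Sum>j\<in>I. M i j * c j) = 0" and l: "l \<in> I"
  shows "c l = 0"
proof -
  obtain y where y: "\<And>i. i \<in> I \<Longrightarrow> (\<Sum>j\<in>I. M j i * y j) = (if i = l then 1 else 0)"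
  proof (rule reg_solve [OF I, of "\<lambda>i j. M j i" a "\<lambda>i. if i = l then 1 else 0" "\<lambda>i. if i = l then 1 else 0"])
    show "reg (M j i) (if i = j then a i else 0)" if "i \<in> I" "j \<in> I" for i j
      using M [OF that(2,1)] by (auto split: if_splits)
  qed (use a in auto)
  have "c l = (\<Sum>i\<in>I. (\<Sum>j\<in>I. M j i * y j) * c i)"
  proof -
    have "(\<Sum>i\<in>I. (\<Sum>j\<in>I. M j i * y j) * c i) = (\<Sum>i\<in>I. if i = l then c i else 0)"
      by (rule sum.cong) (simp_all add: y)
    then show ?thesis using I l by simp
  qed
  also have "\<dots> = (\<Sum>j\<in>I. y j * (\<Sum>i\<in>I. M j i * c i))"
    unfolding sum_distrib_left sum_distrib_right
    by (subst sum.swap) (simp add: ac_simps)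
  finally show ?thesis by (simp add: c)
qed

section \<open>The sorted order of the rows and the spectral vector\<close>

definition prec :: "expo \<Rightarrow> nat \<Rightarrow> nat \<Rightarrow> bool" where
  "prec \<gamma> a b \<longleftrightarrow> lk \<gamma> b < lk \<gamma> a \<or> lk \<gamma> a = lk \<gamma> b \<and> a < b"

text \<open>The position of row \<open>a\<close> after sorting, counted from \<open>0\<close>.\<close>

definition rnk :: "nat \<Rightarrow> expo \<Rightarrow> nat \<Rightarrow> nat" where
  "rnk n \<gamma> a = card {b \<in> {1..n}. prec \<gamma> b a}"

lemma rnk_less: "a \<in> {1..n} \<Longrightarrow> rnk n \<gamma> a < n"
proof -
  assume a: "a \<in> {1..n}"
  have "rnk n \<gamma> a \<le> card ({1..n} - {a})"
    unfolding rnk_def by (rule card_mono) (auto simp: prec_def)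
  also have "\<dots> < n" using a by auto
  finally show ?thesis .
qed

lemma rnk_mono: "a \<in> {1..n} \<Longrightarrow> prec \<gamma> a b \<Longrightarrow> rnk n \<gamma> a < rnk n \<gamma> b"
  unfolding rnk_def by (rule psubset_card_mono) (auto simp: prec_def)

lemma prec_total: "a \<noteq> b \<Longrightarrow> prec \<gamma> a b \<or> prec \<gamma> b a"
  by (auto simp: prec_def)

lemma rnk_less_iff: "a \<in> {1..n} \<Longrightarrow> b \<in> {1..n} \<Longrightarrow> rnk n \<gamma> a < rnk n \<gamma> b \<longleftrightarrow> prec \<gamma> a b"
  by (metis rnk_mono prec_total less_asym less_irrefl)

text \<open>Inversions \<open>(i, j)\<close> of \<open>u\<close> correspond to inversions
  \<open>(u j, u i)\<close> of its inverse. The latter are pairs of rows of the composition, the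
  form in which sorting permutations can be compared.\<close>

lemma perm_length_inv:
  assumes u: "u permutes {1..n}"
  shows "perm_length n u = card {(a, b). 1 \<le> a \<and> a < b \<and> b \<le> n \<and> inv u a > inv u b}"
proof -
  have inv: "inv u (u x) = x" "u (inv u x) = x" for x
    using permutes_inverses [OF u] by auto
  have im: "u x \<in> {1..n} \<longleftrightarrow> x \<in> {1..n}" "inv u x \<in> {1..n} \<longleftrightarrow> x \<in> {1..n}" for x
    using permutes_in_image [OF u] permutes_in_image [OF permutes_inv [OF u]] by auto
  have "bij_betw (\<lambda>(i, j). (u j, u i)) {(i, j). 1 \<le> i \<and> i < j \<and> j \<le> n \<and> u i > u j}
    {(a, b). 1 \<le> a \<and> a < b \<and> b \<le> n \<and> inv u a > inv u b}"
    by (rule bij_betw_byWitness [where f' = "\<lambda>(a, b). (inv u b, inv u a)"])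
      (use im in \<open>force simp: inv\<close>)+
  then show ?thesis unfolding perm_length_def by (rule bij_betw_same_card)
qed

text \<open>
  Every sorting permutation inverts the pairs \<open>a < b\<close> with \<open>\<gamma>\<^sub>a < \<gamma>\<^sub>b\<close>; the one of minimal length
  inverts no others.
\<close>

lemma inv_sort_perm:
  assumes i: "i \<in> {1..n}"
  shows "inv (sort_perm n \<gamma>) i = Suc (rnk n \<gamma> i)"
proof -
  define R where "R i = (if i \<in> {1..n} then Suc (rnk n \<gamma> i) else i)" for i
  have Rlt: "R a < R b \<longleftrightarrow> prec \<gamma> a b" if "a \<in> {1..n}" "b \<in> {1..n}" for a b
    using that by (simp add: R_def rnk_less_iff)
  have "inj_on R {1..n}"
    by (rule inj_onI) (metis Rlt less_irrefl prec_total)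
  moreover have "R ` {1..n} \<subseteq> {1..n}"
    using rnk_less [of _ n \<gamma>] by (auto simp: R_def Suc_le_eq)
  ultimately have "bij_betw R {1..n} {1..n}"
    by (simp add: bij_betw_def endo_inj_surj)
  then have R: "R permutes {1..n}"
    by (rule bij_imp_permutes) (auto simp: R_def)
  define w where "w = inv R"
  have w: "w permutes {1..n}" and wR: "inv w = R"
    using R by (simp_all add: w_def permutes_inv permutes_inv_inv)
  define I0 where "I0 = {(a, b). 1 \<le> a \<and> a < b \<and> b \<le> n \<and> lk \<gamma> a < lk \<gamma> b}"
  have I0w: "{(a, b). 1 \<le> a \<and> a < b \<and> b \<le> n \<and> R a > R b} = I0"
    unfolding I0_def using Rlt by (auto simp: prec_def)
  have act: "perm_act (inv u) (lk \<gamma>) = (\<lambda>j. lk \<gamma> (u j))" if "u permutes {1..n}" for u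
    using that by (simp add: perm_act_def permutes_inv_inv)
  have wsort: "w \<in> sorting_perms n \<gamma>"
    unfolding sorting_perms_def is_partition_def
  proof (intro CollectI conjI w allI impI)
    fix i j assume ij: "1 \<le> i \<and> i \<le> j \<and> j \<le> n"
    then have im: "w i \<in> {1..n}" "w j \<in> {1..n}" using permutes_in_image [OF w] by auto
    have Rw: "R (w x) = x" for x
      using permutes_inverses [OF R] by (simp add: w_def)
    show "perm_act (inv w) (lk \<gamma>) j \<le> perm_act (inv w) (lk \<gamma>) i"
      using Rlt [OF im(2,1)] ij by (auto simp: act [OF w] Rw prec_def)
  qed
  have fin: "finite {(a, b). 1 \<le> a \<and> a < b \<and> b \<le> n \<and> P a b}" for P
    by (rule finite_subset [of _ "{1..n} \<times> {1..n}"]) auto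
  have I0: "I0 \<subseteq> {(a, b). 1 \<le> a \<and> a < b \<and> b \<le> n \<and> inv u a > inv u b}"
    if u: "u \<in> sorting_perms n \<gamma>" for u
  proof -
    have up: "u permutes {1..n}" using u by (simp add: sorting_perms_def)
    have inv: "u (inv u x) = x" for x
      using permutes_inverses [OF up] by auto
    have im: "inv u x \<in> {1..n} \<longleftrightarrow> x \<in> {1..n}" for x
      using permutes_in_image [OF permutes_inv [OF up]] by auto
    have *: "lk \<gamma> (u j) \<le> lk \<gamma> (u i)" if "1 \<le> i" "i \<le> j" "j \<le> n" for i j
      using u that by (simp add: sorting_perms_def is_partition_def act [OF up])
    have "inv u a > inv u b" if "1 \<le> a" "a < b" "b \<le> n" "lk \<gamma> a < lk \<gamma> b" for a b
      using *[of "inv u a" "inv u b"] im [of a] im [of b] that by (force simp: inv)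
    then show ?thesis by (auto simp: I0_def)
  qed
  have min: "perm_length n w \<le> perm_length n u" if "u \<in> sorting_perms n \<gamma>" for u
  proof -
    have "u permutes {1..n}" using that by (simp add: sorting_perms_def)
    then show ?thesis
      unfolding perm_length_inv [OF w] wR I0w
      by (simp only: perm_length_inv card_mono [OF fin I0 [OF that]])
  qed
  have "sort_perm n \<gamma> = w"
    unfolding sort_perm_def
  proof (rule the_equality)
    show "w \<in> sorting_perms n \<gamma> \<and> (\<forall>u\<in>sorting_perms n \<gamma>. perm_length n w \<le> perm_length n u)"
      using wsort min by blast
  next
    fix u
    assume u: "u \<in> sorting_perms n \<gamma> \<and> (\<forall>v\<in>sorting_perms n \<gamma>. perm_length n u \<le> perm_length n v)"
    have up: "u permutes {1..n}" using u by (simp add: sorting_perms_def)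
    \<comment> \<open>Minimality bounds the number of inversions of \<open>u\<close> by that of
      \<open>w\<close>, which is the cardinality of \<open>I0\<close>; as \<open>I0\<close> is
      contained in the inversions of \<open>u\<close>, the two sets coincide.\<close>
    have "card {(a, b). 1 \<le> a \<and> a < b \<and> b \<le> n \<and> inv u a > inv u b} \<le> card I0"
      using u wsort unfolding perm_length_inv [OF up, symmetric] I0w [symmetric]
      unfolding wR [symmetric] perm_length_inv [OF w, symmetric] by blast
    then have eq: "{(a, b). 1 \<le> a \<and> a < b \<and> b \<le> n \<and> inv u a > inv u b} = I0"
      using card_seteq [OF fin I0] u by blast
    have lt: "inv u b < inv u a \<longleftrightarrow> prec \<gamma> b a" if ab: "a \<in> {1..n}" "b \<in> {1..n}" for a b
    proof -
      have inj: "inv u a = inv u b \<longleftrightarrow> a = b"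
        using permutes_inj [OF permutes_inv [OF up]] by (auto simp: inj_eq)
      consider "a < b" | "b < a" | "a = b" by linarith
      then show ?thesis
      proof cases
        case 1
        have "inv u b < inv u a \<longleftrightarrow> (a, b) \<in> I0" using 1 ab by (subst eq [symmetric]) auto
        then show ?thesis using 1 ab by (auto simp: I0_def prec_def)
      next
        case 2
        have "inv u a < inv u b \<longleftrightarrow> (b, a) \<in> I0" using 2 ab by (subst eq [symmetric]) auto
        then show ?thesis using 2 ab inj by (auto simp: I0_def prec_def)
      qed (simp add: prec_def)
    qed
    \<comment> \<open>The inversions determine the permutation: \<open>inv u a\<close> exceeds by
      one the number of rows that \<open>inv u\<close> puts before \<open>a\<close>, and these are
      the rows preceding \<open>a\<close> in \<open>prec\<close>.\<close>
    have "inv u a = R a" for a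
    proof (cases "a \<in> {1..n}")
      case True
      have im: "inv u x \<in> {1..n} \<longleftrightarrow> x \<in> {1..n}" "u x \<in> {1..n} \<longleftrightarrow> x \<in> {1..n}" for x
        using permutes_in_image [OF permutes_inv [OF up]] permutes_in_image [OF up] by auto
      have "{b \<in> {1..n}. prec \<gamma> b a} = {b \<in> {1..n}. inv u b < inv u a}"
        using lt True by blast
      also have "\<dots> = u ` {1..<inv u a}"
      proof (intro equalityI subsetI)
        fix b assume "b \<in> {b \<in> {1..n}. inv u b < inv u a}"
        then show "b \<in> u ` {1..<inv u a}"
          using im(1) [of b] permutes_inverses(1) [OF up, of b]
          by (intro image_eqI [of _ _ "inv u b"]) auto
      next
        fix b assume "b \<in> u ` {1..<inv u a}"
        then obtain x where "b = u x" "1 \<le> x" "x < inv u a" by auto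
        then show "b \<in> {b \<in> {1..n}. inv u b < inv u a}"
          using im(1) [of a] im(2) [of x] True permutes_inverses(2) [OF up, of x] by auto
      qed
      also have "card (u ` {1..<inv u a}) = inv u a - 1"
        using permutes_inj [OF up] by (subst card_image) (auto intro: inj_on_subset)
      finally show ?thesis
        using im(1) [of a] True by (simp add: R_def rnk_def)
    next
      case False
      then show ?thesis
        using permutes_not_in [OF permutes_inv [OF up]] by (auto simp: R_def)
    qed
    then have "inv u = R" by (rule ext)
    then show "u = w"
      unfolding w_def using permutes_inv_inv [OF up] by metis
  qed
  then show ?thesis using i by (simp add: wR R_def)
qed

lemma spectral_eq:
  assumes "i \<in> {1..n}"
  shows "spectral n \<gamma> i = of_nat (lk \<gamma> i) + rvar * of_nat (n - Suc (rnk n \<gamma> i))"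
  using inv_sort_perm [OF assms] by (simp add: spectral_def perm_act_def delta_def)

section \<open>Exponent moves and subleading terms\<close>

definition put :: "expo \<Rightarrow> nat \<Rightarrow> nat \<Rightarrow> nat \<Rightarrow> nat \<Rightarrow> expo" where
  "put m a u b v = Poly_Mapping.update b v (Poly_Mapping.update a u m)"

lemma lookup_upd: "lk (Poly_Mapping.update a u m) i = (if i = a then u else lk m i)"
  by (auto simp: lookup_update)

lemma lookup_put: "lk (put m a u b v) i = (if i = b then v else if i = a then u else lk m i)"
  by (simp add: put_def lookup_upd)

lemma put_split:
  "a \<noteq> b \<Longrightarrow> put m a u b v = put m a 0 b 0 + Poly_Mapping.single a u + Poly_Mapping.single b v"
  by (rule poly_mapping_eqI) (auto simp: lookup_put lookup_add lookup_single when_def)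

lemma put_id: "put m a (lk m a) b (lk m b) = m"
  by (rule poly_mapping_eqI) (auto simp: lookup_put)

lemma put_comm: "a \<noteq> b \<Longrightarrow> put m a u b v = put m b v a u"
  by (rule poly_mapping_eqI) (auto simp: lookup_put)

lemma csize_put: "a \<noteq> b \<Longrightarrow> csize (put m a u b v) + lk m a + lk m b = csize m + u + v"
proof -
  assume "a \<noteq> b"
  then have "csize (put m a u b v) = csize (put m a 0 b 0) + u + v" for u v
    by (subst put_split) (auto simp: csize_add)
  from this [of u v] this [of "lk m a" "lk m b"] show ?thesis by (simp add: put_id)
qed

lemma upd_split: "Poly_Mapping.update a u m = Poly_Mapping.update a 0 m + Poly_Mapping.single a u"
  by (rule poly_mapping_eqI) (auto simp: lookup_upd lookup_add lookup_single when_def)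

lemma upd_id: "Poly_Mapping.update a (lk m a) m = m"
  by (rule poly_mapping_eqI) (auto simp: lookup_upd)

lemma csize_upd: "csize (Poly_Mapping.update a u m) + lk m a = csize m + u"
proof -
  have "csize (Poly_Mapping.update a u m) = csize (Poly_Mapping.update a 0 m) + u" for u
    by (subst upd_split) (simp add: csize_add)
  from this [of u] this [of "lk m a"] show ?thesis by (simp add: upd_id)
qed

lemma mono_eval_put:
  "a \<noteq> b \<Longrightarrow> mono_eval (put m a u b v) x = mono_eval (put m a 0 b 0) x * x a ^ u * x b ^ v"
  by (subst put_split) (auto simp: mono_eval_add)

lemma mono_eval_supp: "(\<And>i. lk m i \<noteq> 0 \<Longrightarrow> x i = y i) \<Longrightarrow> mono_eval m x = mono_eval m y"
  unfolding mono_eval_def by (rule prod.cong) (auto simp: in_keys_iff)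

lemma put_comp: "m \<in> compositions n \<Longrightarrow> a \<in> {1..n} \<Longrightarrow> b \<in> {1..n} \<Longrightarrow> put m a u b v \<in> compositions n"
  by (auto simp: compositions_iff lookup_put)

lemma upd_comp: "m \<in> compositions n \<Longrightarrow> a \<in> {1..n} \<Longrightarrow> Poly_Mapping.update a u m \<in> compositions n"
  by (auto simp: compositions_iff lookup_upd)

section \<open>Adjacent transpositions and divided differences\<close>

definition sw :: "nat \<Rightarrow> expo \<Rightarrow> expo" where
  "sw i m = put m i (lk m (Suc i)) (Suc i) (lk m i)"

lemma lookup_sw: "lk (sw i m) j = lk m (transpose i (Suc i) j)"
  by (auto simp: sw_def lookup_put transpose_def)

lemma csize_sw [simp]: "csize (sw i m) = csize m"
  using csize_put [of i "Suc i" m "lk m (Suc i)" "lk m i"] by (simp add: sw_def)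

lemma sw_comp: "m \<in> compositions n \<Longrightarrow> 1 \<le> i \<Longrightarrow> i < n \<Longrightarrow> sw i m \<in> compositions n"
  unfolding sw_def by (rule put_comp) auto

lemma sw_sw [simp]: "sw i (sw i m) = m"
  by (rule poly_mapping_eqI) (simp add: lookup_sw)

lemma mono_eval_sw: "mono_eval (sw i m) x = mono_eval m (x \<circ> transpose i (Suc i))"
proof -
  let ?p = "lk m i" and ?q = "lk m (Suc i)" and ?r = "put m i 0 (Suc i) 0"
  have "mono_eval m (x \<circ> transpose i (Suc i)) = mono_eval (put m i ?p (Suc i) ?q) (x \<circ> transpose i (Suc i))"
    by (simp add: put_id)
  also have "\<dots> = mono_eval ?r (x \<circ> transpose i (Suc i)) * x (Suc i) ^ ?p * x i ^ ?q"
    by (subst mono_eval_put) auto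
  also have "mono_eval ?r (x \<circ> transpose i (Suc i)) = mono_eval ?r x"
    by (rule mono_eval_supp) (auto simp: lookup_put transpose_def split: if_splits)
  finally show ?thesis
    unfolding sw_def by (subst mono_eval_put) (auto simp: ac_simps comp_def)
qed

text \<open>The divided difference \<open>(x\<^sup>m - s\<^sub>i x\<^sup>m) / (x\<^sub>i - x\<^sub>i\<^sub>+\<^sub>1)\<close>.\<close>

definition divdiff :: "nat \<Rightarrow> expo \<Rightarrow> 'a::comm_ring_1 mvpoly" where
  "divdiff i m = (let p = lk m i; q = lk m (Suc i) in
     if q \<le> p then (\<Sum>l<p-q. monomial (put m i (q + l) (Suc i) (p - 1 - l)))
     else - (\<Sum>l<q-p. monomial (put m i (q - 1 - l) (Suc i) (p + l))))"

text \<open>Once the smaller of the two powers is taken out in both variables,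
  \<open>divdiff\<close> is, up to sign, the geometric sum in the factorisation of a difference of
  two \<open>d\<close>-th powers.\<close>

lemma eval_divdiff:
  fixes x :: "nat \<Rightarrow> 'a::comm_ring_1"
  shows "(x i - x (Suc i)) * eval_poly (divdiff i m) x = mono_eval m x - mono_eval (sw i m) x"
proof -
  let ?p = "lk m i" and ?q = "lk m (Suc i)" and ?R = "mono_eval (put m i 0 (Suc i) 0) x"
  have m: "mono_eval m x = ?R * x i ^ ?p * x (Suc i) ^ ?q"
    using mono_eval_put [of i "Suc i" m ?p ?q x] by (simp add: put_id)
  have sm: "mono_eval (sw i m) x = ?R * x i ^ ?q * x (Suc i) ^ ?p"
    unfolding sw_def by (subst mono_eval_put) auto
  show ?thesis
  proof (cases "?q \<le> ?p")
    case True
    define d where "d = ?p - ?q"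
    have p: "?p = ?q + d" using True by (simp add: d_def)
    have "eval_poly (divdiff i m) x = (\<Sum>l<d. mono_eval (put m i (?q + l) (Suc i) (?p - 1 - l)) x)"
      using True by (simp add: divdiff_def Let_def eval_sum d_def)
    also have "\<dots> = (\<Sum>l<d. ?R * x i ^ (?q + l) * x (Suc i) ^ (?p - 1 - l))"
      by (rule sum.cong, simp, subst mono_eval_put) simp_all
    also have "\<dots> = ?R * x i ^ ?q * x (Suc i) ^ ?q * (\<Sum>l<d. x (Suc i) ^ (d - Suc l) * x i ^ l)"
      unfolding sum_distrib_left
    proof (rule sum.cong)
      fix l assume "l \<in> {..<d}"
      then have "?p - 1 - l = ?q + (d - Suc l)" using p by auto
      then show "?R * x i ^ (?q + l) * x (Suc i) ^ (?p - 1 - l) =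
         ?R * x i ^ ?q * x (Suc i) ^ ?q * (x (Suc i) ^ (d - Suc l) * x i ^ l)"
        by (simp add: power_add ac_simps)
    qed simp
    finally have "(x i - x (Suc i)) * eval_poly (divdiff i m) x =
      ?R * x i ^ ?q * x (Suc i) ^ ?q * (x i ^ d - x (Suc i) ^ d)"
      by (simp add: power_diff_sumr2 ac_simps)
    then show ?thesis unfolding m sm p by (simp add: power_add algebra_simps)
  next
    case False
    define d where "d = ?q - ?p"
    have q: "?q = ?p + d" using False by (simp add: d_def)
    have "eval_poly (divdiff i m) x = - (\<Sum>l<d. mono_eval (put m i (?q - 1 - l) (Suc i) (?p + l)) x)"
      using False by (simp add: divdiff_def Let_def eval_sum eval_uminus d_def)
    also have "(\<Sum>l<d. mono_eval (put m i (?q - 1 - l) (Suc i) (?p + l)) x) =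
        (\<Sum>l<d. ?R * x i ^ (?q - 1 - l) * x (Suc i) ^ (?p + l))"
      by (rule sum.cong, simp, subst mono_eval_put) simp_all
    also have "(\<Sum>l<d. ?R * x i ^ (?q - 1 - l) * x (Suc i) ^ (?p + l)) =
       ?R * x i ^ ?p * x (Suc i) ^ ?p * (\<Sum>l<d. x i ^ (d - Suc l) * x (Suc i) ^ l)"
      unfolding sum_distrib_left
    proof (rule sum.cong)
      fix l assume "l \<in> {..<d}"
      then have "?q - 1 - l = ?p + (d - Suc l)" using q by auto
      then show "?R * x i ^ (?q - 1 - l) * x (Suc i) ^ (?p + l) =
         ?R * x i ^ ?p * x (Suc i) ^ ?p * (x i ^ (d - Suc l) * x (Suc i) ^ l)"
        by (simp add: power_add ac_simps)
    qed simp
    finally have "(x i - x (Suc i)) * eval_poly (divdiff i m) x =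
      ?R * x i ^ ?p * x (Suc i) ^ ?p * (x (Suc i) ^ d - x i ^ d)"
      unfolding power_diff_sumr2 [of "x (Suc i)"] by (simp add: algebra_simps)
    then show ?thesis unfolding m sm q by (simp add: power_add algebra_simps)
  qed
qed

lemma supp_divdiff:
  assumes "m \<in> compositions n" "1 \<le> i" "i < n"
  shows "supp_in {\<mu> \<in> compositions n. Suc (csize \<mu>) = csize m} (divdiff i m :: 'a::comm_ring_1 mvpoly)"
proof -
  have *: "Suc (csize (put m i u (Suc i) v)) = csize m" if "u + v + 1 = lk m i + lk m (Suc i)" for u v
    using csize_put [of i "Suc i" m u v] that by simp
  show ?thesis
    using assms unfolding divdiff_def Let_def
    by (auto intro!: supp_in_sum put_comp *)
qed

section \<open>Subleading terms and their behaviour under adjacent transpositions\<close>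

definition pairs :: "nat \<Rightarrow> (nat \<times> nat) set" where
  "pairs n = {(a, b). 1 \<le> a \<and> a < b \<and> b \<le> n}"

lemma finite_pairs [simp]: "finite (pairs n)"
  by (rule finite_subset [of _ "{1..n} \<times> {1..n}"]) (auto simp: pairs_def)

text \<open>
  The degree \<open>|m| - 1\<close> part of \<open>P\<^sub>m\<close> will turn out to be \<open>sublead n m\<close>.  The contribution \<open>subpair a b m\<close>
  of the rows \<open>a < b\<close> is dictated by compatibility with the two Hecke operators, which reduces to
  two variables; it is not symmetric in \<open>a\<close> and \<open>b\<close>.
\<close>

definition subpair :: "nat \<Rightarrow> nat \<Rightarrow> expo \<Rightarrow> ratfun mvpoly" where
  "subpair a b m = (let p = lk m a; q = lk m b in
     if q < p then - (\<Sum>l<p-q. Const (of_nat (p - q - l)) * monomial (put m a (p - 1 - l) b (q + l)))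
     else - (\<Sum>l<q-p-1. Const (of_nat (q - p - 1 - l)) * monomial (put m a (p + l) b (q - 1 - l))))"

text \<open>Up to sign the subleading term of the falling factorial
  \<open>x (x - 1) ... (x - p + 1)\<close> in row \<open>i\<close>, where \<open>p = lk m i\<close>.
  In \<open>sublead\<close> only these terms survive at \<open>r = 0\<close>, where the values of
  \<open>P\<^sub>m\<close> are products of falling factorials. For \<open>p = 0\<close> the
  truncated subtraction leaves the exponent unchanged, but the coefficient is 0.\<close>

definition subdiag :: "nat \<Rightarrow> expo \<Rightarrow> ratfun mvpoly" where
  "subdiag i m = Const (of_nat (lk m i choose 2)) * monomial (Poly_Mapping.update i (lk m i - 1) m)"

definition sublead :: "nat \<Rightarrow> expo \<Rightarrow> ratfun mvpoly" where
  "sublead n m = Const rvar * (\<Sum>(a, b)\<in>pairs n. subpair a b m) - (\<Sum>i\<in>{1..n}. subdiag i m)"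

lemma supp_subpair:
  assumes "m \<in> compositions n" "a \<in> {1..n}" "b \<in> {1..n}" "a \<noteq> b"
  shows "supp_in {\<mu> \<in> compositions n. Suc (csize \<mu>) = csize m} (subpair a b m)"
proof -
  have *: "Suc (csize (put m a u b v)) = csize m" if "u + v + 1 = lk m a + lk m b" for u v
    using csize_put [of a b m u v] that assms by simp
  show ?thesis
    using assms unfolding subpair_def Let_def
    by (auto intro!: supp_in_sum supp_in_Const_mult put_comp *)
qed

lemma supp_subdiag:
  assumes "m \<in> compositions n" "a \<in> {1..n}"
  shows "supp_in {\<mu> \<in> compositions n. Suc (csize \<mu>) = csize m} (subdiag a m)"
proof (cases "lk m a")
  case 0
  then show ?thesis by (simp add: subdiag_def Const_distrib binomial_eq_0)
next
  case (Suc k)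
  then show ?thesis
    using assms csize_upd [of a k m] unfolding subdiag_def
    by (auto intro!: supp_in_Const_mult upd_comp)
qed

lemma supp_sublead:
  assumes "m \<in> compositions n"
  shows "supp_in {\<mu> \<in> compositions n. Suc (csize \<mu>) = csize m} (sublead n m)"
  unfolding sublead_def
  by (intro supp_in_diff supp_in_Const_mult supp_in_sum)
    (auto intro!: supp_subpair supp_subdiag assms simp: pairs_def)

text \<open>Exchanging two rows merely relabels the rows of a pair term. The pair
  \<open>(i, Suc i)\<close> thereby becomes \<open>(Suc i, i)\<close>, in the wrong order;
  \<open>subpair_flip\<close> repairs this.\<close>

lemma lin_sw_subpair:
  "lin (\<lambda>\<mu>. monomial (sw i \<mu>)) (subpair a b m) =
   subpair (transpose i (Suc i) a) (transpose i (Suc i) b) (sw i m)"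
proof -
  let ?t = "transpose i (Suc i)"
  have "sw i (put m a u b v) = put (sw i m) (?t a) u (?t b) v" for u v
  proof (rule poly_mapping_eqI)
    fix j
    have "?t j = c \<longleftrightarrow> j = ?t c" for c by (metis transpose_involutory)
    then show "lk (sw i (put m a u b v)) j = lk (put (sw i m) (?t a) u (?t b) v) j"
      by (simp add: lookup_sw lookup_put)
  qed
  then show ?thesis
    by (simp add: subpair_def Let_def lookup_sw lin_uminus lin_sum lin_Const_mult)
qed

lemma lin_sw_subdiag:
  "lin (\<lambda>\<mu>. monomial (sw i \<mu>)) (subdiag a m) = subdiag (transpose i (Suc i) a) (sw i m)"
proof -
  let ?t = "transpose i (Suc i)"
  have "sw i (Poly_Mapping.update a u m) = Poly_Mapping.update (?t a) u (sw i m)" for u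
  proof (rule poly_mapping_eqI)
    fix j
    have "?t j = c \<longleftrightarrow> j = ?t c" for c by (metis transpose_involutory)
    then show "lk (sw i (Poly_Mapping.update a u m)) j = lk (Poly_Mapping.update (?t a) u (sw i m)) j"
      by (simp add: lookup_sw lookup_upd)
  qed
  then show ?thesis
    by (simp add: subdiag_def lookup_sw lin_Const_mult)
qed

text \<open>The weights drop by one, and the last summand, now of weight 0, is left out. By this
  identity the weighted sums in \<open>subpair\<close> differ by plain sums: a divided difference in
  \<open>subpair_flip\<close>, and sums over slides in the Pieri formula.\<close>

lemma sum_weights_Suc:
  "(\<Sum>l<k. Const (of_nat (k - l)) * f l) =
    (\<Sum>l<k-1. Const (of_nat (k - 1 - l)) * f l) + (\<Sum>l<k. f l :: ratfun mvpoly)"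
proof -
  have ext: "(\<Sum>l<k-1. Const (of_nat (k - 1 - l)) * f l) = (\<Sum>l<k. Const (of_nat (k - 1 - l)) * f l)"
    by (cases k) (simp_all add: Const_distrib)
  have "Const (of_nat (k - l)) * f l = Const (of_nat (k - 1 - l)) * f l + f l" if "l < k" for l
  proof -
    have k: "k - l = Suc (k - 1 - l)" using that by auto
    show ?thesis unfolding k by (simp only: of_nat_Suc Const_distrib distrib_right mult_1 add.commute)
  qed
  then show ?thesis using ext by (simp add: sum.distrib del: of_nat_diff)
qed

text \<open>The two orders of the rows give the same exponents with weights differing by one, so
  \<open>sum_weights_Suc\<close> leaves the sum that defines \<open>divdiff\<close>.\<close>

lemma subpair_flip:
  "subpair i (Suc i) (sw i m) = subpair (Suc i) i (sw i m) + divdiff i m"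
proof -
  let ?q = "lk m (Suc i)" and ?p = "lk m i" and ?m = "sw i m"
  let ?F = "\<lambda>l. monomial (put m i (?q + l) (Suc i) (?p - 1 - l)) :: ratfun mvpoly"
  let ?G = "\<lambda>l. monomial (put m i (?q - 1 - l) (Suc i) (?p + l)) :: ratfun mvpoly"
  have lks: "lk ?m i = ?q" "lk ?m (Suc i) = ?p" by (simp_all add: lookup_sw)
  have put: "put ?m i u (Suc i) v = put m i u (Suc i) v" "put ?m (Suc i) v i u = put m i u (Suc i) v" for u v
    by (rule poly_mapping_eqI; auto simp: lookup_put lookup_sw transpose_def)+
  consider "?q < ?p" | "?p < ?q" | "?p = ?q" by linarith
  then show ?thesis
  proof cases
    case 1
    then show ?thesis
      unfolding subpair_def divdiff_def Let_def lks put
      using sum_weights_Suc [of "?p - ?q" ?F] by simp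
  next
    case 2
    then show ?thesis
      unfolding subpair_def divdiff_def Let_def lks put
      using sum_weights_Suc [of "?q - ?p" ?G] by simp
  next
    case 3
    then show ?thesis
      unfolding subpair_def divdiff_def Let_def lks put by simp
  qed
qed

text \<open>All pairs of rows other than \<open>(i, Suc i)\<close> are permuted with their order
  preserved; this one pair is reversed and contributes the divided difference. The extra term is the
  one that \<open>sigma i\<close> adds to the exchanged leading monomial.\<close>

lemma sublead_sw:
  assumes "1 \<le> i" "i < n"
  shows "sublead n (sw i m) =
    lin (\<lambda>\<mu>. monomial (sw i \<mu>)) (sublead n m) + Const rvar * divdiff i m"
proof -
  let ?t = "transpose i (Suc i)" and ?m = "sw i m"
  have t: "?t permutes {1..n}" using assms by (intro permutes_swap_id) auto
  have mem: "(i, Suc i) \<in> pairs n" using assms by (simp add: pairs_def)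
  have diag: "(\<Sum>a\<in>{1..n}. subdiag (?t a) ?m) = (\<Sum>a\<in>{1..n}. subdiag a ?m)"
    using sum.permute [OF t, of "\<lambda>a. subdiag a ?m"] by (simp add: comp_def)
  have "(\<Sum>(a, b)\<in>pairs n - {(i, Suc i)}. subpair (?t a) (?t b) ?m) =
    (\<Sum>(a, b)\<in>pairs n - {(i, Suc i)}. subpair a b ?m)"
    by (rule sum.reindex_bij_witness [where i = "\<lambda>(a, b). (?t a, ?t b)" and j = "\<lambda>(a, b). (?t a, ?t b)"])
      (use assms in \<open>auto simp: pairs_def transpose_def split: if_splits\<close>)
  then have "(\<Sum>(a, b)\<in>pairs n. subpair a b ?m) =
     (\<Sum>(a, b)\<in>pairs n. subpair (?t a) (?t b) ?m) + divdiff i m"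
    using subpair_flip [of i m]
    by (simp add: sum.remove [OF finite_pairs mem])
  then show ?thesis
    using diag by (simp add: sublead_def lin_diff lin_Const_mult lin_sum lin_sw_subdiag
        distrib_left case_prod_unfold lin_sw_subpair)
qed

section \<open>The rotation of exponents\<close>

text \<open>For \<open>n \<ge> 1\<close> everything outside the rows \<open>1\<close> to
  \<open>n\<close> is fixed, so this is a permutation of all natural numbers; \<open>map_key\<close>
  needs an injective map.\<close>

definition cyc :: "nat \<Rightarrow> nat \<Rightarrow> nat" where
  "cyc n j = (if j = n then 1 else if 1 \<le> j \<and> j < n then Suc j else j)"

lemma cyc_permutes: "n \<ge> 1 \<Longrightarrow> cyc n permutes {1..n}"
proof (rule bij_imp_permutes)
  assume "n \<ge> 1"
  moreover have "inj_on (cyc n) {1..n}"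
  proof (rule inj_onI)
    fix x y assume "x \<in> {1..n}" "y \<in> {1..n}" "cyc n x = cyc n y"
    then show "x = y" unfolding cyc_def by (cases "x = n"; cases "y = n") auto
  qed
  ultimately show "bij_betw (cyc n) {1..n} {1..n}"
    by (simp add: bij_betw_def) (rule endo_inj_surj, auto simp: cyc_def)
qed (auto simp: cyc_def)

lemma cyc_in: "n \<ge> 1 \<Longrightarrow> cyc n j \<in> {1..n} \<longleftrightarrow> j \<in> {1..n}"
  by (rule permutes_in_image [OF cyc_permutes])

lemma cyc_eq_iff: "n \<ge> 1 \<Longrightarrow> cyc n i = cyc n j \<longleftrightarrow> i = j"
  using permutes_inj [OF cyc_permutes] by (auto simp: inj_eq)

text \<open>The rotation \<open>(m\<^sub>1, ..., m\<^sub>n) \<mapsto> (m\<^sub>2, ..., m\<^sub>n,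
  m\<^sub>1 + 1)\<close>: \<open>map_key\<close> precomposes, so row \<open>j\<close> receives the
  entry of row \<open>cyc n j\<close>.\<close>

definition phi :: "nat \<Rightarrow> expo \<Rightarrow> expo" where
  "phi n m = Poly_Mapping.map_key (cyc n) m + Poly_Mapping.single n 1"

lemma lookup_phi:
  "n \<ge> 1 \<Longrightarrow> lk (phi n m) j = lk m (cyc n j) + (if j = n then 1 else 0)"
  using permutes_inj [OF cyc_permutes [of n]]
  by (simp add: phi_def lookup_add map_key.rep_eq lookup_single when_def)

lemma phi_comp: "n \<ge> 1 \<Longrightarrow> m \<in> compositions n \<Longrightarrow> phi n m \<in> compositions n"
  using cyc_in [of n] by (auto simp: compositions_iff lookup_phi)

lemma csize_phi:
  assumes "n \<ge> 1" "m \<in> compositions n"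
  shows "csize (phi n m) = Suc (csize m)"
proof -
  have "(\<Sum>i\<in>{1..n}. lk m (cyc n i)) = (\<Sum>i\<in>{1..n}. lk m i)"
    using sum.permute [OF cyc_permutes, of n "lk m"] assms by (simp add: comp_def)
  then show ?thesis
    using assms by (simp add: csize_comp [of _ n] phi_comp lookup_phi sum.distrib)
qed

lemma phi_surj:
  assumes n: "n \<ge> 1" and m: "m \<in> compositions n" "lk m n \<noteq> 0"
  obtains m' where "m' \<in> compositions n" "m = phi n m'"
proof -
  let ?c = "inv (cyc n)"
  define m' where "m' = Poly_Mapping.map_key ?c (Poly_Mapping.update n (lk m n - 1) m)"
  have p: "?c permutes {1..n}" by (rule permutes_inv [OF cyc_permutes [OF n]])
  then have lk': "lk m' j = (if ?c j = n then lk m n - 1 else lk m (?c j))" for j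
    using permutes_inj [OF p] by (simp add: m'_def map_key.rep_eq lookup_upd)
  have "m' \<in> compositions n"
    unfolding compositions_iff
  proof (intro allI impI)
    fix j assume "j \<notin> {1..n}"
    then have "?c j \<notin> {1..n}" using permutes_in_image [OF p] by blast
    moreover from this have "?c j \<noteq> n" using n by auto
    moreover from \<open>?c j \<notin> {1..n}\<close> have "lk m (?c j) = 0"
      using m(1) unfolding compositions_iff by blast
    ultimately show "lk m' j = 0" by (simp only: lk' if_False)
  qed
  moreover have "m = phi n m'"
  proof (rule poly_mapping_eqI)
    fix j
    show "lk m j = lk (phi n m') j"
      unfolding lookup_phi [OF n] lk' permutes_inverses(2) [OF cyc_permutes [OF n]] using m(2) by simp
  qed
  ultimately show ?thesis by (rule that)
qed

section \<open>The shift operator on monomials\<close>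

lemma mono_eval_phi:
  assumes n: "n \<ge> 1" and m: "m \<in> compositions n" and y: "\<And>j. j \<in> {1..n} \<Longrightarrow> y (cyc n j) = x j"
  shows "mono_eval (phi n m) x = x n * mono_eval m y"
proof -
  have *: "mono_eval \<mu> z = (\<Prod>i\<in>{1..n}. z i ^ lk \<mu> i)" if "\<mu> \<in> compositions n"
    for \<mu> and z :: "nat \<Rightarrow> 'a"
    by (rule mono_eval_superset) (use that in \<open>auto simp: compositions_def\<close>)
  have "(\<Prod>i\<in>{1..n}. y i ^ lk m i) = (\<Prod>i\<in>{1..n}. y (cyc n i) ^ lk m (cyc n i))"
    using prod.permute [OF cyc_permutes [OF n], of "\<lambda>i. y i ^ lk m i"] by (simp add: comp_def)
  also have "\<dots> = (\<Prod>i\<in>{1..n}. x i ^ lk m (cyc n i))"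
    by (rule prod.cong) (auto simp: y)
  finally have 1: "(\<Prod>i\<in>{1..n}. y i ^ lk m i) = (\<Prod>i\<in>{1..n}. x i ^ lk m (cyc n i))" .
  have "(\<Prod>i\<in>{1..n}. x i ^ (if i = n then 1 else 0)) = (\<Prod>i\<in>{1..n}. if i = n then x i else 1)"
    by (rule prod.cong) auto
  also have "\<dots> = x n" using n by simp
  finally have 2: "(\<Prod>i\<in>{1..n}. x i ^ (if i = n then 1 else 0)) = x n" .
  show ?thesis
    unfolding *[OF m] *[OF phi_comp [OF n m]] lookup_phi [OF n] power_add prod.distrib 1 2
    by (rule mult.commute)
qed

text \<open>The image of \<open>x\<^sup>m\<close> under \<open>f \<mapsto> x\<^sub>n f(x\<^sub>n -
  1, x\<^sub>1, ..., x\<^sub>n\<^sub>-\<^sub>1)\<close>, with the power of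
  \<open>x\<^sub>n - 1\<close> expanded by the binomial theorem. The factor \<open>x\<^sub>n\<close>
  is the box added by \<open>phi\<close>.\<close>

definition shiftmono :: "nat \<Rightarrow> expo \<Rightarrow> ratfun mvpoly" where
  "shiftmono n m = (\<Sum>j\<le>lk m 1. Const (of_nat (lk m 1 choose j) * (- 1) ^ (lk m 1 - j)) *
     monomial (phi n (Poly_Mapping.update 1 j m)))"

lemma eval_shiftmono:
  assumes n: "n \<ge> 1" and m: "m \<in> compositions n"
    and z: "\<And>j. j \<in> {1..n} \<Longrightarrow> z (cyc n j) = x j - (if j = n then 1 else 0)"
  shows "eval_poly (shiftmono n m) x = x n * mono_eval m z"
proof -
  let ?p = "lk m 1" and ?R = "mono_eval (Poly_Mapping.update 1 0 m) z"
  have z1: "z 1 = x n - 1" using z [of n] n by (simp add: cyc_def)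
  have "mono_eval (phi n (Poly_Mapping.update 1 j m)) x = x n * (?R * x n ^ j)" for j
  proof -
    \<comment> \<open>The point \<open>z\<close> has first entry \<open>x n - 1\<close>. Restoring
      \<open>x n\<close> there makes it the rotation of \<open>x\<close>, as
      \<open>mono_eval_phi\<close> requires; the binomial sum accounts for the difference.\<close>
    have "mono_eval (phi n (Poly_Mapping.update 1 j m)) x =
      x n * mono_eval (Poly_Mapping.update 1 j m) (z(1 := x n))"
    proof (rule mono_eval_phi [OF n])
      show "(z(1 := x n)) (cyc n j) = x j" if "j \<in> {1..n}" for j
        using z [OF that] cyc_eq_iff [OF n, of j n] n by (auto simp: cyc_def split: if_splits)
    qed (use n m in \<open>auto intro: upd_comp\<close>)
    also have "mono_eval (Poly_Mapping.update 1 j m) (z(1 := x n)) =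
      mono_eval (Poly_Mapping.update 1 0 m) (z(1 := x n)) * x n ^ j"
      by (subst upd_split) (simp add: mono_eval_add)
    also have "mono_eval (Poly_Mapping.update 1 0 m) (z(1 := x n)) = ?R"
      by (rule mono_eval_supp) (auto simp: lookup_upd split: if_splits)
    finally show ?thesis .
  qed
  then have "eval_poly (shiftmono n m) x =
      (\<Sum>j\<le>?p. of_nat (?p choose j) * (- 1) ^ (?p - j) * (x n * (?R * x n ^ j)))"
    by (simp only: shiftmono_def eval_sum eval_Const_mult eval_monomial)
  also have "\<dots> = x n * ?R * (\<Sum>j\<le>?p. of_nat (?p choose j) * x n ^ j * (- 1) ^ (?p - j))"
    by (simp add: sum_distrib_left ac_simps)
  also have "(\<Sum>j\<le>?p. of_nat (?p choose j) * x n ^ j * (- 1) ^ (?p - j)) = (z 1) ^ ?p"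
    unfolding z1 using binomial_ring [of "x n" "- 1" ?p] by simp
  also have "x n * ?R * z 1 ^ ?p = x n * mono_eval m z"
    using mono_eval_add [of "Poly_Mapping.update 1 0 m" "Poly_Mapping.single 1 ?p" z]
    by (simp only: upd_split [of 1 ?p m, symmetric] upd_id mult.assoc mono_eval_single)
  finally show ?thesis .
qed

text \<open>The binomial terms for \<open>j = lk m 1\<close> and \<open>j = lk m 1 - 1\<close> have
  sizes \<open>csize m + 1\<close> and \<open>csize m\<close>; all others are smaller. If the first
  row is empty, the second term has coefficient 0.\<close>

lemma shiftmono_top:
  assumes n: "n \<ge> 1" and m: "m \<in> compositions n"
  shows "supp_in {\<mu> \<in> compositions n. csize \<mu> < csize m} (shiftmono n m - monomial (phi n m)
     + Const (of_nat (lk m 1)) * monomial (phi n (Poly_Mapping.update 1 (lk m 1 - 1) m)))"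
proof -
  have low: "supp_in {\<mu> \<in> compositions n. csize \<mu> < csize m}
    (Const c * monomial (phi n (Poly_Mapping.update 1 j m)))" if "Suc j < lk m 1" for j and c :: ratfun
    using that n m csize_upd [of 1 j m] by (intro supp_in_Const_mult) (simp add: phi_comp upd_comp csize_phi)
  define f where "f j = Const (of_nat (lk m 1 choose j) * (- 1) ^ (lk m 1 - j)) *
     (monomial (phi n (Poly_Mapping.update 1 j m)) :: ratfun mvpoly)" for j
  have sm: "shiftmono n m = (\<Sum>j\<le>lk m 1. f j)" by (simp add: shiftmono_def f_def)
  have top: "f (lk m 1) = monomial (phi n m)"
    by (simp add: f_def upd_id Const_distrib)
  show ?thesis
  proof (cases "lk m 1")
    case 0
    then show ?thesis using top unfolding sm by (simp add: Const_distrib)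
  next
    case (Suc k)
    have fk: "f k = - Const (of_nat (lk m 1)) * monomial (phi n (Poly_Mapping.update 1 (lk m 1 - 1) m))"
      unfolding f_def Suc by (simp add: Const_distrib)
    have "shiftmono n m = (\<Sum>j<k. f j) + f k + f (lk m 1)"
      unfolding sm Suc by (simp add: lessThan_Suc_atMost [symmetric] ac_simps)
    then have "shiftmono n m - monomial (phi n m)
     + Const (of_nat (lk m 1)) * monomial (phi n (Poly_Mapping.update 1 (lk m 1 - 1) m)) = (\<Sum>j<k. f j)"
      unfolding fk top by simp
    also have "supp_in {\<mu> \<in> compositions n. csize \<mu> < csize m} \<dots>"
      unfolding f_def by (intro supp_in_sum low) (use Suc in simp)
    finally show ?thesis .
  qed
qed

section \<open>Subleading terms under the rotation\<close>

lemma phi_put: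
  assumes "n \<ge> 1"
  shows "phi n (put m (cyc n a) u (cyc n b) v) =
    put (phi n m) a (if a = n then Suc u else u) b (if b = n then Suc v else v)"
  by (rule poly_mapping_eqI) (use assms in \<open>auto simp: lookup_phi lookup_put cyc_eq_iff\<close>)

lemma phi_upd:
  assumes "n \<ge> 1"
  shows "phi n (Poly_Mapping.update (cyc n a) u m) =
    Poly_Mapping.update a (if a = n then Suc u else u) (phi n m)"
  by (rule poly_mapping_eqI) (use assms in \<open>auto simp: lookup_phi lookup_upd cyc_eq_iff\<close>)

lemma lin_phi_subpair:
  assumes "n \<ge> 1" "a \<noteq> n" "b \<noteq> n"
  shows "lin (\<lambda>\<mu>. monomial (phi n \<mu>)) (subpair (cyc n a) (cyc n b) m) = subpair a b (phi n m)"
  using assms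
  by (simp add: subpair_def Let_def lookup_phi lin_uminus lin_sum lin_Const_mult phi_put)

text \<open>Row \<open>1\<close> becomes row \<open>n\<close>, so the pair changes its order, and
  its new last row has one more box. The asymmetry of \<open>subpair\<close> compensates for both:
  its first branch has \<open>p - q\<close> summands, its second \<open>q - p - 1\<close>.\<close>

lemma lin_phi_subpair_last:
  assumes "n \<ge> 1" "a \<noteq> n"
  shows "lin (\<lambda>\<mu>. monomial (phi n \<mu>)) (subpair (cyc n n) (cyc n a) m) = subpair a n (phi n m)"
proof -
  let ?p = "lk m (cyc n n)" and ?q = "lk m (cyc n a)" and ?m = "phi n m"
  have lks: "lk ?m a = ?q" "lk ?m n = Suc ?p" using assms by (simp_all add: lookup_phi)
  have put: "phi n (put m (cyc n n) u (cyc n a) v) = put ?m a v n (Suc u)" for u v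
    using assms by (simp add: phi_put put_comm)
  consider "?q < ?p" | "?q = ?p \<or> ?q = Suc ?p" | "Suc ?p < ?q" by linarith
  then show ?thesis
  proof cases
    case 1
    then have "(\<Sum>l<?p - ?q. Const (of_nat (?p - ?q - l)) * monomial (put ?m a (?q + l) n (Suc (?p - 1 - l)))) =
      (\<Sum>l<Suc ?p - ?q - 1. Const (of_nat (Suc ?p - ?q - 1 - l)) * monomial (put ?m a (?q + l) n (Suc ?p - 1 - l)) :: ratfun mvpoly)"
      by (intro sum.cong) (auto simp: Suc_diff_Suc)
    with 1 show ?thesis
      unfolding subpair_def Let_def lks by (simp add: lin_uminus lin_sum lin_Const_mult put)
  next
    case 2
    then show ?thesis
      unfolding subpair_def Let_def lks by auto
  next
    case 3
    then show ?thesis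
      unfolding subpair_def Let_def lks by (simp add: lin_uminus lin_sum lin_Const_mult put)
  qed
qed

text \<open>By Pascal's rule, the row that gains a box passes from \<open>p choose 2\<close> to
  \<open>(p choose 2) + p\<close>, where \<open>p = lk m 1\<close>.\<close>

lemma lin_phi_subdiag:
  assumes "n \<ge> 1"
  shows "subdiag a (phi n m) = lin (\<lambda>\<mu>. monomial (phi n \<mu>)) (subdiag (cyc n a) m) + (if a = n then
      Const (of_nat (lk m 1)) * monomial (phi n (Poly_Mapping.update 1 (lk m 1 - 1) m)) else 0)"
proof (cases "a = n")
  case False
  then show ?thesis
    using assms by (simp add: subdiag_def lookup_phi lin_Const_mult phi_upd)
next
  case True
  have c: "cyc n n = 1" by (simp add: cyc_def)
  show ?thesis
  proof (cases "lk m 1")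
    case 0
    then show ?thesis using assms True by (simp add: subdiag_def lookup_phi c Const_distrib binomial_eq_0)
  next
    case (Suc k)
    have u: "Poly_Mapping.update n (Suc k) (phi n m) = phi n (Poly_Mapping.update 1 k m)"
      using phi_upd [OF assms, of n k m] by (simp add: c)
    have b: "(Suc (Suc k) choose 2) = (Suc k choose 2) + Suc k"
      by (simp add: numeral_2_eq_2)
    have "subdiag n (phi n m) = Const (of_nat (Suc (Suc k) choose 2)) * monomial (phi n (Poly_Mapping.update 1 k m))"
      using assms Suc u by (simp add: subdiag_def lookup_phi c)
    moreover have "lin (\<lambda>\<mu>. monomial (phi n \<mu>)) (subdiag 1 m) =
        Const (of_nat (Suc k choose 2)) * monomial (phi n (Poly_Mapping.update 1 k m))"
      unfolding subdiag_def Suc lin_Const_mult by simp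
    ultimately show ?thesis
      unfolding True c Suc b by (simp only: of_nat_add Const_distrib distrib_right if_True) simp
  qed
qed

text \<open>The correction is the second binomial term of \<open>shiftmono\<close>, so
  \<open>shift\<close> produces the subleading term required for \<open>phi n m\<close>.\<close>

lemma sublead_phi:
  assumes n: "n \<ge> 1"
  shows "sublead n (phi n m) = lin (\<lambda>\<mu>. monomial (phi n \<mu>)) (sublead n m)
    - Const (of_nat (lk m 1)) * monomial (phi n (Poly_Mapping.update 1 (lk m 1 - 1) m))"
proof -
  let ?L = "lin (\<lambda>\<mu>. monomial (phi n \<mu>)) :: ratfun mvpoly \<Rightarrow> _"
  let ?K = "Const (of_nat (lk m 1)) * monomial (phi n (Poly_Mapping.update 1 (lk m 1 - 1) m)) :: ratfun mvpoly"
  have "(\<Sum>a\<in>{1..n}. subdiag a (phi n m)) = (\<Sum>a\<in>{1..n}. ?L (subdiag (cyc n a) m) + (if a = n then ?K else 0))"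
    by (intro sum.cong refl lin_phi_subdiag [OF n])
  also have "\<dots> = (\<Sum>a\<in>{1..n}. ?L (subdiag (cyc n a) m)) + ?K"
    using n by (simp add: sum.distrib)
  also have "(\<Sum>a\<in>{1..n}. ?L (subdiag (cyc n a) m)) = (\<Sum>a\<in>{1..n}. ?L (subdiag a m))"
    using sum.permute [OF cyc_permutes [OF n], of "\<lambda>a. ?L (subdiag a m)"] by (simp add: comp_def)
  finally have diag: "(\<Sum>a\<in>{1..n}. subdiag a (phi n m)) = (\<Sum>a\<in>{1..n}. ?L (subdiag a m)) + ?K" .
  have "(\<Sum>(a, b)\<in>pairs n. subpair a b (phi n m)) = (\<Sum>(a, b)\<in>pairs n. ?L (subpair a b m))"
  \<comment> \<open>The pair \<open>(a, n)\<close> comes from \<open>(1, Suc a)\<close>, every other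
    pair \<open>(a, b)\<close> from \<open>(Suc a, Suc b)\<close>.\<close>
  proof (rule sum.reindex_bij_witness [where j = "\<lambda>(a, b). if b = n then (1, Suc a) else (Suc a, Suc b)"
        and i = "\<lambda>(a, b). if a = 1 then (b - 1, n) else (a - 1, b - 1)"])
    fix c assume "c \<in> pairs n"
    then obtain a b where c: "c = (a, b)" "1 \<le> a" "a < b" "b \<le> n" by (auto simp: pairs_def)
    then have cy: "cyc n a = Suc a" "b \<noteq> n \<Longrightarrow> cyc n b = Suc b" "cyc n n = 1" by (auto simp: cyc_def)
    show "(case (case c of (a, b) \<Rightarrow> if b = n then (1, Suc a) else (Suc a, Suc b)) of
         (a, b) \<Rightarrow> ?L (subpair a b m)) = (case c of (a, b) \<Rightarrow> subpair a b (phi n m))"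
      using lin_phi_subpair [OF n, of a b m] lin_phi_subpair_last [OF n, of a m] c cy by auto
  qed (auto simp: pairs_def split: if_splits)
  then show ?thesis
    using diag by (simp add: sublead_def lin_diff lin_Const_mult lin_sum case_prod_unfold)
qed

section \<open>Existence of the vanishing polynomials\<close>

text \<open>Being adjacent, the rows \<open>i\<close> and \<open>Suc i\<close> compare alike by
  index with every other row, and between themselves they do not tie. So the exchange preserves
  \<open>prec\<close>.\<close>

lemma spectral_sw:
  assumes i: "1 \<le> i" "i < n" and ne: "lk \<gamma> i \<noteq> lk \<gamma> (Suc i)" and j: "j \<in> {1..n}"
  shows "spectral n (sw i \<gamma>) j = spectral n \<gamma> (transpose i (Suc i) j)"
proof -
  let ?t = "transpose i (Suc i)"
  have t: "?t permutes {1..n}" using i by (intro permutes_swap_id) auto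
  have tj: "?t a \<in> {1..n} \<longleftrightarrow> a \<in> {1..n}" for a by (rule permutes_in_image [OF t])
  have prec: "prec (sw i \<gamma>) b j \<longleftrightarrow> prec \<gamma> (?t b) (?t j)" for b
    using ne by (auto simp: prec_def lookup_sw transpose_def)
  have "bij_betw ?t {b \<in> {1..n}. prec (sw i \<gamma>) b j} {b \<in> {1..n}. prec \<gamma> b (?t j)}"
    by (rule bij_betw_byWitness [where f' = ?t]) (use tj in \<open>auto simp: prec simp del: atLeastAtMost_iff\<close>)
  then have "rnk n (sw i \<gamma>) j = rnk n \<gamma> (?t j)"
    unfolding rnk_def by (rule bij_betw_same_card)
  then show ?thesis
    using j tj [of j] by (simp add: spectral_eq lookup_sw)
qed

text \<open>Adjacent rows of equal length are consecutive in \<open>prec\<close>. At such a vector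
  the factor \<open>r / (x\<^sub>i - x\<^sub>i\<^sub>+\<^sub>1)\<close> in \<open>sigma i\<close>
  equals 1, and \<open>sigma i\<close> does not change the value of a polynomial.\<close>

lemma spectral_diff_tie:
  assumes i: "1 \<le> i" "i < n" and eq: "lk \<gamma> i = lk \<gamma> (Suc i)"
  shows "spectral n \<gamma> i - spectral n \<gamma> (Suc i) = rvar"
proof -
  have "{b \<in> {1..n}. prec \<gamma> b (Suc i)} = insert i {b \<in> {1..n}. prec \<gamma> b i}"
    using i eq by (auto simp: prec_def)
  then have "rnk n \<gamma> (Suc i) = Suc (rnk n \<gamma> i)"
    by (simp add: rnk_def prec_def)
  moreover have "rnk n \<gamma> (Suc i) < n" using i by (intro rnk_less) auto
  ultimately have "n - Suc (rnk n \<gamma> i) = Suc (n - Suc (rnk n \<gamma> (Suc i)))" by simp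
  then have "(of_nat (n - Suc (rnk n \<gamma> i)) :: ratfun) = of_nat (n - Suc (rnk n \<gamma> (Suc i))) + 1"
    by simp
  then show ?thesis
    using i eq by (simp add: spectral_eq algebra_simps del: of_nat_diff)
qed

lemma reg_spectral: "i \<in> {1..n} \<Longrightarrow> reg (spectral n \<gamma> i) (of_nat (lk \<gamma> i))"
  using reg_add [OF reg_of_nat [of "lk \<gamma> i"] reg_mult [OF reg_rvar reg_of_nat]]
  by (simp add: spectral_eq del: of_nat_diff)

text \<open>The rotation preserves \<open>prec\<close>. A row as long as row \<open>1\<close> used
  to follow it by index and now follows because of the added box; a row one box longer used to
  precede it by length and now does so by index.\<close>

lemma spectral_phi:
  assumes n: "n \<ge> 1" and j: "j \<in> {1..n}"
  shows "spectral n (phi n \<gamma>) j = spectral n \<gamma> (cyc n j) + (if j = n then 1 else 0)"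
proof -
  have prec: "prec (phi n \<gamma>) b j \<longleftrightarrow> prec \<gamma> (cyc n b) (cyc n j)" if b: "b \<in> {1..n}" for b
  proof -
    consider "b = n" "j = n" | "b = n" "j < n" | "b < n" "j = n" | "b < n" "j < n"
      using b j by fastforce
    then show ?thesis
      by cases (use n b j in \<open>auto simp: prec_def lookup_phi cyc_def\<close>)
  qed
  have "bij_betw (cyc n) {b \<in> {1..n}. prec (phi n \<gamma>) b j} {b \<in> {1..n}. prec \<gamma> b (cyc n j)}"
    by (rule bij_betw_byWitness [where f' = "inv (cyc n)"])
      (use cyc_in [OF n] permutes_inverses [OF cyc_permutes [OF n]]
        permutes_in_image [OF permutes_inv [OF cyc_permutes [OF n]]] prec
        in \<open>auto simp del: atLeastAtMost_iff\<close>)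
  then have "rnk n (phi n \<gamma>) j = rnk n \<gamma> (cyc n j)"
    unfolding rnk_def by (rule bij_betw_same_card)
  then show ?thesis
    using j n cyc_in [OF n, of j] by (simp add: spectral_eq lookup_phi)
qed

text \<open>An empty last row is sorted last, where \<open>\<delta>\<close> is 0. Hence the factor
  \<open>x\<^sub>n\<close> in \<open>shift\<close> vanishes at every such vector.\<close>

lemma spectral_last_0:
  assumes n: "n \<ge> 1" and "lk \<gamma> n = 0"
  shows "spectral n \<gamma> n = 0"
proof -
  have "{b \<in> {1..n}. prec \<gamma> b n} = {1..n} - {n}"
    using assms by (auto simp: prec_def)
  then have "Suc (rnk n \<gamma> n) = n" using n by (simp add: rnk_def)
  then show ?thesis using assms by (simp add: spectral_eq)
qed

text \<open>The Hecke operators \<open>sigma i\<close> and \<open>shift n\<close> satisfy \<open>sigma i P\<^sub>\<eta> = P\<^bsub>sw i \<eta>\<^esub>\<close> and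
  \<open>shift n P\<^sub>\<eta> = P\<^bsub>phi n \<eta>\<^esub>\<close>.\<close>

definition sigma :: "nat \<Rightarrow> ratfun mvpoly \<Rightarrow> ratfun mvpoly" where
  "sigma i = lin (\<lambda>m. monomial (sw i m) + Const rvar * divdiff i m)"

lemma eval_sigma:
  assumes ne: "x i \<noteq> x (Suc i)"
  shows "eval_poly (sigma i p) x = eval_poly p (x \<circ> transpose i (Suc i)) +
    rvar / (x i - x (Suc i)) * (eval_poly p x - eval_poly p (x \<circ> transpose i (Suc i)))"
proof -
  let ?y = "x \<circ> transpose i (Suc i)"
  have dd: "eval_poly (divdiff i m) x = (mono_eval m x - mono_eval m ?y) / (x i - x (Suc i))" for m
    using eval_divdiff [of x i m] ne by (simp add: mono_eval_sw field_simps)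
  have "eval_poly (sigma i p) x = (\<Sum>m\<in>Poly_Mapping.keys p. lk p m * mono_eval m ?y +
    rvar / (x i - x (Suc i)) * (lk p m * mono_eval m x - lk p m * mono_eval m ?y))"
    unfolding sigma_def eval_lin
    by (intro sum.cong refl, simp only: eval_add eval_Const_mult eval_monomial mono_eval_sw dd)
      (simp add: algebra_simps diff_divide_distrib)
  then show ?thesis
    by (simp only: eval_alt [of p] sum.distrib sum_subtractf sum_distrib_left [symmetric])
qed

definition shift :: "nat \<Rightarrow> ratfun mvpoly \<Rightarrow> ratfun mvpoly" where
  "shift n = lin (shiftmono n)"

lemma eval_shift:
  assumes n: "n \<ge> 1" and p: "p \<in> polys n"
    and z: "\<And>j. j \<in> {1..n} \<Longrightarrow> z (cyc n j) = x j - (if j = n then 1 else 0)"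
  shows "eval_poly (shift n p) x = x n * eval_poly p z"
proof -
  have "eval_poly (shift n p) x = (\<Sum>m\<in>Poly_Mapping.keys p. lk p m * (x n * mono_eval m z))"
    unfolding shift_def eval_lin using p
    by (intro sum.cong refl arg_cong2 [where f = "(*)"] eval_shiftmono n z) (auto simp: polys_def)
  then show ?thesis
    by (simp add: eval_alt [of p] sum_distrib_left ac_simps)
qed

section \<open>Falling factorials, the values at \<open>r = 0\<close>\<close>

definition ff :: "nat \<Rightarrow> nat \<Rightarrow> rat" where
  "ff a k = (\<Prod>j<k. of_nat a - of_nat j)"

lemma ff_0 [simp]: "ff a 0 = 1" and ff_0_Suc [simp]: "ff 0 (Suc k) = 0"
  by (auto simp: ff_def)

lemma ff_Suc_Suc: "ff (Suc a) (Suc k) = of_nat (Suc a) * ff a k"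
  unfolding ff_def by (subst prod.lessThan_Suc_shift) simp

lemma ff_self: "ff a a \<noteq> 0"
  by (induction a) (simp_all add: ff_Suc_Suc)

lemma ff_eq_0: "a < k \<Longrightarrow> ff a k = 0"
  by (auto simp: ff_def)

definition ffall :: "nat \<Rightarrow> expo \<Rightarrow> expo \<Rightarrow> rat" where
  "ffall n \<gamma> \<eta> = (\<Prod>i\<in>{1..n}. ff (lk \<gamma> i) (lk \<eta> i))"

text \<open>A nonzero product forces each row of \<open>\<eta>\<close> to be at most that of
  \<open>\<gamma>\<close>, and equal sizes then force equality. So within a level the matrix of
  these values is diagonal.\<close>

lemma ffall_level:
  assumes "\<gamma> \<in> level n d" "\<eta> \<in> level n d"
  shows "ffall n \<gamma> \<eta> \<noteq> 0 \<longleftrightarrow> \<gamma> = \<eta>"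
proof
  assume "\<gamma> = \<eta>"
  then show "ffall n \<gamma> \<eta> \<noteq> 0" by (simp add: ffall_def ff_self)
next
  assume nz: "ffall n \<gamma> \<eta> \<noteq> 0"
  have le: "lk \<eta> i \<le> lk \<gamma> i" if "i \<in> {1..n}" for i
  proof (rule ccontr)
    assume "\<not> ?thesis"
    then have "ff (lk \<gamma> i) (lk \<eta> i) = 0" by (simp add: ff_eq_0)
    then show False using nz that by (auto simp: ffall_def)
  qed
  have "(\<Sum>i\<in>{1..n}. lk \<gamma> i) = (\<Sum>i\<in>{1..n}. lk \<eta> i)"
    using assms csize_comp [of \<gamma> n] csize_comp [of \<eta> n] by (simp add: level_def)
  then have "lk \<gamma> i = lk \<eta> i" if "i \<in> {1..n}" for i
    using sum_mono_inv [of "lk \<eta>" "{1..n}" "lk \<gamma>"] le that by fastforce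
  then show "\<gamma> = \<eta>"
    using assms by (intro poly_mapping_eqI) (metis level_def compositions_iff mem_Collect_eq)
qed

text \<open>
  Besides the defining properties of \<open>P\<^sub>\<eta>\<close> this records its subleading term and, for the
  uniqueness of interpolation, its values at \<open>r = 0\<close>.
\<close>

definition good :: "nat \<Rightarrow> expo \<Rightarrow> ratfun mvpoly \<Rightarrow> bool" where
  "good n \<eta> P \<longleftrightarrow>
     supp_in {\<mu> \<in> compositions n. Suc (csize \<mu>) < csize \<eta>} (P - monomial \<eta> - sublead n \<eta>) \<and>
     (\<forall>\<gamma>\<in>compositions n. csize \<gamma> < csize \<eta> \<longrightarrow> eval_poly P (spectral n \<gamma>) = 0) \<and>
     (\<forall>\<gamma>\<in>compositions n. reg (eval_poly P (spectral n \<gamma>)) (ffall n \<gamma> \<eta>))"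

lemma good_supp:
  assumes "good n \<eta> P" "\<eta> \<in> compositions n"
  shows "supp_in {\<mu> \<in> compositions n. csize \<mu> \<le> csize \<eta>} P"
proof -
  let ?A = "{\<mu> \<in> compositions n. csize \<mu> \<le> csize \<eta>}"
  have "supp_in ?A (P - monomial \<eta> - sublead n \<eta>)"
    using assms(1) unfolding good_def by (auto elim!: supp_in_mono)
  moreover have "supp_in ?A (sublead n \<eta>)"
    using supp_sublead [OF assms(2)] by (rule supp_in_mono) auto
  moreover have "supp_in ?A (monomial \<eta> :: ratfun mvpoly)"
    using assms(2) by simp
  ultimately have "supp_in ?A ((P - monomial \<eta> - sublead n \<eta>) + sublead n \<eta> + monomial \<eta>)"
    by (intro supp_in_add)
  then show ?thesis by simp
qed

lemma good_polys: "good n \<eta> P \<Longrightarrow> \<eta> \<in> compositions n \<Longrightarrow> P \<in> polys n"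
  unfolding polys_iff by (rule supp_in_mono [OF good_supp]) auto

section \<open>Construction of the polynomials by Hecke operators\<close>

lemma good_0: "good n 0 (monomial 0)"
proof -
  have "sublead n 0 = 0"
    by (simp add: sublead_def subpair_def subdiag_def case_prod_unfold Const_distrib binomial_eq_0)
  moreover have "mono_eval 0 x = (1 :: ratfun)" for x
    by (simp add: mono_eval_def)
  ultimately show ?thesis by (simp add: good_def ffall_def)
qed

text \<open>The highest terms follow from \<open>sublead_sw\<close>. If rows \<open>i\<close> and
  \<open>Suc i\<close> of \<open>\<gamma>\<close> are equal, the value at \<open>\<gamma>\<close> is
  unchanged; otherwise it is the value at \<open>sw i \<gamma>\<close>, of the same size, plus
  \<open>r / (x\<^sub>i - x\<^sub>i\<^sub>+\<^sub>1)\<close> times a difference of two such values,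
  and this quotient vanishes at \<open>r = 0\<close>.\<close>

lemma good_sw:
  assumes i: "1 \<le> i" "i < n" and \<eta>: "\<eta> \<in> compositions n" and P: "good n \<eta> P"
  shows "good n (sw i \<eta>) (sigma i P)"
  unfolding good_def
proof (intro conjI ballI impI)
  let ?R = "P - monomial \<eta> - sublead n \<eta>"
  let ?s = "lin (\<lambda>\<mu>. monomial (sw i \<mu>)) :: ratfun mvpoly \<Rightarrow> _"
  let ?A = "{\<mu> \<in> compositions n. Suc (csize \<mu>) < csize (sw i \<eta>)}"
  have R: "supp_in ?A ?R" using P by (simp add: good_def)
  have sup: "supp_in {\<mu> \<in> compositions n. csize \<mu> \<le> csize m} (monomial (sw i m) + Const rvar * divdiff i m)"
    if "m \<in> compositions n" for m
    using i that supp_divdiff [OF that i]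
    by (intro supp_in_add supp_in_Const_mult) (auto simp: sw_comp elim!: supp_in_mono)
  have sR: "supp_in ?A (sigma i ?R)"
    unfolding sigma_def
    using P unfolding good_def by (elim conjE) (erule supp_in_lin, rule supp_in_mono [OF sup], auto)
  have sN: "supp_in ?A (lin (divdiff i) (sublead n \<eta>))"
  proof (rule supp_in_lin [OF supp_sublead [OF \<eta>]])
    fix m assume "m \<in> {\<mu> \<in> compositions n. Suc (csize \<mu>) = csize \<eta>}"
    then show "supp_in ?A (divdiff i m)"
      using supp_divdiff [of m n i] i by (auto elim!: supp_in_mono)
  qed
  have "sigma i P = sigma i ?R + sigma i (sublead n \<eta>) + sigma i (monomial \<eta>)"
    unfolding sigma_def by (simp add: lin_diff)
  also have "sigma i (sublead n \<eta>) = ?s (sublead n \<eta>) + Const rvar * lin (divdiff i) (sublead n \<eta>)"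
    unfolding sigma_def by (simp add: lin_plus lin_Const_fun)
  also have "sigma i (monomial \<eta>) = monomial (sw i \<eta>) + Const rvar * divdiff i \<eta>"
    unfolding sigma_def by simp
  finally have "sigma i P - monomial (sw i \<eta>) - sublead n (sw i \<eta>) =
      sigma i ?R + Const rvar * lin (divdiff i) (sublead n \<eta>)"
    unfolding sublead_sw [OF i] by simp
  then show "supp_in ?A (sigma i P - monomial (sw i \<eta>) - sublead n (sw i \<eta>))"
    using sR sN by (simp add: supp_in_add supp_in_Const_mult)
next
  have ev: "if lk \<gamma> i = lk \<gamma> (Suc i) then eval_poly (sigma i P) (spectral n \<gamma>) = eval_poly P (spectral n \<gamma>)
    else spectral n \<gamma> i - spectral n \<gamma> (Suc i) \<noteq> 0 \<and>
      reg (rvar / (spectral n \<gamma> i - spectral n \<gamma> (Suc i))) 0 \<and>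
      eval_poly (sigma i P) (spectral n \<gamma>) = eval_poly P (spectral n (sw i \<gamma>)) +
       rvar / (spectral n \<gamma> i - spectral n \<gamma> (Suc i)) *
         (eval_poly P (spectral n \<gamma>) - eval_poly P (spectral n (sw i \<gamma>)))" for \<gamma>
  proof (cases "lk \<gamma> i = lk \<gamma> (Suc i)")
    case True
    have r: "rvar \<noteq> 0" by (simp add: rvar_def Zero_fract_def eq_fract)
    have d: "spectral n \<gamma> i - spectral n \<gamma> (Suc i) = rvar" by (rule spectral_diff_tie [OF i True])
    then have "spectral n \<gamma> i \<noteq> spectral n \<gamma> (Suc i)" using r by auto
    then show ?thesis using True d r by (simp add: eval_sigma)
  next
    case False
    have rg: "reg (spectral n \<gamma> i - spectral n \<gamma> (Suc i)) (of_nat (lk \<gamma> i) - of_nat (lk \<gamma> (Suc i)))"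
      using i by (intro reg_diff reg_spectral) auto
    have nz: "(of_nat (lk \<gamma> i) - of_nat (lk \<gamma> (Suc i)) :: rat) \<noteq> 0" using False by simp
    have d: "spectral n \<gamma> i - spectral n \<gamma> (Suc i) \<noteq> 0" by (rule reg_nonzero [OF rg nz])
    have "reg (rvar / (spectral n \<gamma> i - spectral n \<gamma> (Suc i))) 0"
      using reg_divide [OF reg_rvar rg nz] by simp
    moreover have "eval_poly P (spectral n \<gamma> \<circ> transpose i (Suc i)) = eval_poly P (spectral n (sw i \<gamma>))"
      by (rule eval_cong [OF good_polys [OF P \<eta>]]) (use spectral_sw [OF i False] in auto)
    ultimately show ?thesis using False d by (simp add: eval_sigma)
  qed
  fix \<gamma> assume \<gamma>: "\<gamma> \<in> compositions n"
  then have sw\<gamma>: "sw i \<gamma> \<in> compositions n" using i by (simp add: sw_comp)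
  show "eval_poly (sigma i P) (spectral n \<gamma>) = 0" if "csize \<gamma> < csize (sw i \<eta>)"
    using ev [of \<gamma>] P \<gamma> sw\<gamma> that by (simp add: good_def split: if_splits)
  have rg: "reg (eval_poly P (spectral n \<gamma>)) (ffall n \<gamma> \<eta>)"
    "reg (eval_poly P (spectral n (sw i \<gamma>))) (ffall n (sw i \<gamma>) \<eta>)"
    using P \<gamma> sw\<gamma> by (simp_all add: good_def)
  have t: "transpose i (Suc i) permutes {1..n}" using i by (intro permutes_swap_id) auto
  have ffs: "ffall n (sw i \<gamma>) \<eta> = ffall n \<gamma> (sw i \<eta>)"
    using prod.permute [OF t, of "\<lambda>j. ff (lk (sw i \<gamma>) j) (lk \<eta> j)"]
    by (simp add: ffall_def lookup_sw comp_def)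
  show "reg (eval_poly (sigma i P) (spectral n \<gamma>)) (ffall n \<gamma> (sw i \<eta>))"
  proof (cases "lk \<gamma> i = lk \<gamma> (Suc i)")
    case True
    then have "sw i \<gamma> = \<gamma>"
      by (intro poly_mapping_eqI) (auto simp: lookup_sw transpose_def)
    then show ?thesis using ev [of \<gamma>] True rg ffs by simp
  next
    case False
    then show ?thesis
      using ev [of \<gamma>] reg_add [OF rg(2) reg_mult [OF _ reg_diff [OF rg]]] ffs by fastforce
  qed
qed

text \<open>If the last row of \<open>\<gamma>\<close> is empty, the factor \<open>x\<^sub>n\<close>
  of \<open>shift\<close> vanishes there. Otherwise \<open>\<gamma> = phi n \<gamma>'\<close>, and
  the value is the last entry of the spectral vector times the value of \<open>P\<close> at
  \<open>\<gamma>'\<close>, which has one box less.\<close>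

lemma good_phi:
  assumes n: "n \<ge> 1" and \<eta>: "\<eta> \<in> compositions n" and P: "good n \<eta> P"
  shows "good n (phi n \<eta>) (shift n P)"
  unfolding good_def
proof (intro conjI ballI impI)
  let ?R = "P - monomial \<eta> - sublead n \<eta>"
  let ?L = "lin (\<lambda>\<mu>. monomial (phi n \<mu>)) :: ratfun mvpoly \<Rightarrow> _"
  let ?D = "\<lambda>m. shiftmono n m - monomial (phi n m)"
  let ?K = "\<lambda>m. Const (of_nat (lk m 1)) * monomial (phi n (Poly_Mapping.update 1 (lk m 1 - 1) m)) :: ratfun mvpoly"
  let ?A = "{\<mu> \<in> compositions n. Suc (csize \<mu>) < csize (phi n \<eta>)}"
  have supK: "supp_in {\<mu> \<in> compositions n. csize \<mu> \<le> csize m} (?K m)" if m: "m \<in> compositions n" for m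
  proof (cases "lk m 1")
    case 0
    then show ?thesis by (simp add: Const_distrib)
  next
    case (Suc k)
    then show ?thesis
      using m n csize_upd [of 1 k m]
      by (intro supp_in_Const_mult) (simp add: phi_comp upd_comp csize_phi)
  qed
  have supD: "supp_in {\<mu> \<in> compositions n. csize \<mu> \<le> csize m} (?D m)" if m: "m \<in> compositions n" for m
  proof -
    have "supp_in {\<mu> \<in> compositions n. csize \<mu> \<le> csize m} (?D m + ?K m)"
      using shiftmono_top [OF n m] by (rule supp_in_mono) auto
    from supp_in_diff [OF this supK [OF m]] show ?thesis by simp
  qed
  have R: "supp_in {\<mu> \<in> compositions n. Suc (csize \<mu>) < csize \<eta>} ?R" using P by (simp add: good_def)
  have sR: "supp_in ?A (shift n ?R)"
    unfolding shift_def
  proof (rule supp_in_lin [OF R])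
    fix m assume m: "m \<in> {\<mu> \<in> compositions n. Suc (csize \<mu>) < csize \<eta>}"
    then have "supp_in ?A (?D m)"
      using supD [of m] n \<eta> by (auto simp: csize_phi elim!: supp_in_mono)
    moreover have "supp_in ?A (monomial (phi n m) :: ratfun mvpoly)"
      using m n \<eta> by (simp add: phi_comp csize_phi)
    ultimately have "supp_in ?A (?D m + monomial (phi n m))" by (rule supp_in_add)
    then show "supp_in ?A (shiftmono n m)" by simp
  qed
  have sS: "supp_in ?A (lin ?D (sublead n \<eta>))"
  proof (rule supp_in_lin [OF supp_sublead [OF \<eta>]])
    fix m assume "m \<in> {\<mu> \<in> compositions n. Suc (csize \<mu>) = csize \<eta>}"
    then show "supp_in ?A (?D m)"
      using supD [of m] n \<eta> by (auto simp: csize_phi elim!: supp_in_mono)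
  qed
  \<comment> \<open>\<open>?D \<eta>\<close> alone may have a part of size
    \<open>csize \<eta>\<close>; adding \<open>?K \<eta>\<close>, the correction in
    \<open>sublead_phi\<close>, removes it.\<close>
  have sM: "supp_in ?A (?D \<eta> + ?K \<eta>)"
    using shiftmono_top [OF n \<eta>] n \<eta> by (auto simp: csize_phi elim!: supp_in_mono)
  have "shift n P = shift n ?R + shift n (sublead n \<eta>) + shift n (monomial \<eta>)"
    unfolding shift_def by (simp add: lin_diff)
  also have "shift n (sublead n \<eta>) = ?L (sublead n \<eta>) + lin ?D (sublead n \<eta>)"
    unfolding shift_def by (simp add: lin_minus)
  also have "shift n (monomial \<eta>) = monomial (phi n \<eta>) + ?D \<eta>"
    unfolding shift_def by simp
  finally have "shift n P - monomial (phi n \<eta>) - sublead n (phi n \<eta>) =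
      shift n ?R + lin ?D (sublead n \<eta>) + (?D \<eta> + ?K \<eta>)"
    unfolding sublead_phi [OF n] by simp
  then show "supp_in ?A (shift n P - monomial (phi n \<eta>) - sublead n (phi n \<eta>))"
    using sR sS sM by (simp only: supp_in_add)
next
  fix \<gamma> assume \<gamma>: "\<gamma> \<in> compositions n"
  have "(csize \<gamma> < csize (phi n \<eta>) \<longrightarrow> eval_poly (shift n P) (spectral n \<gamma>) = 0) \<and>
    reg (eval_poly (shift n P) (spectral n \<gamma>)) (ffall n \<gamma> (phi n \<eta>))"
  proof (cases "lk \<gamma> n = 0")
    case True
    have "ffall n \<gamma> (phi n \<eta>) = 0"
      unfolding ffall_def by (rule prod_zero) (use n True in \<open>auto intro!: bexI [of _ n] simp: lookup_phi\<close>)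
    moreover have "eval_poly (shift n P) (spectral n \<gamma>) = spectral n \<gamma> n *
      eval_poly P (\<lambda>i. spectral n \<gamma> (inv (cyc n) i) - (if inv (cyc n) i = n then 1 else 0))"
      using permutes_inverses [OF cyc_permutes [OF n]]
      by (intro eval_shift n good_polys [OF P \<eta>]) auto
    ultimately show ?thesis by (simp add: spectral_last_0 [OF n True])
  next
    case False
    obtain \<gamma>' where \<gamma>': "\<gamma>' \<in> compositions n" "\<gamma> = phi n \<gamma>'"
      by (rule phi_surj [OF n \<gamma> False])
    have ev: "eval_poly (shift n P) (spectral n \<gamma>) = spectral n \<gamma> n * eval_poly P (spectral n \<gamma>')"
      by (rule eval_shift [OF n good_polys [OF P \<eta>]]) (simp add: \<gamma>' spectral_phi [OF n])
    \<comment> \<open>Row \<open>n\<close> of both arguments has gained a box, and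
      \<open>ff_Suc_Suc\<close> splits off the factor \<open>lk \<gamma> n\<close>; the other rows
      are merely rotated.\<close>
    have "(\<Prod>i\<in>{1..n}. ff (lk \<gamma> i) (lk (phi n \<eta>) i)) =
      (\<Prod>i\<in>{1..n}. (if i = n then of_nat (lk \<gamma> n) else 1) * ff (lk \<gamma>' (cyc n i)) (lk \<eta> (cyc n i)))"
      by (rule prod.cong) (use n in \<open>auto simp: \<gamma>' lookup_phi ff_Suc_Suc\<close>)
    also have "\<dots> = of_nat (lk \<gamma> n) * ffall n \<gamma>' \<eta>"
      using n prod.permute [OF cyc_permutes [OF n], of "\<lambda>i. ff (lk \<gamma>' i) (lk \<eta> i)"]
      by (simp add: prod.distrib ffall_def comp_def)
    finally have f: "ffall n \<gamma> (phi n \<eta>) = of_nat (lk \<gamma> n) * ffall n \<gamma>' \<eta>" by (simp add: ffall_def)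
    have "reg (eval_poly P (spectral n \<gamma>')) (ffall n \<gamma>' \<eta>)"
      using P \<gamma>' by (simp add: good_def)
    moreover have "reg (spectral n \<gamma> n) (of_nat (lk \<gamma> n))"
      using n by (intro reg_spectral) auto
    ultimately have "reg (eval_poly (shift n P) (spectral n \<gamma>)) (ffall n \<gamma> (phi n \<eta>))"
      unfolding ev f by (intro reg_mult)
    moreover have "eval_poly P (spectral n \<gamma>') = 0" if "csize \<gamma> < csize (phi n \<eta>)"
      using that P \<gamma>' n \<eta> by (simp add: good_def csize_phi)
    ultimately show ?thesis using ev by simp
  qed
  then show "csize \<gamma> < csize (phi n \<eta>) \<Longrightarrow> eval_poly (shift n P) (spectral n \<gamma>) = 0"
    "reg (eval_poly (shift n P) (spectral n \<gamma>)) (ffall n \<gamma> (phi n \<eta>))" by auto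
qed

text \<open>Induction on the size. If the last row is nonempty, \<open>good_phi\<close> reduces to a
  smaller composition; a nonempty row \<open>k < n\<close> is first brought to the bottom by
  adjacent exchanges, which \<open>good_sw\<close> undoes.\<close>

lemma good_exists:
  assumes n: "n \<ge> 1" and "\<eta> \<in> compositions n"
  shows "\<exists>P. good n \<eta> P"
  using assms(2)
proof (induction "csize \<eta>" arbitrary: \<eta>)
  case 0
  then show ?case using good_0 by force
next
  case (Suc d)
  have step: "\<exists>P. good n \<nu> P" if "k \<in> {1..n}" "lk \<nu> k \<noteq> 0" "\<nu> \<in> compositions n" "csize \<nu> = Suc d" for k \<nu>
    using that
  proof (induction "n - k" arbitrary: k \<nu>)
    case 0
    then have "k = n" by simp
    with 0 obtain \<mu> where \<mu>: "\<mu> \<in> compositions n" "\<nu> = phi n \<mu>"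
      using phi_surj [OF n] by metis
    then have "d = csize \<mu>" using 0 n by (simp add: csize_phi)
    then obtain P where "good n \<mu> P" using Suc.hyps(1) \<mu> by blast
    then show ?case using good_phi [OF n \<mu>(1)] \<mu> by blast
  next
    case (Suc e)
    then have k: "1 \<le> k" "k < n" by auto
    have "\<exists>P. good n (sw k \<nu>) P"
      by (rule Suc.hyps(1) [of "Suc k"]) (use Suc k in \<open>auto simp: lookup_sw sw_comp\<close>)
    then show ?case
      using good_sw [OF k sw_comp [OF Suc.prems(3) k]] by auto
  qed
  have "csize \<eta> \<noteq> 0" using Suc.hyps(2) by linarith
  then obtain k where "k \<in> {1..n}" "lk \<eta> k \<noteq> 0"
    using csize_comp [OF Suc.prems] by (metis sum.neutral)
  then show ?case using step Suc by metis
qed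

section \<open>Interpolation and the Pieri formula\<close>

text \<open>A choice of \<open>P\<^sub>\<eta>\<close>; what follows rests on the properties
  collected in \<open>good\<close>.\<close>

definition basic :: "nat \<Rightarrow> expo \<Rightarrow> ratfun mvpoly" where
  "basic n \<eta> = (SOME P. good n \<eta> P)"

lemma good_basic: "n \<ge> 1 \<Longrightarrow> \<eta> \<in> compositions n \<Longrightarrow> good n \<eta> (basic n \<eta>)"
  unfolding basic_def by (rule someI_ex) (rule good_exists)

lemma basic_polys: "n \<ge> 1 \<Longrightarrow> \<eta> \<in> compositions n \<Longrightarrow> basic n \<eta> \<in> polys n"
  by (rule good_polys [OF good_basic])

lemma supp_basic:
  "n \<ge> 1 \<Longrightarrow> \<eta> \<in> compositions n \<Longrightarrow> supp_in {\<mu> \<in> compositions n. csize \<mu> \<le> csize \<eta>} (basic n \<eta>)"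
  by (rule good_supp [OF good_basic])

text \<open>The subleading term and the remainder in \<open>good\<close> have smaller size than
  \<open>\<eta>\<close>. Hence the coefficients of a combination of the \<open>basic n \<mu>\<close>
  of one level can be read off from its top component.\<close>

lemma lookup_basic_top:
  assumes n: "n \<ge> 1" and \<eta>: "\<eta> \<in> level n d" and \<nu>: "csize \<nu> = d"
  shows "lk (basic n \<eta>) \<nu> = (if \<nu> = \<eta> then 1 else 0)"
proof -
  have c: "\<eta> \<in> compositions n" "csize \<eta> = d" using \<eta> by (auto simp: level_def)
  have "lk (basic n \<eta> - monomial \<eta> - sublead n \<eta>) \<nu> = 0"
    using good_basic [OF n c(1)] c \<nu> unfolding good_def supp_in_iff by force
  moreover have "lk (sublead n \<eta>) \<nu> = 0"
    using supp_sublead [OF c(1)] c \<nu> unfolding supp_in_iff by force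
  ultimately show ?thesis by (simp add: lookup_minus lookup_monomial)
qed

lemma eval_basic_0:
  "n \<ge> 1 \<Longrightarrow> \<eta> \<in> compositions n \<Longrightarrow> \<gamma> \<in> compositions n \<Longrightarrow> csize \<gamma> < csize \<eta> \<Longrightarrow>
    eval_poly (basic n \<eta>) (spectral n \<gamma>) = 0"
  using good_basic [of n \<eta>] by (simp add: good_def)

lemma reg_basic:
  assumes "n \<ge> 1" "\<gamma> \<in> level n d" "\<eta> \<in> level n d"
  shows "reg (eval_poly (basic n \<eta>) (spectral n \<gamma>)) (if \<gamma> = \<eta> then ffall n \<gamma> \<gamma> else 0)"
proof -
  have "reg (eval_poly (basic n \<eta>) (spectral n \<gamma>)) (ffall n \<gamma> \<eta>)"
    using good_basic [of n \<eta>] assms by (simp add: good_def level_def)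
  moreover have "ffall n \<gamma> \<eta> = (if \<gamma> = \<eta> then ffall n \<gamma> \<gamma> else 0)"
    using ffall_level [OF assms(2,3)] by auto
  ultimately show ?thesis by simp
qed

lemma ffall_self: "ffall n \<gamma> \<gamma> \<noteq> 0"
  by (simp add: ffall_def ff_self)

section \<open>Uniqueness of interpolation\<close>

lemma lookup_combination:
  assumes "n \<ge> 1" "\<nu> \<in> level n d"
  shows "lk (\<Sum>\<mu>\<in>level n d. Const (c \<mu>) * basic n \<mu>) \<nu> = c \<nu>"
proof -
  have "lk (\<Sum>\<mu>\<in>level n d. Const (c \<mu>) * basic n \<mu>) \<nu> = (\<Sum>\<mu>\<in>level n d. if \<nu> = \<mu> then c \<mu> else 0)"
    unfolding lookup_sum
    by (rule sum.cong) (use assms in \<open>auto simp: lookup_basic_top level_def\<close>)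
  then show ?thesis using assms by simp
qed

lemma supp_combination:
  "n \<ge> 1 \<Longrightarrow> supp_in {\<mu> \<in> compositions n. csize \<mu> \<le> d} (\<Sum>\<mu>\<in>level n d. Const (c \<mu>) * basic n \<mu>)"
  by (intro supp_in_sum supp_in_Const_mult supp_in_mono [OF supp_basic]) (auto simp: level_def)

lemma eval_combination_0:
  "n \<ge> 1 \<Longrightarrow> \<gamma> \<in> compositions n \<Longrightarrow> csize \<gamma> < d \<Longrightarrow>
    eval_poly (\<Sum>\<mu>\<in>level n d. Const (c \<mu>) * basic n \<mu>) (spectral n \<gamma>) = 0"
  unfolding eval_sum eval_Const_mult by (rule sum.neutral) (auto simp: level_def eval_basic_0)

text \<open>By \<open>reg_basic\<close> the matrix of values of the \<open>basic n \<mu>\<close> at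
  the spectral vectors of their own level is diagonal and invertible at
  \<open>r = 0\<close>.\<close>

lemma combination_unique:
  assumes n: "n \<ge> 1"
    and "\<And>\<gamma>. \<gamma> \<in> level n d \<Longrightarrow> eval_poly (\<Sum>\<mu>\<in>level n d. Const (c \<mu>) * basic n \<mu>) (spectral n \<gamma>) = 0"
    and "\<nu> \<in> level n d"
  shows "c \<nu> = 0"
proof (rule reg_solution_unique [where I = "level n d" and a = "\<lambda>\<gamma>. ffall n \<gamma> \<gamma>"
      and M = "\<lambda>\<gamma> \<nu>. eval_poly (basic n \<nu>) (spectral n \<gamma>)"])
  show "(\<Sum>j\<in>level n d. eval_poly (basic n j) (spectral n \<gamma>) * c j) = 0" if "\<gamma> \<in> level n d" for \<gamma>
    using assms(2) [OF that] by (simp add: eval_sum eval_Const_mult mult.commute)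
qed (use assms reg_basic ffall_self in auto)

lemma supp_minus_combination:
  assumes n: "n \<ge> 1" and f: "supp_in {\<mu> \<in> compositions n. csize \<mu> \<le> e} f"
  shows "supp_in {\<mu> \<in> compositions n. csize \<mu> < e} (f - (\<Sum>\<nu>\<in>level n e. Const (lk f \<nu>) * basic n \<nu>))"
    (is "supp_in _ ?g")
proof -
  have g: "supp_in {\<mu> \<in> compositions n. csize \<mu> \<le> e} ?g"
    by (intro supp_in_diff f supp_combination n)
  show ?thesis
    unfolding supp_in_iff
  proof (intro allI impI)
    fix m assume m: "lk ?g m \<noteq> 0"
    then have "m \<in> compositions n" "csize m \<le> e" using g by (auto simp: supp_in_iff)
    moreover have "csize m \<noteq> e"
      using m calculation lookup_combination [OF n, of m e] by (auto simp: lookup_minus level_def)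
    ultimately show "m \<in> {\<mu> \<in> compositions n. csize \<mu> < e}" by simp
  qed
qed

text \<open>Induction on the degree bound. Subtracting the combination of the
  \<open>basic n \<nu>\<close> with the same top component lowers the degree and keeps the zeros
  below level \<open>e\<close>, so \<open>f\<close> equals that combination; the zeros at level
  \<open>e\<close> then make its coefficients vanish.\<close>

lemma interp_zero:
  assumes n: "n \<ge> 1"
  shows "supp_in {\<mu> \<in> compositions n. csize \<mu> < e} f \<Longrightarrow>
    (\<And>\<gamma>. \<gamma> \<in> compositions n \<Longrightarrow> csize \<gamma> < e \<Longrightarrow> eval_poly f (spectral n \<gamma>) = 0) \<Longrightarrow> f = 0"
proof (induction e arbitrary: f)
  case 0
  then show ?case by (simp add: supp_in_def)
next
  case (Suc e)
  let ?h = "\<Sum>\<nu>\<in>level n e. Const (lk f \<nu>) * basic n \<nu>"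
  have "f - ?h = 0"
  proof (rule Suc.IH)
    show "supp_in {\<mu> \<in> compositions n. csize \<mu> < e} (f - ?h)"
      using Suc.prems(1) by (intro supp_minus_combination n) (simp add: less_Suc_eq_le)
    show "eval_poly (f - ?h) (spectral n \<gamma>) = 0" if "\<gamma> \<in> compositions n" "csize \<gamma> < e" for \<gamma>
      using that Suc.prems(2) eval_combination_0 [OF n that] by (simp add: eval_diff)
  qed
  then have f: "f = ?h" by simp
  have "lk f \<nu> = 0" if "\<nu> \<in> level n e" for \<nu>
    by (rule combination_unique [OF n _ that])
      (use Suc.prems(2) f in \<open>auto simp: level_def\<close>)
  then show ?case by (subst f) (simp add: Const_distrib)
qed

text \<open>The difference has degree below \<open>e\<close> and vanishes below level
  \<open>e\<close>, so \<open>interp_zero\<close> applies. Thus polynomials with these zeros are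
  determined by their top component.\<close>

lemma interp_expand:
  assumes n: "n \<ge> 1" and f: "supp_in {\<mu> \<in> compositions n. csize \<mu> \<le> e} f"
    and 0: "\<And>\<gamma>. \<gamma> \<in> compositions n \<Longrightarrow> csize \<gamma> < e \<Longrightarrow> eval_poly f (spectral n \<gamma>) = 0"
  shows "f = (\<Sum>\<nu>\<in>level n e. Const (lk f \<nu>) * basic n \<nu>)"
proof -
  have "f - (\<Sum>\<nu>\<in>level n e. Const (lk f \<nu>) * basic n \<nu>) = 0"
    by (rule interp_zero [OF n supp_minus_combination [OF n f]])
      (simp add: eval_diff 0 eval_combination_0 [OF n])
  then show ?thesis by simp
qed

section \<open>The Pieri formula\<close>

lemma supp_X_mult:
  assumes "k \<in> {1..n}" and "supp_in A p" and "\<And>m. m \<in> A \<Longrightarrow> m + Poly_Mapping.single k (Suc 0) \<in> B"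
  shows "supp_in B (X k * p :: 'a::comm_ring_1 mvpoly)"
  unfolding X_mult_lin by (rule supp_in_lin [OF assms(2)]) (simp add: assms(3))

lemma add_single_comp:
  "m \<in> compositions n \<Longrightarrow> k \<in> {1..n} \<Longrightarrow> m + Poly_Mapping.single k c \<in> compositions n"
  by (auto simp: compositions_iff lookup_add lookup_single when_def)

text \<open>Both terms on the left vanish below level \<open>csize \<eta>\<close>. Their leading
  monomials cancel, and the remaining part of size \<open>csize \<eta>\<close> is the difference of
  the subleading terms, so \<open>interp_expand\<close> gives the right-hand side.\<close>

lemma basic_pieri:
  assumes n: "n \<ge> 1" and \<eta>: "\<eta> \<in> compositions n" and k: "k \<in> {1..n}"
    and \<kappa>: "\<kappa> = \<eta> + Poly_Mapping.single k (Suc 0)"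
  shows "X k * basic n \<eta> - basic n \<kappa> = lin (basic n) (X k * sublead n \<eta> - sublead n \<kappa>)"
proof -
  let ?d = "csize \<eta>" and ?g = "X k * sublead n \<eta> - sublead n \<kappa>"
  let ?f = "X k * basic n \<eta> - basic n \<kappa>"
  let ?R = "basic n \<eta> - monomial \<eta> - sublead n \<eta>" and ?Q = "basic n \<kappa> - monomial \<kappa> - sublead n \<kappa>"
  let ?B = "{\<mu> \<in> compositions n. csize \<mu> < ?d}"
  have \<kappa>c: "\<kappa> \<in> compositions n" "csize \<kappa> = Suc ?d"
    using \<eta> k by (simp_all add: \<kappa> add_single_comp csize_add)
  have s1: "supp_in ?B (X k * ?R)"
    by (rule supp_X_mult [OF k, of "{\<mu> \<in> compositions n. Suc (csize \<mu>) < ?d}"])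
      (use good_basic [OF n \<eta>] k in \<open>auto simp: good_def add_single_comp csize_add\<close>)
  have s2: "supp_in ?B ?Q"
    using good_basic [OF n \<kappa>c(1)] \<kappa>c(2) by (simp add: good_def)
  have fg: "?f - ?g = X k * ?R - ?Q"
    by (simp add: algebra_simps X_mult_monomial \<kappa>)
  have low: "supp_in ?B (?f - ?g)"
    by (subst fg) (rule supp_in_diff [OF s1 s2])
  have g: "supp_in (level n ?d) ?g"
  proof (rule supp_in_diff)
    show "supp_in (level n ?d) (X k * sublead n \<eta>)"
      by (rule supp_X_mult [OF k supp_sublead [OF \<eta>]])
        (use k in \<open>auto simp: level_def add_single_comp csize_add\<close>)
    show "supp_in (level n ?d) (sublead n \<kappa>)"
      using supp_sublead [OF \<kappa>c(1)] \<kappa>c(2) by (simp add: level_def)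
  qed
  have lkf: "lk ?f \<nu> = lk ?g \<nu>" if "\<nu> \<in> level n ?d" for \<nu>
  proof -
    have "lk (?f - ?g) \<nu> = 0" using low that by (auto simp: supp_in_iff level_def)
    then show ?thesis by (simp only: lookup_minus right_minus_eq)
  qed
  have "supp_in {\<mu> \<in> compositions n. csize \<mu> \<le> ?d} ((?f - ?g) + ?g)"
    using low g by (intro supp_in_add; elim supp_in_mono; auto simp: level_def)
  then have "?f = (\<Sum>\<nu>\<in>level n ?d. Const (lk ?f \<nu>) * basic n \<nu>)"
    by (intro interp_expand [OF n])
      (simp_all add: eval_diff eval_X_mult eval_basic_0 [OF n \<eta>] eval_basic_0 [OF n \<kappa>c(1)] \<kappa>c(2))
  also have "\<dots> = (\<Sum>\<nu>\<in>level n ?d. Const (lk ?g \<nu>) * basic n \<nu>)"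
    by (rule sum.cong) (simp_all only: lkf)
  also have "\<dots> = lin (basic n) ?g"
    using g by (intro lin_superset [symmetric]) (auto simp: supp_in_def)
  finally show ?thesis .
qed

lemma X_mult_put:
  "a \<noteq> k \<Longrightarrow> X k * monomial (put m a u k v) = (monomial (put m a u k (Suc v)) :: 'a::comm_ring_1 mvpoly)"
  "a \<noteq> k \<Longrightarrow> X k * monomial (put m k v a u) = (monomial (put m k (Suc v) a u) :: 'a::comm_ring_1 mvpoly)"
  unfolding X_mult_monomial
  by (rule arg_cong [where f = monomial], rule poly_mapping_eqI,
      auto simp: lookup_put lookup_add lookup_single when_def)+

lemma X_mult_subpair_other:
  assumes "a \<noteq> k" "b \<noteq> k"
  shows "X k * subpair a b m = subpair a b (m + Poly_Mapping.single k (Suc 0))"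
proof -
  have "put m a u b v + Poly_Mapping.single k (Suc 0) = put (m + Poly_Mapping.single k (Suc 0)) a u b v" for u v
    by (rule poly_mapping_eqI) (use assms in \<open>auto simp: lookup_put lookup_add lookup_single when_def\<close>)
  then have XX: "X k * (Const c * monomial (put m a u b v)) =
      Const c * monomial (put (m + Poly_Mapping.single k (Suc 0)) a u b v)" for u v and c :: ratfun
    by (simp only: mult.left_commute [of "X k"] X_mult_monomial)
  have lks: "lk (m + Poly_Mapping.single k (Suc 0)) a = lk m a" "lk (m + Poly_Mapping.single k (Suc 0)) b = lk m b"
    using assms by (auto simp: lookup_add lookup_single)
  show ?thesis
    unfolding subpair_def Let_def lks
    by (cases "lk m b < lk m a") (simp_all only: if_True if_False sum_distrib_left mult_minus_right XX)
qed

lemma X_mult_subdiag_other: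
  assumes "i \<noteq> k"
  shows "X k * subdiag i m = subdiag i (m + Poly_Mapping.single k (Suc 0))"
proof -
  have "Poly_Mapping.update i u m + Poly_Mapping.single k (Suc 0) =
      Poly_Mapping.update i u (m + Poly_Mapping.single k (Suc 0))" for u
    by (rule poly_mapping_eqI) (use assms in \<open>auto simp: lookup_upd lookup_add lookup_single when_def\<close>)
  then show ?thesis
    using assms unfolding subdiag_def
    by (simp add: mult.left_commute [of "X k"] X_mult_monomial lookup_add lookup_single)
qed

text \<open>Pascal's rule for row \<open>k\<close>, which gains a box. For the critical row the
  additional term becomes the summand \<open>m - 1\<close> of the weight.\<close>

lemma X_mult_subdiag_same:
  "subdiag k (m + Poly_Mapping.single k (Suc 0)) = X k * subdiag k m + Const (of_nat (lk m k)) * monomial m"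
proof (cases "lk m k")
  case 0
  then show ?thesis
    by (simp add: subdiag_def lookup_add lookup_single Const_distrib binomial_eq_0)
next
  case (Suc u)
  have 1: "Poly_Mapping.update k u m + Poly_Mapping.single k (Suc 0) = m"
    "Poly_Mapping.update k (Suc u) (m + Poly_Mapping.single k (Suc 0)) = m"
    by (rule poly_mapping_eqI; use Suc in \<open>auto simp: lookup_upd lookup_add lookup_single when_def\<close>)+
  have b: "(Suc (Suc u) choose 2) = (Suc u choose 2) + Suc u"
    by (simp add: numeral_2_eq_2)
  have "subdiag k (m + Poly_Mapping.single k (Suc 0)) = Const (of_nat (Suc (Suc u) choose 2)) * monomial m"
    unfolding subdiag_def by (simp add: lookup_add lookup_single Suc 1)
  moreover have "X k * subdiag k m = Const (of_nat (Suc u choose 2)) * monomial m"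
    unfolding subdiag_def Suc mult.left_commute [of "X k"] X_mult_monomial by (simp add: 1)
  ultimately show ?thesis
    unfolding b Suc by (simp only: of_nat_add Const_distrib distrib_right)
qed

lemma put_add_single:
  "j \<noteq> k \<Longrightarrow> put (m + Poly_Mapping.single k (Suc 0)) j u k v = put m j u k v"
  "j \<noteq> k \<Longrightarrow> put (m + Poly_Mapping.single k (Suc 0)) k v j u = put m j u k v"
  "j \<noteq> k \<Longrightarrow> put m k v j u = put m j u k v"
  by (rule poly_mapping_eqI; auto simp: lookup_put lookup_add lookup_single when_def)+

text \<open>Both terms run over the same exponents with weights differing by one, so each exponent
  survives with coefficient 1. These exponents arise from \<open>m\<close> by sliding
  \<open>l\<close> boxes from row \<open>k\<close> to row \<open>j\<close>.\<close>

lemma X_mult_subpair_before: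
  assumes "j \<noteq> k" and "lk m j \<le> lk m k"
  shows "X k * subpair j k m - subpair j k (m + Poly_Mapping.single k (Suc 0)) =
    (\<Sum>l<lk m k - lk m j. monomial (put m j (lk m j + l) k (lk m k - l)))"
proof -
  let ?d = "lk m k - lk m j"
  let ?f = "\<lambda>l. monomial (put m j (lk m j + l) k (lk m k - l)) :: ratfun mvpoly"
  have "X k * subpair j k m = - (\<Sum>l<?d-1. Const (of_nat (?d - 1 - l)) * ?f l)"
  proof -
    have "X k * monomial (put m j (lk m j + l) k (lk m k - 1 - l)) = ?f l" if "l < ?d - 1" for l
      using that assms by (simp add: X_mult_put(1) Suc_diff_Suc)
    then show ?thesis
      using assms unfolding subpair_def Let_def
      by (simp add: sum_distrib_left mult.left_commute [of "X k"] del: of_nat_diff)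
  qed
  moreover have "subpair j k (m + Poly_Mapping.single k (Suc 0)) = - (\<Sum>l<?d. Const (of_nat (?d - l)) * ?f l)"
    using assms unfolding subpair_def Let_def
    by (simp add: put_add_single lookup_add lookup_single del: of_nat_diff)
  ultimately show ?thesis
    using sum_weights_Suc [of ?d ?f] by simp
qed

lemma X_mult_subpair_after:
  assumes "j \<noteq> k" and "lk m j \<le> Suc (lk m k)"
  shows "X k * subpair k j m - subpair k j (m + Poly_Mapping.single k (Suc 0)) =
    (\<Sum>l<Suc (lk m k) - lk m j. monomial (put m j (lk m j + l) k (lk m k - l)))"
proof -
  let ?d = "Suc (lk m k) - lk m j"
  let ?f = "\<lambda>l. monomial (put m j (lk m j + l) k (lk m k - l)) :: ratfun mvpoly"
  have "X k * subpair k j m = - (\<Sum>l<?d-1. Const (of_nat (?d - 1 - l)) * ?f l)"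
  proof (cases "lk m j < lk m k")
    case True
    have "X k * monomial (put m k (lk m k - 1 - l) j (lk m j + l)) = ?f l" if "l < lk m k - lk m j" for l
      using that assms by (simp add: X_mult_put Suc_diff_Suc put_add_single(3))
    then show ?thesis
      using True unfolding subpair_def Let_def
      by (simp add: sum_distrib_left mult.left_commute [of "X k"] Suc_diff_le del: of_nat_diff)
  next
    \<comment> \<open>Here row \<open>j\<close> has as many boxes as row \<open>k\<close> or one
      more; in both cases the two sums are empty.\<close>
    case False
    then have "lk m j - lk m k - 1 = 0" "?d - 1 = 0" using assms by auto
    then show ?thesis using False unfolding subpair_def Let_def by simp
  qed
  moreover have "subpair k j (m + Poly_Mapping.single k (Suc 0)) = - (\<Sum>l<?d. Const (of_nat (?d - l)) * ?f l)"
    using assms unfolding subpair_def Let_def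
    by (auto simp add: put_add_single lookup_add lookup_single simp del: of_nat_diff)
  ultimately show ?thesis
    using sum_weights_Suc [of ?d ?f] by simp
qed

section \<open>Glissades\<close>

lemma composition_nonzero:
  assumes "\<eta> \<in> compositions n" "\<eta> \<noteq> 0"
  obtains i where "i \<in> {1..n}" "lk \<eta> i > 0"
proof -
  obtain i where "lk \<eta> i \<noteq> 0"
    using assms(2) poly_mapping_eqI [of \<eta> 0] by auto
  then have "i \<in> Poly_Mapping.keys \<eta>" "lk \<eta> i > 0"
    by (simp_all add: in_keys_iff)
  then show ?thesis using assms(1) by (intro that) (auto simp: compositions_def)
qed

lemma crit_row:
  assumes \<eta>: "\<eta> \<in> compositions n" "\<eta> \<noteq> 0"
  shows crit_row_in: "crit_row n \<eta> \<in> {1..n}"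
    and crit_row_max: "lk \<eta> (crit_row n \<eta>) = max_part n \<eta>"
    and max_part_pos: "max_part n \<eta> > 0"
    and max_part_ge: "j \<in> {1..n} \<Longrightarrow> lk \<eta> j \<le> max_part n \<eta>"
    and crit_row_first: "j \<in> {1..n} \<Longrightarrow> j < crit_row n \<eta> \<Longrightarrow> lk \<eta> j < max_part n \<eta>"
proof -
  obtain i where i: "i \<in> {1..n}" "lk \<eta> i > 0" by (rule composition_nonzero [OF \<eta>])
  have ge: "lk \<eta> j \<le> max_part n \<eta>" if "j \<in> {1..n}" for j
    unfolding max_part_def using that by (intro Max_ge) auto
  then show "j \<in> {1..n} \<Longrightarrow> lk \<eta> j \<le> max_part n \<eta>" .
  show "max_part n \<eta> > 0" using ge [OF i(1)] i(2) by simp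
  have "max_part n \<eta> \<in> lk \<eta> ` {1..n}"
    unfolding max_part_def using i by (intro Max_in) auto
  then have "{i \<in> {1..n}. lk \<eta> i = max_part n \<eta>} \<noteq> {}" by auto
  then have "crit_row n \<eta> \<in> {i \<in> {1..n}. lk \<eta> i = max_part n \<eta>}"
    unfolding crit_row_def by (intro Min_in) auto
  then show "crit_row n \<eta> \<in> {1..n}" "lk \<eta> (crit_row n \<eta>) = max_part n \<eta>" by auto
  assume j: "j \<in> {1..n}" "j < crit_row n \<eta>"
  have "lk \<eta> j \<noteq> max_part n \<eta>"
  proof
    assume "lk \<eta> j = max_part n \<eta>"
    then have "crit_row n \<eta> \<le> j"
      unfolding crit_row_def using j(1) by (intro Min_le) auto
    then show False using j(2) by simp
  qed
  then show "lk \<eta> j < max_part n \<eta>" using ge [OF j(1)] by simp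
qed

lemma eta_star_add:
  assumes "\<eta> \<in> compositions n" "\<eta> \<noteq> 0"
  shows "\<eta> = eta_star n \<eta> + Poly_Mapping.single (crit_row n \<eta>) (Suc 0)"
  unfolding eta_star_def
  by (rule poly_mapping_eqI)
    (use crit_row_max [OF assms] max_part_pos [OF assms] in
      \<open>auto simp: lookup_upd lookup_add lookup_single when_def\<close>)

lemma eta_star_comp:
  assumes "\<eta> \<in> compositions n" "\<eta> \<noteq> 0"
  shows "eta_star n \<eta> \<in> compositions n"
  unfolding eta_star_def by (intro upd_comp assms(1) crit_row_in [OF assms])

text \<open>The number of admissible \<open>l\<close>, counting \<open>l = 0\<close>. The bound is
  smaller by one above the critical row because there \<epsilon> must be positive.\<close>

definition slide_count :: "nat \<Rightarrow> expo \<Rightarrow> nat \<Rightarrow> nat" where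
  "slide_count n \<eta> j = (if j < crit_row n \<eta> then max_part n \<eta> - 1 - lk \<eta> j else max_part n \<eta> - lk \<eta> j)"

definition slide :: "nat \<Rightarrow> expo \<Rightarrow> nat \<Rightarrow> nat \<Rightarrow> expo" where
  "slide n \<eta> j l = put \<eta> j (lk \<eta> j + l) (crit_row n \<eta>) (max_part n \<eta> - 1 - l)"

text \<open>Terms avoiding the critical row cancel. As this row is the first of maximal length,
  every pair containing it satisfies the hypothesis of \<open>X_mult_subpair_before\<close> or
  \<open>X_mult_subpair_after\<close>, according to the side of row \<open>j\<close>.\<close>

lemma sublead_crit:
  assumes \<eta>: "\<eta> \<in> compositions n" "\<eta> \<noteq> 0"
  shows "X (crit_row n \<eta>) * sublead n (eta_star n \<eta>) - sublead n \<eta> =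
    Const (of_nat (max_part n \<eta> - 1)) * monomial (eta_star n \<eta>) +
    Const rvar * (\<Sum>j\<in>{1..n}-{crit_row n \<eta>}. \<Sum>l<slide_count n \<eta> j. monomial (slide n \<eta> j l))"
proof -
  define k m \<nu> where "k = crit_row n \<eta>" and "m = max_part n \<eta>" and "\<nu> = eta_star n \<eta>"
  have k: "k \<in> {1..n}" and m: "m > 0"
    using crit_row_in [OF \<eta>] max_part_pos [OF \<eta>] by (auto simp: k_def m_def)
  have \<nu>: "\<eta> = \<nu> + Poly_Mapping.single k (Suc 0)"
    unfolding \<nu>_def k_def by (rule eta_star_add [OF \<eta>])
  have \<nu>k: "lk \<nu> k = m - 1" and \<nu>j: "j \<noteq> k \<Longrightarrow> lk \<nu> j = lk \<eta> j" for j
    by (auto simp: \<nu>_def k_def m_def eta_star_def lookup_upd)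
  have slide: "put \<nu> j u k v = put \<eta> j u k v" if "j \<noteq> k" for j u v
    using put_add_single(1) [OF that, of \<nu> u v] \<nu> by simp
  define D where "D a b = X k * subpair a b \<nu> - subpair a b \<eta>" for a b
  define D' where "D' j = (if j < k then D j k else D k j)" for j
  have D': "D' j = (\<Sum>l<slide_count n \<eta> j. monomial (slide n \<eta> j l))" if j: "j \<in> {1..n} - {k}" for j
  proof (cases "j < k")
    case True
    then have "lk \<nu> j \<le> lk \<nu> k"
      using crit_row_first [OF \<eta>, of j] j \<nu>j [of j] \<nu>k by (simp add: k_def m_def)
    with True show ?thesis
      using X_mult_subpair_before [of j k \<nu>] j
      by (simp add: D'_def D_def \<nu> [symmetric] \<nu>k \<nu>j slide slide_count_def slide_def
          k_def [symmetric] m_def [symmetric])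
  next
    case False
    have "lk \<nu> j \<le> Suc (lk \<nu> k)"
      using max_part_ge [OF \<eta>, of j] j \<nu>j [of j] \<nu>k m by (simp add: m_def)
    with False show ?thesis
      using X_mult_subpair_after [of j k \<nu>] j m
      by (simp add: D'_def D_def \<nu> [symmetric] \<nu>k \<nu>j slide slide_count_def slide_def
          k_def [symmetric] m_def [symmetric])
  qed
  have D0: "D a b = 0" if "a \<noteq> k" "b \<noteq> k" for a b
    using X_mult_subpair_other [OF that, of \<nu>] by (simp add: D_def \<nu> [symmetric])
  have "(\<Sum>(a, b)\<in>pairs n. D a b) = (\<Sum>(a, b)\<in>{c \<in> pairs n. fst c = k \<or> snd c = k}. D a b)"
  proof (rule sum.mono_neutral_right)
    show "\<forall>c\<in>pairs n - {c \<in> pairs n. fst c = k \<or> snd c = k}. (case c of (a, b) \<Rightarrow> D a b) = 0"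
      by clarsimp (metis D0)
  qed auto
  also have "\<dots> = (\<Sum>j\<in>{1..n}-{k}. D' j)"
    by (rule sum.reindex_bij_witness [where i = "\<lambda>j. if j < k then (j, k) else (k, j)"
          and j = "\<lambda>(a, b). if a = k then b else a"])
      (use k in \<open>auto simp: pairs_def D'_def split: if_splits\<close>)
  also have "\<dots> = (\<Sum>j\<in>{1..n}-{k}. \<Sum>l<slide_count n \<eta> j. monomial (slide n \<eta> j l))"
    by (rule sum.cong) (simp_all add: D')
  finally have pairs: "X k * (\<Sum>(a, b)\<in>pairs n. subpair a b \<nu>) - (\<Sum>(a, b)\<in>pairs n. subpair a b \<eta>) =
     (\<Sum>j\<in>{1..n}-{k}. \<Sum>l<slide_count n \<eta> j. monomial (slide n \<eta> j l))"
    by (simp add: D_def sum_distrib_left sum_subtractf case_prod_unfold)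
  have "(\<Sum>i\<in>{1..n}-{k}. subdiag i \<eta>) = (\<Sum>i\<in>{1..n}-{k}. X k * subdiag i \<nu>)"
    by (rule sum.cong) (auto simp: X_mult_subdiag_other \<nu> [symmetric])
  moreover have "subdiag k \<eta> = X k * subdiag k \<nu> + Const (of_nat (m - 1)) * monomial \<nu>"
    using X_mult_subdiag_same [of k \<nu>] by (simp only: \<nu> [symmetric] \<nu>k)
  ultimately have diag: "(\<Sum>i\<in>{1..n}. subdiag i \<eta>) =
      X k * (\<Sum>i\<in>{1..n}. subdiag i \<nu>) + Const (of_nat (m - 1)) * monomial \<nu>"
    unfolding sum.remove [OF finite_atLeastAtMost k] by (simp only: sum_distrib_left distrib_left ac_simps)
  have "X k * sublead n \<nu> - sublead n \<eta> = Const rvar *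
      (X k * (\<Sum>(a, b)\<in>pairs n. subpair a b \<nu>) - (\<Sum>(a, b)\<in>pairs n. subpair a b \<eta>)) +
      ((\<Sum>i\<in>{1..n}. subdiag i \<eta>) - X k * (\<Sum>i\<in>{1..n}. subdiag i \<nu>))"
    unfolding sublead_def by (simp only: right_diff_distrib mult.left_commute [of "X k"]) simp
  then show ?thesis
    unfolding pairs diag by (simp add: k_def m_def \<nu>_def)
qed

text \<open>Row \<open>j\<close> is the only row that grows, so a slide determines \<open>j\<close>
  and \<open>l\<close>. Starting at \<open>l = 1\<close> excludes \<open>eta_star\<close>, which
  every \<open>j\<close> would produce for \<open>l = 0\<close>.\<close>

lemma glissades_eq:
  assumes \<eta>: "\<eta> \<in> compositions n" "\<eta> \<noteq> 0"
  shows "bij_betw (\<lambda>(j, l). slide n \<eta> j l)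
    (Sigma ({1..n} - {crit_row n \<eta>}) (\<lambda>j. {1..<slide_count n \<eta> j}))
    {\<gamma>. glissade n \<eta> \<gamma> \<and> \<gamma> \<noteq> eta_star n \<eta>}"
  unfolding bij_betw_def
proof (intro conjI equalityI subsetI)
  define k m where "k = crit_row n \<eta>" and "m = max_part n \<eta>"
  have k: "k \<in> {1..n}" using crit_row_in [OF \<eta>] by (simp add: k_def)
  note kf = k_def [symmetric] m_def [symmetric]
  let ?S = "Sigma ({1..n} - {crit_row n \<eta>}) (\<lambda>j. {1..<slide_count n \<eta> j})"
  define Q where "Q j l \<gamma> \<longleftrightarrow> l > 0 \<and>
         lk \<gamma> j = lk \<eta> j + l \<and> int (lk \<gamma> k) = int m - 1 - int l \<and>
         (\<forall>i \<in> {1..n} - {j, k}. lk \<gamma> i = lk \<eta> i) \<and>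
         (let eps = int m - 1 - int (lk \<eta> j) - int l in
           (j < k \<longrightarrow> eps > 0) \<and> (j > k \<longrightarrow> eps \<ge> 0))" for j l and \<gamma> :: expo
  have gl: "glissade n \<eta> \<gamma> \<longleftrightarrow> \<gamma> \<in> compositions n \<and>
      (\<gamma> = eta_star n \<eta> \<or> (\<exists>j \<in> {1..n} - {k}. \<exists>l. Q j l \<gamma>))" for \<gamma>
    unfolding glissade_def Q_def Let_def kf using \<eta> by simp
  have lks: "lk (slide n \<eta> j l) i = (if i = k then m - 1 - l else if i = j then lk \<eta> j + l else lk \<eta> i)" for i j l
    by (simp add: slide_def lookup_put kf)
  show "inj_on (\<lambda>(j, l). slide n \<eta> j l) ?S"
  proof (rule inj_onI)
    fix c c' assume c: "c \<in> ?S" "c' \<in> ?S"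
      "(case c of (j, l) \<Rightarrow> slide n \<eta> j l) = (case c' of (j, l) \<Rightarrow> slide n \<eta> j l)"
    obtain j l j' l' where jl: "c = (j, l)" "c' = (j', l')" by force
    have "lk (slide n \<eta> j l) j = lk (slide n \<eta> j' l') j" using c(3) jl by simp
    then show "c = c'"
      using c(1,2) unfolding jl lks by (auto simp: kf split: if_splits)
  qed
  show "\<gamma> \<in> {\<gamma>. glissade n \<eta> \<gamma> \<and> \<gamma> \<noteq> eta_star n \<eta>}" if "\<gamma> \<in> (\<lambda>(j, l). slide n \<eta> j l) ` ?S" for \<gamma>
  proof -
    from that obtain c where c: "c \<in> ?S" "\<gamma> = (case c of (j, l) \<Rightarrow> slide n \<eta> j l)" by blast
    obtain j l where "c = (j, l)" by force
    with c have jl: "j \<in> {1..n}" "j \<noteq> k" "1 \<le> l" "l < slide_count n \<eta> j" "\<gamma> = slide n \<eta> j l"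
      by (auto simp: kf)
    have "lk \<gamma> j \<noteq> lk (eta_star n \<eta>) j"
      using jl unfolding jl(5) lks by (simp add: eta_star_def lookup_upd kf)
    then have "\<gamma> \<noteq> eta_star n \<eta>" by auto
    moreover have "\<gamma> \<in> compositions n"
      unfolding jl(5) slide_def kf by (rule put_comp [OF \<eta>(1) jl(1) k])
    moreover have "Q j l \<gamma>"
      unfolding Q_def
    proof (intro conjI ballI)
      have g: "lk \<gamma> i = (if i = k then m - 1 - l else if i = j then lk \<eta> j + l else lk \<eta> i)" for i
        by (simp only: jl(5) lks)
      have sc: "j < k \<Longrightarrow> l < m - 1 - lk \<eta> j" "\<not> j < k \<Longrightarrow> l < m - lk \<eta> j"
        using jl(4) by (simp_all add: slide_count_def kf)
      show "l > 0" using jl(3) by simp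
      show "lk \<gamma> j = lk \<eta> j + l" using jl(2) by (simp add: g)
      show "int (lk \<gamma> k) = int m - 1 - int l" using sc by (cases "j < k") (auto simp: g)
      show "lk \<gamma> i = lk \<eta> i" if "i \<in> {1..n} - {j, k}" for i using that by (simp add: g)
      show "let eps = int m - 1 - int (lk \<eta> j) - int l in (j < k \<longrightarrow> eps > 0) \<and> (j > k \<longrightarrow> eps \<ge> 0)"
        using sc by (cases "j < k") (auto simp: Let_def)
    qed
    ultimately show ?thesis
      using jl(1,2) gl [of \<gamma>] by blast
  qed
  show "\<gamma> \<in> (\<lambda>(j, l). slide n \<eta> j l) ` ?S" if "\<gamma> \<in> {\<gamma>. glissade n \<eta> \<gamma> \<and> \<gamma> \<noteq> eta_star n \<eta>}" for \<gamma>
  proof -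
    from that obtain j l where "\<gamma> \<in> compositions n" "j \<in> {1..n} - {k}" "Q j l \<gamma>"
      using gl [of \<gamma>] by blast
    then have jl: "\<gamma> \<in> compositions n" "j \<in> {1..n} - {k}" "l > 0"
      "lk \<gamma> j = lk \<eta> j + l" "int (lk \<gamma> k) = int m - 1 - int l"
      "\<forall>i \<in> {1..n} - {j, k}. lk \<gamma> i = lk \<eta> i"
      "j < k \<Longrightarrow> int m - 1 - int (lk \<eta> j) - int l > 0" "j > k \<Longrightarrow> int m - 1 - int (lk \<eta> j) - int l \<ge> 0"
      unfolding Q_def Let_def by blast+
    have "\<gamma> = slide n \<eta> j l"
    proof (rule poly_mapping_eqI)
      fix i
      show "lk \<gamma> i = lk (slide n \<eta> j l) i"
      proof (cases "i \<in> {1..n}")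
        case True
        then consider "i = k" | "i = j" "i \<noteq> k" | "i \<in> {1..n} - {j, k}" by blast
        then show ?thesis by cases (use jl(2,4-6) in \<open>auto simp: lks\<close>)
      next
        case False
        then have "lk \<gamma> i = 0" "lk \<eta> i = 0"
          using jl(1) \<eta>(1) by (simp_all add: compositions_iff)
        moreover have "i \<noteq> j" "i \<noteq> k"
          using jl(2) k False by auto
        ultimately show ?thesis by (simp add: lks)
      qed
    qed
    moreover have "(j, l) \<in> ?S"
      using jl(2,3,7,8) by (auto simp: slide_count_def kf)
    ultimately show ?thesis by force
  qed
qed

section \<open>Counting slides and summing over glissades\<close>

lemma slide_0:
  assumes "\<eta> \<in> compositions n" "\<eta> \<noteq> 0" "j \<noteq> crit_row n \<eta>"
  shows "slide n \<eta> j 0 = eta_star n \<eta>"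
  by (rule poly_mapping_eqI) (use assms in \<open>auto simp: slide_def eta_star_def lookup_put lookup_upd\<close>)

text \<open>A row other than the critical one has slide count 0 exactly if it lies below and has
  maximal length, or lies above and is one box shorter. These are the rows counted by the critical
  leg.\<close>

lemma card_slides:
  assumes \<eta>: "\<eta> \<in> compositions n" "\<eta> \<noteq> 0"
  shows "card {j \<in> {1..n} - {crit_row n \<eta>}. 0 < slide_count n \<eta> j} + crit_leg n \<eta> = n - 1"
proof -
  define k m where "k = crit_row n \<eta>" and "m = max_part n \<eta>"
  have k: "k \<in> {1..n}" using crit_row_in [OF \<eta>] by (simp add: k_def)
  let ?A = "{j \<in> {1..n} - {k}. 0 < slide_count n \<eta> j}"
  let ?B = "{i \<in> {1..n}. i > k \<and> lk \<eta> i = m}" and ?C = "{i \<in> {1..n}. i < k \<and> lk \<eta> i = m - 1}"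
  have un: "{1..n} - {k} = ?A \<union> (?B \<union> ?C)"
  proof (intro equalityI subsetI)
    fix j assume j: "j \<in> {1..n} - {k}"
    then show "j \<in> ?A \<union> (?B \<union> ?C)"
      using crit_row_first [OF \<eta>, of j] max_part_ge [OF \<eta>, of j]
      by (auto simp: slide_count_def k_def m_def)
  qed (use k in auto)
  have "card ({1..n} - {k}) = card (?A \<union> (?B \<union> ?C))"
    by (rule arg_cong [OF un])
  also have "card (?A \<union> (?B \<union> ?C)) = card ?A + card (?B \<union> ?C)"
    by (rule card_Un_disjoint) (auto simp: slide_count_def k_def m_def)
  also have "card (?B \<union> ?C) = card ?B + card ?C"
    by (rule card_Un_disjoint) auto
  finally show ?thesis
    using k by (simp add: crit_leg_def k_def [symmetric] m_def [symmetric])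
qed

lemma finite_glissades: "finite {\<gamma>. glissade n \<eta> \<gamma>}"
proof (cases "\<eta> \<in> compositions n \<and> \<eta> \<noteq> 0")
  case True
  then have "finite {\<gamma>. glissade n \<eta> \<gamma> \<and> \<gamma> \<noteq> eta_star n \<eta>}"
    using bij_betw_finite [OF glissades_eq] by force
  then have "finite (insert (eta_star n \<eta>) {\<gamma>. glissade n \<eta> \<gamma> \<and> \<gamma> \<noteq> eta_star n \<eta>})" by simp
  then show ?thesis by (rule finite_subset [rotated]) auto
qed (auto simp: glissade_def)

lemma glissade_comp:
  assumes "glissade n \<eta> \<gamma>"
  shows "\<eta> \<in> compositions n" "\<eta> \<noteq> 0" "\<gamma> \<in> compositions n"
  using assms by (auto simp: glissade_def)

lemma csize_glissade:
  assumes "glissade n \<eta> \<gamma>"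
  shows "csize \<eta> = Suc (csize \<gamma>)"
proof (cases "\<gamma> = eta_star n \<eta>")
  case True
  have "csize \<eta> = csize (eta_star n \<eta> + Poly_Mapping.single (crit_row n \<eta>) (Suc 0))"
    by (rule arg_cong [OF eta_star_add [OF glissade_comp(1,2) [OF assms]]])
  then show ?thesis using True by (simp add: csize_add)
next
  case False
  note \<eta> = glissade_comp(1,2) [OF assms]
  from False assms have "\<gamma> \<in> (\<lambda>(j, l). slide n \<eta> j l) `
      (Sigma ({1..n} - {crit_row n \<eta>}) (\<lambda>j. {1..<slide_count n \<eta> j}))"
    using glissades_eq [OF \<eta>] by (auto simp: bij_betw_def)
  then obtain c where c: "c \<in> Sigma ({1..n} - {crit_row n \<eta>}) (\<lambda>j. {1..<slide_count n \<eta> j})"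
    "\<gamma> = (case c of (j, l) \<Rightarrow> slide n \<eta> j l)" by blast
  obtain j l where "c = (j, l)" by force
  with c have "j \<noteq> crit_row n \<eta>" "l < slide_count n \<eta> j" "\<gamma> = slide n \<eta> j l" by auto
  then show ?thesis
    using csize_put [of j "crit_row n \<eta>" \<eta> "lk \<eta> j + l" "max_part n \<eta> - 1 - l"]
      crit_row_max [OF \<eta>] max_part_pos [OF \<eta>]
    by (auto simp: slide_def slide_count_def split: if_splits)
qed

text \<open>Each row with positive slide count produces \<open>eta_star\<close> once, for
  \<open>l = 0\<close>. By \<open>card_slides\<close> their number is the coefficient of
  \<open>r\<close> in the weight of \<open>\<eta>\<close>.\<close>

lemma sum_slides:
  fixes F :: "expo \<Rightarrow> ratfun mvpoly"
  assumes n: "n \<ge> 1" and \<eta>: "\<eta> \<in> compositions n" "\<eta> \<noteq> 0"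
  shows "(\<Sum>j\<in>{1..n}-{crit_row n \<eta>}. \<Sum>l<slide_count n \<eta> j. F (slide n \<eta> j l)) =
    Const (of_nat n - 1 - of_nat (crit_leg n \<eta>)) * F (eta_star n \<eta>) +
    (\<Sum>\<gamma>\<in>{\<gamma>. glissade n \<eta> \<gamma> \<and> \<gamma> \<noteq> eta_star n \<eta>}. F \<gamma>)"
proof -
  let ?J = "{1..n} - {crit_row n \<eta>}" and ?L = "slide_count n \<eta>"
  have "(\<Sum>l<?L j. F (slide n \<eta> j l)) =
     (if 0 < ?L j then F (eta_star n \<eta>) else 0) + (\<Sum>l\<in>{1..<?L j}. F (slide n \<eta> j l))" if "j \<in> ?J" for j
  proof (cases "?L j")
    case (Suc d)
    then have "{..<?L j} = insert 0 {1..<?L j}" by auto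
    then show ?thesis using that Suc by (simp add: slide_0 [OF \<eta>])
  qed simp
  then have "(\<Sum>j\<in>?J. \<Sum>l<?L j. F (slide n \<eta> j l)) =
      (\<Sum>j\<in>?J. if 0 < ?L j then F (eta_star n \<eta>) else 0) + (\<Sum>j\<in>?J. \<Sum>l\<in>{1..<?L j}. F (slide n \<eta> j l))"
    by (simp add: sum.distrib)
  also have "(\<Sum>j\<in>?J. \<Sum>l\<in>{1..<?L j}. F (slide n \<eta> j l)) =
      (\<Sum>c\<in>Sigma ?J (\<lambda>j. {1..<?L j}). F (case c of (j, l) \<Rightarrow> slide n \<eta> j l))"
    by (subst sum.Sigma) (auto simp: case_prod_unfold)
  also have "\<dots> = (\<Sum>\<gamma>\<in>{\<gamma>. glissade n \<eta> \<gamma> \<and> \<gamma> \<noteq> eta_star n \<eta>}. F \<gamma>)"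
    by (rule sum.reindex_bij_betw [OF glissades_eq [OF \<eta>]])
  also have "(\<Sum>j\<in>?J. if 0 < ?L j then F (eta_star n \<eta>) else 0) =
      of_nat (card {j \<in> ?J. 0 < ?L j}) * F (eta_star n \<eta>)"
    by (subst sum.inter_filter [symmetric]) auto
  also have "of_nat (card {j \<in> ?J. 0 < ?L j}) = Const (of_nat n - 1 - of_nat (crit_leg n \<eta>) :: ratfun)"
  proof -
    have "n = Suc (card {j \<in> ?J. 0 < ?L j} + crit_leg n \<eta>)"
      using card_slides [OF \<eta>] n by simp
    then have "(of_nat n :: ratfun) = of_nat (Suc (card {j \<in> ?J. 0 < ?L j} + crit_leg n \<eta>))" by (rule arg_cong)
    then have "of_nat n - 1 - of_nat (crit_leg n \<eta>) = (of_nat (card {j \<in> ?J. 0 < ?L j}) :: ratfun)" by simp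
    moreover have "Const (of_nat c :: ratfun) = of_nat c" for c
      by (induction c) (simp_all add: Const_distrib)
    ultimately show ?thesis by simp
  qed
  finally show ?thesis .
qed

section \<open>Bar games and the operator Xi\<close>

lemma lin_lin: "lin G (lin F p) = lin (\<lambda>m. lin G (F m)) p"
  unfolding lin_def [of F] lin_sum lin_Const_mult by (simp add: lin_def [of "\<lambda>m. lin G (F m)"])

lemma lin_uminus_fun: "lin (\<lambda>m. - F m) p = - lin F p"
  by (simp add: lin_def sum_negf)

text \<open>The substitution of \<open>-x\<close> for \<open>x\<close>, in a form that is visibly
  linear; \<open>subst_uminus\<close> identifies it with \<open>subst_poly\<close>.\<close>

definition reflect :: "ratfun mvpoly \<Rightarrow> ratfun mvpoly" where
  "reflect = lin (\<lambda>m. Const ((- 1) ^ csize m) * monomial m)"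

lemma reflect_X_mult: "reflect (X k * p) = - (X k * reflect p)"
  unfolding reflect_def X_mult_lin lin_lin
  by (simp add: lin_Const_mult csize_add Const_distrib lin_uminus_fun)

lemma Const_power: "Const (c ^ k) = (Const c :: 'a::comm_ring_1 mvpoly) ^ k"
  by (induction k) (simp_all add: Const_distrib)

lemma monomial_mult: "monomial a * monomial b = (monomial (a + b) :: 'a::comm_ring_1 mvpoly)"
  by (simp add: monomial_def mult_single)

lemma X_power: "X i ^ k = (monomial (Poly_Mapping.single i k) :: 'a::comm_ring_1 mvpoly)"
  by (induction k)
    (simp_all add: X_mult_monomial monomial_def [of 0] single_add [symmetric])

lemma sum_single_lookup: "(\<Sum>i\<in>Poly_Mapping.keys m. Poly_Mapping.single i (lk m i)) = m"
proof (rule poly_mapping_eqI)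
  fix j
  have "lk (\<Sum>i\<in>Poly_Mapping.keys m. Poly_Mapping.single i (lk m i)) j =
      (\<Sum>i\<in>Poly_Mapping.keys m. if j = i then lk m i else 0)"
    unfolding lookup_sum by (rule sum.cong) (auto simp: lookup_single when_def)
  then show "lk (\<Sum>i\<in>Poly_Mapping.keys m. Poly_Mapping.single i (lk m i)) j = lk m j"
    by (simp add: in_keys_iff)
qed

lemma subst_uminus: "subst_poly p (\<lambda>i. - X i) = reflect p"
proof -
  have "(\<Prod>i\<in>A. (- X i :: ratfun mvpoly) ^ f i) =
     Const ((- 1) ^ sum f A) * monomial (\<Sum>i\<in>A. Poly_Mapping.single i (f i))" if "finite A" for A f
    using that
  proof (induction A rule: finite_induct)
    case empty
    then show ?case by (simp add: Const_distrib monomial_def)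
  next
    case (insert i A)
    have "(- X i :: ratfun mvpoly) ^ f i = Const ((- 1) ^ f i) * monomial (Poly_Mapping.single i (f i))"
      by (subst power_minus) (simp add: X_power Const_power Const_distrib)
    then show ?case
      using insert by (simp add: power_add Const_distrib monomial_mult [symmetric] ac_simps)
  qed
  then have "(\<Prod>i\<in>Poly_Mapping.keys m. (- X i :: ratfun mvpoly) ^ lk m i) =
      Const ((- 1) ^ csize m) * monomial m" for m
    by (simp add: csize_def sum_single_lookup)
  then show ?thesis by (simp add: subst_poly_def reflect_def lin_def)
qed

text \<open>The Pieri formula for \<open>eta_star\<close> and the critical row, solved for
  \<open>basic n \<eta>\<close>. The coefficient of \<open>basic n (eta_star n \<eta>)\<close>
  collects the diagonal term and the slides with \<open>l = 0\<close>.\<close>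

lemma basic_rec:
  assumes n: "n \<ge> 1" and \<eta>: "\<eta> \<in> compositions n" "\<eta> \<noteq> 0"
  shows "basic n \<eta> = X (crit_row n \<eta>) * basic n (eta_star n \<eta>) -
    Const (of_nat (max_part n \<eta>) - 1 + rvar * (of_nat n - 1 - of_nat (crit_leg n \<eta>))) * basic n (eta_star n \<eta>) -
    Const rvar * (\<Sum>\<gamma>\<in>{\<gamma>. glissade n \<eta> \<gamma> \<and> \<gamma> \<noteq> eta_star n \<eta>}. basic n \<gamma>)"
proof -
  have m: "(of_nat (max_part n \<eta> - 1) :: ratfun) = of_nat (max_part n \<eta>) - 1"
    using max_part_pos [OF \<eta>] by (subst of_nat_diff) auto
  have "X (crit_row n \<eta>) * basic n (eta_star n \<eta>) - basic n \<eta> =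
      Const (of_nat (max_part n \<eta> - 1)) * basic n (eta_star n \<eta>) +
      Const rvar * (\<Sum>j\<in>{1..n}-{crit_row n \<eta>}. \<Sum>l<slide_count n \<eta> j. basic n (slide n \<eta> j l))"
    unfolding basic_pieri [OF n eta_star_comp [OF \<eta>] crit_row_in [OF \<eta>] eta_star_add [OF \<eta>]]
      sublead_crit [OF \<eta>]
    by (simp add: lin_add lin_Const_mult lin_sum)
  then show ?thesis
    unfolding sum_slides [OF n \<eta>] m by (simp add: Const_distrib algebra_simps)
qed

text \<open>The polynomial \<open>(-1)\<^sup>d P\<^sub>\<eta>(-x)\<close>, where
  \<open>d = csize \<eta>\<close>; by \<open>Xi_eq\<close> it is the image of
  \<open>x\<^sup>\<eta>\<close> under \<open>Xi\<close>.\<close>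

definition bar :: "nat \<Rightarrow> expo \<Rightarrow> ratfun mvpoly" where
  "bar n \<eta> = Const ((- 1) ^ csize \<eta>) * reflect (basic n \<eta>)"

lemma bar_0: "n \<ge> 1 \<Longrightarrow> bar n 0 = 1"
proof -
  assume n: "n \<ge> 1"
  have "sublead n 0 = 0"
    by (simp add: sublead_def subpair_def subdiag_def case_prod_unfold Const_distrib binomial_eq_0)
  moreover have "0 \<in> compositions n" by (simp add: compositions_iff)
  ultimately have "basic n 0 - monomial 0 = 0"
    using good_basic [OF n, of 0] by (simp add: good_def supp_in_def)
  then have b: "basic n 0 = monomial 0" by simp
  show ?thesis
    unfolding bar_def b reflect_def lin_monomial by (simp add: Const_distrib monomial_def)
qed

lemma eta_star_glissade:
  "\<eta> \<in> compositions n \<Longrightarrow> \<eta> \<noteq> 0 \<Longrightarrow> glissade n \<eta> (eta_star n \<eta>)"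
  by (simp add: glissade_def eta_star_comp)

text \<open>Reflection changes the sign of \<open>x\<^sub>k\<close>, and removing a box changes the
  sign of the prefactor. Together they give every term of \<open>basic_rec\<close> the sign plus,
  and the coefficients become the weights of the glissades.\<close>

lemma bar_rec:
  assumes n: "n \<ge> 1" and \<eta>: "\<eta> \<in> compositions n" "\<eta> \<noteq> 0"
  shows "bar n \<eta> = (\<Sum>\<gamma>\<in>{\<gamma>. glissade n \<eta> \<gamma>}. step_weight n \<eta> \<gamma> * bar n \<gamma>)"
proof -
  let ?s = "eta_star n \<eta>" and ?k = "crit_row n \<eta>"
  let ?c = "of_nat (max_part n \<eta>) - 1 + rvar * (of_nat n - 1 - of_nat (crit_leg n \<eta>))"
  let ?G = "{\<gamma>. glissade n \<eta> \<gamma> \<and> \<gamma> \<noteq> ?s}"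
  have cs: "csize \<eta> = Suc (csize ?s)" by (rule csize_glissade [OF eta_star_glissade [OF \<eta>]])
  have cg: "csize \<gamma> = csize ?s" if "\<gamma> \<in> ?G" for \<gamma>
    using csize_glissade [of n \<eta> \<gamma>] that cs by simp
  have r: "reflect (basic n \<eta>) = - (X ?k * reflect (basic n ?s)) - Const ?c * reflect (basic n ?s) -
      Const rvar * (\<Sum>\<gamma>\<in>?G. reflect (basic n \<gamma>))"
    by (subst basic_rec [OF n \<eta>], unfold reflect_def lin_diff lin_Const_mult lin_sum)
      (simp only: reflect_def [symmetric] reflect_X_mult)
  have "bar n \<eta> = Const (- ((- 1) ^ csize ?s)) * (- (X ?k * reflect (basic n ?s)) -
      Const ?c * reflect (basic n ?s) - Const rvar * (\<Sum>\<gamma>\<in>?G. reflect (basic n \<gamma>)))"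
    unfolding bar_def [of n \<eta>] cs r by simp
  also have "\<dots> = comp_weight n \<eta> * bar n ?s +
      Const rvar * (\<Sum>\<gamma>\<in>?G. Const ((- 1) ^ csize ?s) * reflect (basic n \<gamma>))"
  proof -
    have "- A * (- (x * R) - C * R - r * S) = (x + C) * (A * R) + r * (A * S)"
      for A C R S r x :: "ratfun mvpoly" by (simp add: algebra_simps)
    then show ?thesis
      unfolding bar_def [of n ?s] comp_weight_def Const_distrib(4) sum_distrib_left [symmetric] by blast
  qed
  also have "(\<Sum>\<gamma>\<in>?G. Const ((- 1) ^ csize ?s) * reflect (basic n \<gamma>)) = (\<Sum>\<gamma>\<in>?G. bar n \<gamma>)"
    by (rule sum.cong) (simp_all add: bar_def cg)
  also have "Const rvar * (\<Sum>\<gamma>\<in>?G. bar n \<gamma>) = (\<Sum>\<gamma>\<in>?G. step_weight n \<eta> \<gamma> * bar n \<gamma>)"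
    unfolding sum_distrib_left by (rule sum.cong) (simp_all add: step_weight_def)
  also have "comp_weight n \<eta> * bar n ?s + (\<Sum>\<gamma>\<in>?G. step_weight n \<eta> \<gamma> * bar n \<gamma>) =
      (\<Sum>\<gamma>\<in>insert ?s ?G. step_weight n \<eta> \<gamma> * bar n \<gamma>)"
    using finite_subset [OF _ finite_glissades [of n \<eta>], of ?G] by (subst sum.insert) (auto simp: step_weight_def)
  also have "insert ?s ?G = {\<gamma>. glissade n \<eta> \<gamma>}"
    using eta_star_glissade [OF \<eta>] by auto
  finally show ?thesis .
qed

section \<open>Sums over bar games\<close>

lemma bar_games_0: "bar_games n 0 = {[0]}"
proof (intro equalityI subsetI)
  fix G assume "G \<in> bar_games n 0"
  then have "length G = Suc 0" "G ! 0 = 0" by (simp_all add: bar_games_def)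
  then show "G \<in> {[0]}" by (cases G) auto
qed (simp add: bar_games_def)

text \<open>Each glissade removes exactly one box, so the rest of the list has the length prescribed
  for a game on \<open>\<gamma>\<close>.\<close>

lemma bar_games_Cons:
  assumes "csize \<eta> = Suc d"
  shows "G \<in> bar_games n \<eta> \<longleftrightarrow> (\<exists>\<gamma> G'. G = \<eta> # G' \<and> glissade n \<eta> \<gamma> \<and> G' \<in> bar_games n \<gamma>)"
proof
  assume G: "G \<in> bar_games n \<eta>"
  then have G1: "length G = Suc (Suc d)" "G ! 0 = \<eta>" "G ! Suc d = 0"
    "\<And>t. t < Suc d \<Longrightarrow> glissade n (G ! t) (G ! Suc t)"
    using assms by (simp_all add: bar_games_def)
  then obtain G' where G': "G = \<eta> # G'" by (cases G) auto
  have gl: "glissade n \<eta> (G' ! 0)" using G1(4) [of 0] G' by simp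
  have "csize (G' ! 0) = d" using csize_glissade [OF gl] assms by simp
  moreover have "glissade n (G' ! t) (G' ! Suc t)" if "t < d" for t
    using G1(4) [of "Suc t"] that G' by simp
  ultimately have "G' \<in> bar_games n (G' ! 0)"
    using G1(1,3) G' by (simp add: bar_games_def)
  then show "\<exists>\<gamma> G'. G = \<eta> # G' \<and> glissade n \<eta> \<gamma> \<and> G' \<in> bar_games n \<gamma>"
    using G' gl by blast
next
  assume "\<exists>\<gamma> G'. G = \<eta> # G' \<and> glissade n \<eta> \<gamma> \<and> G' \<in> bar_games n \<gamma>"
  then obtain \<gamma> G' where G: "G = \<eta> # G'" "glissade n \<eta> \<gamma>" "G' \<in> bar_games n \<gamma>" by blast
  then have "csize \<gamma> = d" using csize_glissade [OF G(2)] assms by simp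
  with G(3) have G': "length G' = Suc d" "G' ! 0 = \<gamma>" "G' ! d = 0"
    "\<And>t. t < d \<Longrightarrow> glissade n (G' ! t) (G' ! Suc t)"
    by (simp_all add: bar_games_def)
  have "glissade n (G ! t) (G ! Suc t)" if "t < Suc d" for t
    using that G'(2,4) G(1,2) by (cases t) auto
  then show "G \<in> bar_games n \<eta>"
    using G' G(1) assms by (simp add: bar_games_def)
qed

lemma bar_games_hd: "G \<in> bar_games n \<gamma> \<Longrightarrow> G ! 0 = \<gamma>"
  by (simp add: bar_games_def)

lemma game_weight_Cons:
  "G \<noteq> [] \<Longrightarrow> game_weight n (\<eta> # G) = step_weight n \<eta> (G ! 0) * game_weight n G"
proof -
  assume "G \<noteq> []"
  then obtain d where d: "length G = Suc d" by (cases G) auto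
  show ?thesis
    unfolding game_weight_def by (simp add: d prod.lessThan_Suc_shift del: prod.lessThan_Suc)
qed

text \<open>Splitting off the first move gives the recursion of \<open>bar_rec\<close>. Finiteness
  is carried along because a sum over an infinite set is 0 by convention.\<close>

lemma bar_games_sum:
  assumes n: "n \<ge> 1"
  shows "\<eta> \<in> compositions n \<Longrightarrow> finite (bar_games n \<eta>) \<and>
    (\<Sum>G\<in>bar_games n \<eta>. game_weight n G) = bar n \<eta>"
proof (induction "csize \<eta>" arbitrary: \<eta>)
  case 0
  then have "\<eta> = 0" by simp
  then show ?case using n by (simp add: bar_games_0 bar_0 game_weight_def)
next
  case (Suc d)
  then have \<eta>: "\<eta> \<in> compositions n" "\<eta> \<noteq> 0" by auto
  have IH: "finite (bar_games n \<gamma>)" "(\<Sum>G\<in>bar_games n \<gamma>. game_weight n G) = bar n \<gamma>" if "glissade n \<eta> \<gamma>" for \<gamma>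
    using Suc.hyps(1) [of \<gamma>] csize_glissade [OF that] Suc.hyps(2) glissade_comp(3) [OF that] by auto
  let ?I = "{\<gamma>. glissade n \<eta> \<gamma>}" and ?B = "\<lambda>\<gamma>. (#) \<eta> ` bar_games n \<gamma>"
  have eq: "bar_games n \<eta> = (\<Union>\<gamma>\<in>?I. ?B \<gamma>)"
    by (intro set_eqI)
      (simp only: bar_games_Cons [OF Suc.hyps(2) [symmetric]] UN_iff image_iff mem_Collect_eq, blast)
  have fin: "finite (?B \<gamma>)" if "\<gamma> \<in> ?I" for \<gamma> using IH(1) that by simp
  \<comment> \<open>The union is disjoint because a game on \<open>\<gamma>\<close> has
    \<open>\<gamma>\<close> as its first position.\<close>
  have "(\<Sum>G\<in>bar_games n \<eta>. game_weight n G) = (\<Sum>\<gamma>\<in>?I. \<Sum>G\<in>?B \<gamma>. game_weight n G)"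
    unfolding eq
    by (rule sum.UNION_disjoint) (use finite_glissades fin in \<open>auto dest: bar_games_hd\<close>)
  also have "\<dots> = (\<Sum>\<gamma>\<in>?I. step_weight n \<eta> \<gamma> * bar n \<gamma>)"
  proof (rule sum.cong)
    fix \<gamma> assume \<gamma>: "\<gamma> \<in> ?I"
    have "game_weight n (\<eta> # G) = step_weight n \<eta> \<gamma> * game_weight n G" if "G \<in> bar_games n \<gamma>" for G
    proof -
      have "G \<noteq> []" using that by (auto simp: bar_games_def)
      then show ?thesis using game_weight_Cons [of G n \<eta>] bar_games_hd [OF that] by simp
    qed
    then have "(\<Sum>G\<in>?B \<gamma>. game_weight n G) = (\<Sum>G\<in>bar_games n \<gamma>. step_weight n \<eta> \<gamma> * game_weight n G)"
      by (subst sum.reindex) (auto intro: sum.cong)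
    then show "(\<Sum>G\<in>?B \<gamma>. game_weight n G) = step_weight n \<eta> \<gamma> * bar n \<gamma>"
      using IH(2) \<gamma> by (simp add: sum_distrib_left [symmetric])
  qed simp
  finally have "(\<Sum>G\<in>bar_games n \<eta>. game_weight n G) = bar n \<eta>"
    using bar_rec [OF n \<eta>] by simp
  moreover have "finite (bar_games n \<eta>)"
    unfolding eq using finite_glissades fin by blast
  ultimately show ?case by blast
qed

section \<open>The interpolation polynomials and their top components\<close>

lemma pdegree_eq:
  assumes "supp_in {\<mu>. csize \<mu> \<le> d} p" "lk p \<eta> \<noteq> 0" "csize \<eta> = d"
  shows "pdegree p = d"
  unfolding pdegree_def
proof (rule Max_eqI)
  show "d \<in> insert 0 (csize ` Poly_Mapping.keys p)"
    using assms by (auto simp: in_keys_iff)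
qed (use assms in \<open>auto simp: supp_in_def\<close>)

lemma pdegree_ge: "lk p \<mu> \<noteq> 0 \<Longrightarrow> csize \<mu> \<le> pdegree p"
  unfolding pdegree_def by (rule Max_ge) (auto simp: in_keys_iff)

text \<open>Since the matrix of values is invertible, some combination of the
  \<open>basic n \<nu>\<close> takes the value 1 at \<open>\<eta>\<close> and 0 elsewhere on the
  level. Dividing it by its coefficient at \<open>\<eta>\<close>, which is nonzero already at
  \<open>r = 0\<close>, gives \<open>interp_E\<close>.\<close>

lemma interp_E_expand:
  assumes n: "n \<ge> 1" and \<eta>: "\<eta> \<in> level n d"
  shows "interp_E n \<eta> = (\<Sum>\<nu>\<in>level n d. Const (lk (interp_E n \<eta>) \<nu>) * basic n \<nu>)"
    and "lk (interp_E n \<eta>) \<eta> = 1"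
    and "\<gamma> \<in> level n d \<Longrightarrow> \<gamma> \<noteq> \<eta> \<Longrightarrow> eval_poly (interp_E n \<eta>) (spectral n \<gamma>) = 0"
    and "eval_poly (interp_E n \<eta>) (spectral n \<eta>) \<noteq> 0"
proof -
  have \<eta>c: "\<eta> \<in> compositions n" "csize \<eta> = d" using \<eta> by (auto simp: level_def)
  obtain c where c: "\<And>\<gamma>. \<gamma> \<in> level n d \<Longrightarrow> reg (c \<gamma>) ((if \<gamma> = \<eta> then 1 else 0) / ffall n \<gamma> \<gamma>)"
    "\<And>\<gamma>. \<gamma> \<in> level n d \<Longrightarrow>
      (\<Sum>\<nu>\<in>level n d. eval_poly (basic n \<nu>) (spectral n \<gamma>) * c \<nu>) = (if \<gamma> = \<eta> then 1 else 0)"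
  proof (rule reg_solve [of "level n d" "\<lambda>\<gamma> \<nu>. eval_poly (basic n \<nu>) (spectral n \<gamma>)" "\<lambda>\<gamma>. ffall n \<gamma> \<gamma>"
        "\<lambda>\<gamma>. if \<gamma> = \<eta> then 1 else 0" "\<lambda>\<gamma>. if \<gamma> = \<eta> then 1 else 0"])
  qed (use reg_basic [OF n] ffall_self in auto)
  have c\<eta>: "c \<eta> \<noteq> 0" using reg_nonzero [OF c(1) [OF \<eta>]] by (simp add: ffall_self)
  define \<kappa> where "\<kappa> = 1 / c \<eta>"
  define e where "e \<nu> = c \<nu> / c \<eta>" for \<nu>
  define p where "p = (\<Sum>\<nu>\<in>level n d. Const (e \<nu>) * basic n \<nu>)"
  have e: "e \<eta> = 1" and \<kappa>: "\<kappa> \<noteq> 0" using c\<eta> by (simp_all add: e_def \<kappa>_def)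
  have ev: "eval_poly p (spectral n \<gamma>) = (if \<gamma> = \<eta> then \<kappa> else 0)" if "\<gamma> \<in> level n d" for \<gamma>
  proof -
    have "eval_poly p (spectral n \<gamma>) = (\<Sum>\<nu>\<in>level n d. eval_poly (basic n \<nu>) (spectral n \<gamma>) * c \<nu>) / c \<eta>"
      by (simp add: p_def eval_sum eval_Const_mult e_def sum_divide_distrib) (simp add: mult.commute)
    then show ?thesis using c(2) [OF that] by (simp add: \<kappa>_def)
  qed
  have lkp: "lk p \<eta> = 1" using lookup_combination [OF n \<eta>] e by (simp add: p_def)
  have sp: "supp_in {\<mu> \<in> compositions n. csize \<mu> \<le> d} p" unfolding p_def by (rule supp_combination [OF n])
  have van: "eval_poly p (spectral n \<gamma>) = 0"
    if "\<gamma> \<in> compositions n" "\<gamma> \<noteq> \<eta>" "csize \<gamma> \<le> csize \<eta>" for \<gamma>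
  proof (cases "csize \<gamma> = d")
    case True
    then show ?thesis using ev [of \<gamma>] that by (simp add: level_def)
  next
    case False
    then show ?thesis unfolding p_def using that \<eta>c by (intro eval_combination_0 n) auto
  qed
  have E: "interp_E n \<eta> = p"
    unfolding interp_E_def
  proof (rule the_equality)
    have "pdegree p = csize \<eta>"
      using sp lkp \<eta>c by (intro pdegree_eq [of _ _ \<eta>]) (auto elim!: supp_in_mono)
    moreover have "p \<in> polys n" unfolding polys_iff using sp by (rule supp_in_mono) auto
    ultimately show "p \<in> polys n \<and> pdegree p = csize \<eta> \<and>
       (\<forall>\<gamma> \<in> compositions n. \<gamma> \<noteq> \<eta> \<and> csize \<gamma> \<le> csize \<eta> \<longrightarrow> eval_poly p (spectral n \<gamma>) = 0) \<and>
       lk p \<eta> = 1"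
      using van lkp by blast
  next
    fix q assume q: "q \<in> polys n \<and> pdegree q = csize \<eta> \<and>
       (\<forall>\<gamma> \<in> compositions n. \<gamma> \<noteq> \<eta> \<and> csize \<gamma> \<le> csize \<eta> \<longrightarrow> eval_poly q (spectral n \<gamma>) = 0) \<and>
       lk q \<eta> = 1"
    define g where "g = q - p"
    have sq: "supp_in {\<mu> \<in> compositions n. csize \<mu> \<le> d} q"
      using q pdegree_ge [of q] \<eta>c by (auto simp: supp_in_iff polys_iff)
    have g0: "eval_poly g (spectral n \<gamma>) = 0" if "\<gamma> \<in> compositions n" "\<gamma> \<noteq> \<eta>" "csize \<gamma> \<le> d" for \<gamma>
      using that q van [OF that(1,2)] \<eta>c by (simp add: g_def eval_diff)
    have gexp: "g = (\<Sum>\<nu>\<in>level n d. Const (lk g \<nu>) * basic n \<nu>)"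
    proof (rule interp_expand [OF n])
      show "supp_in {\<mu> \<in> compositions n. csize \<mu> \<le> d} g"
        unfolding g_def by (rule supp_in_diff [OF sq sp])
      show "eval_poly g (spectral n \<gamma>) = 0" if "\<gamma> \<in> compositions n" "csize \<gamma> < d" for \<gamma>
        using g0 [of \<gamma>] that \<eta>c by auto
    qed
    \<comment> \<open>On the level \<open>g\<close> can be nonzero at \<open>\<eta>\<close> only, so
      it has the same values as \<open>u\<close> times the combination with coefficients
      \<open>c\<close>, and hence the same coefficients. Its coefficient at \<open>\<eta>\<close> is
      0, which forces \<open>u = 0\<close>.\<close>
    define u where "u = eval_poly g (spectral n \<eta>)"
    have gc: "lk g \<nu> - u * c \<nu> = 0" if "\<nu> \<in> level n d" for \<nu>
    proof (rule combination_unique [OF n _ that])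
      fix \<gamma> assume \<gamma>: "\<gamma> \<in> level n d"
      have "eval_poly (\<Sum>\<mu>\<in>level n d. Const (lk g \<mu> - u * c \<mu>) * basic n \<mu>) (spectral n \<gamma>) =
        eval_poly (\<Sum>\<mu>\<in>level n d. Const (lk g \<mu>) * basic n \<mu>) (spectral n \<gamma>) -
        u * (\<Sum>\<mu>\<in>level n d. eval_poly (basic n \<mu>) (spectral n \<gamma>) * c \<mu>)"
        unfolding eval_sum eval_Const_mult
        by (simp add: left_diff_distrib sum_subtractf sum_distrib_left mult.assoc mult.commute
            [of "eval_poly _ _"])
      also have "\<dots> = 0"
        unfolding gexp [symmetric] c(2) [OF \<gamma>]
        using g0 [of \<gamma>] \<gamma> by (auto simp: u_def level_def)
      finally show "eval_poly (\<Sum>\<mu>\<in>level n d. Const (lk g \<mu> - u * c \<mu>) * basic n \<mu>) (spectral n \<gamma>) = 0" .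
    qed
    have "lk g \<eta> = 0" using q lkp by (simp add: g_def lookup_minus)
    then have "u = 0" using gc [OF \<eta>] c\<eta> by simp
    then have "g = 0" using gc by (subst gexp) (simp add: Const_distrib)
    then show "q = p" by (simp add: g_def)
  qed
  have "p = (\<Sum>\<nu>\<in>level n d. Const (lk p \<nu>) * basic n \<nu>)"
    unfolding p_def by (rule sum.cong) (simp_all add: lookup_combination [OF n])
  then show "interp_E n \<eta> = (\<Sum>\<nu>\<in>level n d. Const (lk (interp_E n \<eta>) \<nu>) * basic n \<nu>)"
    unfolding E .
  show "lk (interp_E n \<eta>) \<eta> = 1" "eval_poly (interp_E n \<eta>) (spectral n \<eta>) \<noteq> 0"
    unfolding E using lkp ev [OF \<eta>] \<kappa> by simp_all
  show "\<gamma> \<in> level n d \<Longrightarrow> \<gamma> \<noteq> \<eta> \<Longrightarrow> eval_poly (interp_E n \<eta>) (spectral n \<gamma>) = 0"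
    unfolding E using ev by simp
qed

lemma top_component_combination:
  assumes n: "n \<ge> 1" and \<eta>: "\<eta> \<in> level n d" and e: "e \<eta> \<noteq> 0"
  shows "top_component (\<Sum>\<nu>\<in>level n d. Const (e \<nu>) * basic n \<nu>) = (\<Sum>\<nu>\<in>level n d. Const (e \<nu>) * monomial \<nu>)"
proof -
  let ?p = "\<Sum>\<nu>\<in>level n d. Const (e \<nu>) * basic n \<nu>"
  have sp: "supp_in {\<mu> \<in> compositions n. csize \<mu> \<le> d} ?p" by (rule supp_combination [OF n])
  have "pdegree ?p = d"
  proof (rule pdegree_eq)
    show "supp_in {\<mu>. csize \<mu> \<le> d} ?p" using sp by (rule supp_in_mono) auto
    show "lk ?p \<eta> \<noteq> 0" using lookup_combination [OF n \<eta>, of e] e by simp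
  qed (use \<eta> in \<open>simp add: level_def\<close>)
  then have "top_component ?p = (\<Sum>m | m \<in> Poly_Mapping.keys ?p \<and> csize m = d. Poly_Mapping.single m (lk ?p m))"
    unfolding top_component_def by simp
  also have "\<dots> = (\<Sum>m\<in>level n d. Poly_Mapping.single m (lk ?p m))"
  proof (rule sum.mono_neutral_left)
    show "{m \<in> Poly_Mapping.keys ?p. csize m = d} \<subseteq> level n d"
      using sp by (auto simp: supp_in_def level_def)
    show "\<forall>m\<in>level n d - {m \<in> Poly_Mapping.keys ?p. csize m = d}. Poly_Mapping.single m (lk ?p m) = 0"
      by (auto simp: level_def in_keys_iff)
  qed simp
  also have "\<dots> = (\<Sum>m\<in>level n d. Const (e m) * monomial m)"
    by (rule sum.cong) (simp_all add: lookup_combination [OF n] Const_mult_monomial)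
  finally show ?thesis .
qed

text \<open>The coefficients that express \<open>interp_E\<close> in the
  \<open>basic n \<nu>\<close> express its top component in monomials. This is why \<open>Xi\<close>
  sends a monomial to a reflected \<open>basic\<close> polynomial, up to sign.\<close>

lemma jack_E_expand:
  assumes n: "n \<ge> 1" and \<eta>: "\<eta> \<in> level n d"
  shows "jack_E n \<eta> = (\<Sum>\<nu>\<in>level n d. Const (lk (interp_E n \<eta>) \<nu>) * monomial \<nu>)"
  unfolding jack_E_def
  by (subst interp_E_expand(1) [OF n \<eta>], rule top_component_combination [OF n \<eta>])
    (simp add: interp_E_expand(2) [OF n \<eta>])

section \<open>The polynomials \<open>jack_F\<close> as a basis, and the operator
  \<open>Xi\<close>\<close>

lemma rvar_nonzero: "rvar \<noteq> 0"
  by (simp add: rvar_def Zero_fract_def eq_fract)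

text \<open>\<open>alpha\<close> has a pole at \<open>r = 0\<close>, so each factor is multiplied by
  \<open>r\<close>. The result \<open>a + 1 + r (l + 1)\<close> takes a positive integer value at
  \<open>r = 0\<close>.\<close>

lemma d_coeff_nonzero: "d_coeff n \<eta> \<noteq> 0"
proof -
  have "alpha * (of_nat a + 1) + of_nat l + 1 \<noteq> (0 :: ratfun)" for a l
  proof
    assume "alpha * (of_nat a + 1) + of_nat l + 1 = (0 :: ratfun)"
    then have "rvar * (alpha * (of_nat a + 1) + of_nat l + 1) = 0" by simp
    then have "of_nat (Suc a) + rvar * of_nat (Suc l) = 0"
      using rvar_nonzero by (simp add: alpha_def algebra_simps)
    moreover have "reg (of_nat (Suc a) + rvar * of_nat (Suc l)) (of_nat (Suc a) + 0 * of_nat (Suc l))"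
      by (intro reg_add reg_mult reg_rvar reg_of_nat)
    ultimately show False using reg_nonzero [of _ "of_nat (Suc a) + 0 * of_nat (Suc l)"]
      by (metis add.right_neutral mult_zero_left of_nat_neq_0)
  qed
  then show ?thesis unfolding d_coeff_def by (simp add: prod_zero_iff)
qed

lemma polys_closed:
  "p \<in> polys n \<Longrightarrow> q \<in> polys n \<Longrightarrow> p + q \<in> polys n"
  "p \<in> polys n \<Longrightarrow> Const c * p \<in> polys n"
  "0 \<in> polys n" "\<eta> \<in> compositions n \<Longrightarrow> monomial \<eta> \<in> polys n"
  by (simp_all add: polys_iff supp_in_add supp_in_Const_mult)

lemma bar_polys: "n \<ge> 1 \<Longrightarrow> \<eta> \<in> compositions n \<Longrightarrow> bar n \<eta> \<in> polys n"
  unfolding bar_def reflect_def polys_iff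
  by (intro supp_in_Const_mult supp_in_lin [where A = "compositions n"])
    (use basic_polys in \<open>auto simp: polys_iff\<close>)

lemma lin_bar_jack_F:
  assumes n: "n \<ge> 1" and \<eta>: "\<eta> \<in> compositions n"
  shows "lin (bar n) (jack_F n \<eta>) = interp_F n \<eta>" "jack_F n \<eta> \<in> polys n"
proof -
  let ?d = "csize \<eta>"
  have \<eta>l: "\<eta> \<in> level n ?d" using \<eta> by (simp add: level_def)
  define e where "e = lk (interp_E n \<eta>)"
  note E = interp_E_expand(1) [OF n \<eta>l, folded e_def]
  note j = jack_E_expand [OF n \<eta>l, folded e_def]
  show "jack_F n \<eta> \<in> polys n"
    unfolding jack_F_def j polys_iff
    by (intro supp_in_Const_mult supp_in_sum) (simp add: level_def)
  have "lin (bar n) (jack_F n \<eta>) = Const (d_coeff n \<eta>) * (\<Sum>\<nu>\<in>level n ?d. Const (e \<nu>) * bar n \<nu>)"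
    unfolding jack_F_def j by (simp add: lin_Const_mult lin_sum)
  also have "(\<Sum>\<nu>\<in>level n ?d. Const (e \<nu>) * bar n \<nu>) =
      (\<Sum>\<nu>\<in>level n ?d. Const ((- 1) ^ ?d) * (Const (e \<nu>) * reflect (basic n \<nu>)))"
    by (rule sum.cong) (simp_all add: bar_def level_def mult.left_commute)
  also have "\<dots> = Const ((- 1) ^ ?d) * reflect (interp_E n \<eta>)"
    unfolding E reflect_def lin_sum lin_Const_mult by (simp only: sum_distrib_left)
  finally show "lin (bar n) (jack_F n \<eta>) = interp_F n \<eta>"
    unfolding interp_F_def subst_uminus Const_distrib by (simp only: ac_simps)
qed

text \<open>\<open>basic n \<nu>\<close> is expanded in the \<open>interp_E n \<eta>\<close> by
  Lagrange interpolation on its level. Top components turn this into an expansion of the monomial,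
  and the nonzero factors \<open>d_coeff\<close> are divided out.\<close>

lemma monomial_jack_F:
  assumes n: "n \<ge> 1" and \<nu>: "\<nu> \<in> level n d"
  shows "\<exists>a. monomial \<nu> = (\<Sum>\<eta>\<in>level n d. Const (a \<eta>) * jack_F n \<eta>)"
proof -
  define e where "e \<eta> = lk (interp_E n \<eta>)" for \<eta>
  define \<kappa> where "\<kappa> \<eta> = eval_poly (interp_E n \<eta>) (spectral n \<eta>)" for \<eta>
  note E = interp_E_expand [OF n, of _ d, folded e_def]
  define b where "b \<eta> = eval_poly (basic n \<nu>) (spectral n \<eta>) / \<kappa> \<eta>" for \<eta>
  \<comment> \<open>The coefficients, in the \<open>basic n \<mu>\<close>, of the Lagrange expansion
    minus \<open>basic n \<nu>\<close>. This difference vanishes on the whole level, so every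
    \<open>z \<mu>\<close> is 0.\<close>
  define z where "z \<mu> = (\<Sum>\<eta>\<in>level n d. b \<eta> * e \<eta> \<mu>) - (if \<mu> = \<nu> then 1 else 0)" for \<mu>
  have z: "z \<mu> = 0" if "\<mu> \<in> level n d" for \<mu>
  proof (rule combination_unique [OF n _ that])
    fix \<gamma> assume \<gamma>: "\<gamma> \<in> level n d"
    let ?M = "\<lambda>\<mu>. eval_poly (basic n \<mu>) (spectral n \<gamma>)"
    have "(\<Sum>\<mu>\<in>level n d. (if \<mu> = \<nu> then 1 else 0) * ?M \<mu>) = (\<Sum>\<mu>\<in>level n d. if \<mu> = \<nu> then ?M \<mu> else 0)"
      by (rule sum.cong) auto
    then have 1: "(\<Sum>\<mu>\<in>level n d. (if \<mu> = \<nu> then 1 else 0) * ?M \<mu>) = ?M \<nu>" using \<nu> by simp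
    have "(\<Sum>\<mu>\<in>level n d. (\<Sum>\<eta>\<in>level n d. b \<eta> * e \<eta> \<mu>) * ?M \<mu>) =
        (\<Sum>\<eta>\<in>level n d. b \<eta> * (\<Sum>\<mu>\<in>level n d. e \<eta> \<mu> * ?M \<mu>))"
      unfolding sum_distrib_left sum_distrib_right by (subst sum.swap) (simp add: mult.assoc)
    also have "\<dots> = (\<Sum>\<eta>\<in>level n d. if \<eta> = \<gamma> then b \<gamma> * \<kappa> \<gamma> else 0)"
    proof (rule sum.cong)
      fix \<eta> assume \<eta>: "\<eta> \<in> level n d"
      have "(\<Sum>\<mu>\<in>level n d. e \<eta> \<mu> * ?M \<mu>) = eval_poly (interp_E n \<eta>) (spectral n \<gamma>)"
        by (subst E(1) [OF \<eta>]) (simp add: eval_sum eval_Const_mult)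
      then show "b \<eta> * (\<Sum>\<mu>\<in>level n d. e \<eta> \<mu> * ?M \<mu>) = (if \<eta> = \<gamma> then b \<gamma> * \<kappa> \<gamma> else 0)"
        using E(3) [OF \<eta> \<gamma>] by (auto simp: \<kappa>_def)
    qed simp
    also have "\<dots> = ?M \<nu>" using \<gamma> E(4) [OF \<gamma>] by (simp add: b_def \<kappa>_def)
    finally show "eval_poly (\<Sum>\<mu>\<in>level n d. Const (z \<mu>) * basic n \<mu>) (spectral n \<gamma>) = 0"
      using 1 by (simp add: eval_sum eval_Const_mult z_def left_diff_distrib sum_subtractf)
  qed
  have "(\<Sum>\<eta>\<in>level n d. Const (b \<eta> / d_coeff n \<eta>) * jack_F n \<eta>) =
     (\<Sum>\<eta>\<in>level n d. \<Sum>\<mu>\<in>level n d. Const (b \<eta> * e \<eta> \<mu>) * monomial \<mu>)"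
  proof (rule sum.cong)
    fix \<eta> assume \<eta>: "\<eta> \<in> level n d"
    have "jack_E n \<eta> = (\<Sum>\<mu>\<in>level n d. Const (e \<eta> \<mu>) * monomial \<mu>)"
      unfolding e_def by (rule jack_E_expand [OF n \<eta>])
    moreover have "Const (b \<eta> / d_coeff n \<eta>) * jack_F n \<eta> = Const (b \<eta>) * jack_E n \<eta>"
      unfolding jack_F_def mult.assoc [symmetric] Const_distrib(1) [symmetric] using d_coeff_nonzero by simp
    ultimately show "Const (b \<eta> / d_coeff n \<eta>) * jack_F n \<eta> =
        (\<Sum>\<mu>\<in>level n d. Const (b \<eta> * e \<eta> \<mu>) * monomial \<mu>)"
      by (simp add: sum_distrib_left Const_distrib mult.assoc)
  qed simp
  also have "\<dots> = (\<Sum>\<mu>\<in>level n d. Const (\<Sum>\<eta>\<in>level n d. b \<eta> * e \<eta> \<mu>) * monomial \<mu>)"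
  proof (subst sum.swap, rule sum.cong)
    have "Const (sum f A) = (\<Sum>i\<in>A. Const (f i) :: ratfun mvpoly)" for f and A :: "expo set"
      by (induction A rule: infinite_finite_induct) (simp_all add: Const_distrib)
    then show "(\<Sum>\<eta>\<in>level n d. Const (b \<eta> * e \<eta> \<mu>) * monomial \<mu>) =
        Const (\<Sum>\<eta>\<in>level n d. b \<eta> * e \<eta> \<mu>) * monomial \<mu>" for \<mu>
      by (simp add: sum_distrib_right)
  qed simp
  also have "\<dots> = (\<Sum>\<mu>\<in>level n d. if \<mu> = \<nu> then monomial \<mu> else 0)"
  proof (rule sum.cong)
    fix \<mu> assume "\<mu> \<in> level n d"
    from z [OF this] have "(\<Sum>\<eta>\<in>level n d. b \<eta> * e \<eta> \<mu>) = (if \<mu> = \<nu> then 1 else 0)" by (simp add: z_def)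
    then show "Const (\<Sum>\<eta>\<in>level n d. b \<eta> * e \<eta> \<mu>) * monomial \<mu> = (if \<mu> = \<nu> then monomial \<mu> else 0)"
      by (simp add: Const_distrib)
  qed simp
  also have "\<dots> = monomial \<nu>" using \<nu> by simp
  finally show ?thesis by metis
qed

text \<open>The polynomials on which both operators agree form a subspace containing all
  \<open>jack_F n \<eta>\<close>, hence all monomials, hence \<open>polys n\<close>. Elsewhere both
  are \<open>undefined\<close> by extensionality.\<close>

lemma linear_operators_eqI:
  assumes n: "n \<ge> 1" and T: "T \<in> linear_operators n" and U: "U \<in> linear_operators n"
    and eq: "\<And>\<eta>. \<eta> \<in> compositions n \<Longrightarrow> T (jack_F n \<eta>) = U (jack_F n \<eta>)"
  shows "T = U"
proof -
  define E where "E = {p \<in> polys n. T p = U p}"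
  have E_add: "p + q \<in> E" if "p \<in> E" "q \<in> E" for p q
    using that T U by (simp add: E_def linear_operators_def polys_closed)
  have E_mult: "Const c * p \<in> E" if "p \<in> E" for c p
    using that T U by (simp add: E_def linear_operators_def polys_closed)
  have E_F: "jack_F n \<eta> \<in> E" if "\<eta> \<in> compositions n" for \<eta>
    using eq [OF that] lin_bar_jack_F(2) [OF n that] by (simp add: E_def)
  have "0 \<in> compositions n" by (simp add: compositions_iff)
  then have E_0: "0 \<in> E" using E_mult [OF E_F, of 0 0] by (simp add: Const_distrib)
  have E_sum: "sum f A \<in> E" if "\<And>a. a \<in> A \<Longrightarrow> f a \<in> E" for A :: "expo set" and f
    using that by (induction A rule: infinite_finite_induct) (simp_all add: E_0 E_add)
  have E_mono: "monomial \<nu> \<in> E" if "\<nu> \<in> compositions n" for \<nu>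
  proof -
    have "\<nu> \<in> level n (csize \<nu>)" using that by (simp add: level_def)
    from monomial_jack_F [OF n this] obtain a where
      "monomial \<nu> = (\<Sum>\<eta>\<in>level n (csize \<nu>). Const (a \<eta>) * jack_F n \<eta>)" by blast
    also have "\<dots> \<in> E" by (intro E_sum E_mult E_F) (simp add: level_def)
    finally show ?thesis .
  qed
  have "p \<in> E" if "p \<in> polys n" for p
  proof -
    have "lin monomial p \<in> E"
      unfolding lin_def by (intro E_sum E_mult E_mono) (use that in \<open>auto simp: polys_def\<close>)
    then show ?thesis by (simp add: lin_id)
  qed
  then have "T p = U p" if "p \<in> polys n" for p using that by (auto simp: E_def)
  moreover have "T \<in> extensional (polys n)" "U \<in> extensional (polys n)"
    using T U by (auto simp: linear_operators_def PiE_def)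
  ultimately show ?thesis by (intro extensionalityI [of T "polys n" U])
qed

text \<open>The restriction of \<open>lin (bar n)\<close> satisfies the defining conditions by
  \<open>lin_bar_jack_F\<close> and is the only such operator by
  \<open>linear_operators_eqI\<close>.\<close>

lemma Xi_eq:
  assumes n: "n \<ge> 1"
  shows "Xi n = restrict (lin (bar n)) (polys n)" (is "_ = ?T")
  unfolding Xi_def
proof (rule the_equality)
  have "lin (bar n) p \<in> polys n" if "p \<in> polys n" for p
    using that bar_polys [OF n] unfolding polys_iff by (rule supp_in_lin) (simp add: polys_iff)
  then have T: "?T \<in> linear_operators n"
    by (auto simp: linear_operators_def polys_closed lin_add lin_Const_mult)
  moreover have F: "?T (jack_F n \<eta>) = interp_F n \<eta>" if "\<eta> \<in> compositions n" for \<eta>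
    using lin_bar_jack_F [OF n that] by simp
  ultimately show "?T \<in> linear_operators n \<and> (\<forall>\<eta>\<in>compositions n. ?T (jack_F n \<eta>) = interp_F n \<eta>)" by blast
  fix U assume "U \<in> linear_operators n \<and> (\<forall>\<eta>\<in>compositions n. U (jack_F n \<eta>) = interp_F n \<eta>)"
  then show "U = ?T" using T F by (intro linear_operators_eqI [OF n]) auto
qed

theorem theoremD:
  fixes n :: nat and \<eta> :: "nat \<Rightarrow>\<^sub>0 nat"
  assumes "n \<ge> 1" and "\<eta> \<in> compositions n"
  shows "bar_monomial n \<eta> = (\<Sum>G\<in>bar_games n \<eta>. game_weight n G)"
  using bar_games_sum [OF assms] assms
  by (simp add: bar_monomial_def Xi_eq polys_closed)

end
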